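(* Let $\Delta$ be a simplicial complex on $[n]$ with $\dim\Delta\le n-3$, let $F_1,\dots,F_q$ be a shelling of $\Delta$, and let $U_{\bar\sigma}$ be a subspace in $L_\Delta$ for some subset $\bar\sigma\subseteq[n]$. Then the order complex $\Delta(\hat0,U_{\bar\sigma})$ of the open interval $(\hat 0,U_{\bar\sigma})$ in $L_\Delta$ is homotopy equivalent to a wedge of spheres consisting of $(p-1)!$ copies of spheres of dimension $$\delta(D):=p(2-n)+\sum_{j=1}^p|F_{i_j}|+|\bar\sigma|-3$$ for each shelling-trapped decomposition $D=\{(\bar\sigma_1,F_{i_1}),\dots,(\bar\sigma_p,F_{i_p})\}$ of $\bar\sigma$. Moreover, for each such $D$ and each permutation $w$ of $[p-1]$ there is a saturated chain $C_{D,w}$ from $\hat0$ to $U_{\bar\sigma}$ in $L_\Delta$ (whose elements other than $\hat 0$ and $U_{\bar\sigma}$ form a $\delta(D)$-dimensional simplex of $\Delta(\hat0,U_{\bar\sigma})$) such that removing these simplices for all pairs $(D,w)$ from $\Delta(\hat0,U_{\bar\sigma})$ leaves a contractible simplicial complex.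
   Context: For $S\subseteq[n]$, $U_S$ is the diagonal subspace $\{u\in\mathbb{R}^n: u_i=u_j\ \forall i,j\in S\}$; $\mathcal{A}_\Delta=\{U_{[n]-F}: F\text{ facet of }\Delta\}$; $L_\Delta$ is the set of all intersections of members of $\mathcal{A}_\Delta$ (bottom $\hat0=\mathbb{R}^n$) ordered by reverse inclusion. A shelling is an ordering $F_1,\dots,F_q$ of all facets such that for each $k\ge2$, $(\bigcup_{i<k}2^{F_i})\cap2^{F_k}$ is pure of dimension $\dim F_k-1$. A wall of $F_i$ is a codimension-one face of $F_i$. Set $G_1=F_1$ and, for $i\ge2$, let $G_i$ be the intersection of all walls of $F_i$ that lie in the subcomplex generated by $F_1,\dots,F_{i-1}$. For a subset $\tau\subseteq[n]$ write $\bar\tau=[n]-\tau$. A (unordered) shelling-trapped decomposition of $\bar\sigma$ is a family $\{(\bar\sigma_1,F_{i_1}),\dots,(\bar\sigma_p,F_{i_p})\}$ with $\bar\sigma=\bigsqcup_{j=1}^p\bar\sigma_j$ a disjoint union and $F_{i_1},\dots,F_{i_p}$ facets of $\Delta$ with $G_{i_j}\subseteq\sigma_j\subseteq F_{i_j}$ for all $j$, where $\sigma_j=[n]-\bar\sigma_j$. *)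

theory Defs
  imports "HOL-Analysis.Analysis"
begin

text \<open>An (abstract) simplicial complex: a family of finite sets closed under taking subsets
  (the empty face is allowed, the void complex is the empty family).\<close>
definition simplicial_complex :: "'v set set \<Rightarrow> bool" where
  "simplicial_complex K \<longleftrightarrow> (\<forall>s\<in>K. finite s) \<and> (\<forall>s\<in>K. \<forall>t. t \<subseteq> s \<longrightarrow> t \<in> K)"

definition facets :: "'v set set \<Rightarrow> 'v set set" where
  "facets K = {F\<in>K. \<forall>G\<in>K. F \<subseteq> G \<longrightarrow> G = F}"

text \<open>Geometric realization: functions (barycentric coordinates) whose support is a face,
  with nonnegative values summing to 1, with the topology induced from the product topology.\<close>
definition geom_realization :: "'v set set \<Rightarrow> ('v \<Rightarrow> real) topology" where
  "geom_realization K = subtopology euclidean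
     {f. (\<forall>v. 0 \<le> f v) \<and> {v. f v \<noteq> 0} \<in> K \<and> sum f {v. f v \<noteq> 0} = 1}"

text \<open>The k-th sphere of dimension d (d \<ge> -1; dimension -1 gives the empty set), embedded in
  coordinates (k,0..d), centred at the unit vector e_(k,0) and of radius 1, so that all these
  spheres pass through the origin and meet pairwise only there.\<close>
definition wedge_sphere :: "nat \<Rightarrow> int \<Rightarrow> (nat \<times> nat \<Rightarrow> real) set" where
  "wedge_sphere k d = {x. (\<forall>a i. (a \<noteq> k \<or> int i > d) \<longrightarrow> x (a, i) = 0) \<and>
      (\<Sum>i\<in>{i. int i \<le> d}. (x (k, i) - (if i = 0 then 1 else 0))^2) = 1 \<and> 0 \<le> d}"

text \<open>Wedge of spheres of the dimensions listed in ds, glued at the origin; the wedge of no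
  spheres is a point.\<close>
definition wedge_of_spheres :: "int list \<Rightarrow> (nat \<times> nat \<Rightarrow> real) topology" where
  "wedge_of_spheres ds = subtopology euclidean
     ((if ds = [] then {\<lambda>_. 0} else {}) \<union> (\<Union>k<length ds. wedge_sphere k (ds ! k)))"

text \<open>[n] is the finite type 'n, n = CARD('n), R^n = real^'n.\<close>
definition diag_subspace :: "'n set \<Rightarrow> (real^'n) set" where
  "diag_subspace S = {u. \<forall>i\<in>S. \<forall>j\<in>S. u $ i = u $ j}"

definition arrangement :: "'n set set \<Rightarrow> (real^'n) set set" where
  "arrangement \<Delta> = {diag_subspace (UNIV - F) | F. F \<in> facets \<Delta>}"

text \<open>Intersection lattice L_\<Delta> (ordered by reverse inclusion); the empty intersection is R^n.\<close>
definition intersection_lattice :: "'n set set \<Rightarrow> (real^'n) set set" where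
  "intersection_lattice \<Delta> = {\<Inter>S | S. S \<subseteq> arrangement \<Delta>}"

text \<open>Vertices of the open interval (0,U) of L_\<Delta> (0 = R^n, reverse inclusion).\<close>
definition open_interval :: "'n set set \<Rightarrow> (real^'n) set \<Rightarrow> (real^'n) set set" where
  "open_interval \<Delta> U = {X \<in> intersection_lattice \<Delta>. U \<subset> X \<and> X \<subset> UNIV}"

definition order_complex_interval :: "'n set set \<Rightarrow> (real^'n) set \<Rightarrow> (real^'n) set set set" where
  "order_complex_interval \<Delta> U = {c. c \<subseteq> open_interval \<Delta> U \<and> finite c \<and>
      (\<forall>X\<in>c. \<forall>Y\<in>c. X \<subseteq> Y \<or> Y \<subseteq> X)}"

definition saturated_chain :: "'n set set \<Rightarrow> (real^'n) set \<Rightarrow> (real^'n) set set \<Rightarrow> bool" where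
  "saturated_chain \<Delta> U C \<longleftrightarrow> C \<subseteq> intersection_lattice \<Delta> \<and> UNIV \<in> C \<and> U \<in> C \<and>
     (\<forall>X\<in>C. U \<subseteq> X) \<and> (\<forall>X\<in>C. \<forall>Y\<in>C. X \<subseteq> Y \<or> Y \<subseteq> X) \<and>
     (\<forall>X\<in>intersection_lattice \<Delta>. U \<subseteq> X \<and> (\<forall>Y\<in>C. X \<subseteq> Y \<or> Y \<subseteq> X) \<longrightarrow> X \<in> C)"

definition pure_of_dim :: "'v set set \<Rightarrow> int \<Rightarrow> bool" where
  "pure_of_dim K d \<longleftrightarrow> (\<forall>F\<in>facets K. int (card F) = d + 1)"

text \<open>A shelling: a list F_1,...,F_q (here 0-indexed) of all facets, without repetitions, such that
  for k \<ge> 2 the intersection of the complex generated by earlier facets with 2^F_k is pure of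
  dimension dim F_k - 1.\<close>
definition shelling :: "'v set set \<Rightarrow> 'v set list \<Rightarrow> bool" where
  "shelling \<Delta> Fs \<longleftrightarrow> distinct Fs \<and> set Fs = facets \<Delta> \<and>
     (\<forall>k. 0 < k \<and> k < length Fs \<longrightarrow>
        pure_of_dim {t. t \<subseteq> Fs ! k \<and> (\<exists>i<k. t \<subseteq> Fs ! i)} (int (card (Fs ! k)) - 2))"

definition old_walls :: "'v set list \<Rightarrow> nat \<Rightarrow> 'v set set" where
  "old_walls Fs i = {Fs ! i - {v} | v. v \<in> Fs ! i \<and> (\<exists>j<i. Fs ! i - {v} \<subseteq> Fs ! j)}"

definition shelling_G :: "'v set list \<Rightarrow> nat \<Rightarrow> 'v set" where
  "shelling_G Fs i = (if i = 0 then Fs ! 0 else Fs ! i \<inter> \<Inter>(old_walls Fs i))"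

definition shelling_trapped_decomp ::
  "'n set list \<Rightarrow> 'n set \<Rightarrow> ('n set \<times> 'n set) set \<Rightarrow> bool" where
  "shelling_trapped_decomp Fs \<sigma>bar D \<longleftrightarrow> finite D \<and>
     \<Union>(fst ` D) = \<sigma>bar \<and>
     (\<forall>a\<in>D. \<forall>b\<in>D. a \<noteq> b \<longrightarrow> fst a \<inter> fst b = {}) \<and>
     (\<forall>(\<tau>bar, F)\<in>D. \<exists>i<length Fs. Fs ! i = F \<and>
         shelling_G Fs i \<subseteq> UNIV - \<tau>bar \<and> UNIV - \<tau>bar \<subseteq> F)"

definition decomp_dim :: "('n::finite set \<times> 'n set) set \<Rightarrow> 'n set \<Rightarrow> int" where
  "decomp_dim D \<sigma>bar = int (card D) * (2 - int CARD('n)) + (\<Sum>d\<in>D. int (card (snd d)))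
      + int (card \<sigma>bar) - 3"

end

theory Submission
  imports Defs
begin

text \<open>
  Let \<open>E\<^sub>i\<close> be the complement of \<open>F\<^sub>i\<close>. In a shelled complex any two of these sets are connected
  through others inside their union, so \<open>L\<^sub>\<Delta>\<close> is the poset of disjoint families of unions of
  \<open>E\<^sub>i\<close>'s under refinement. Replacing unions of \<open>E\<^sub>i\<close>'s by arbitrary supersets of some \<open>E\<^sub>i\<close> enlarges
  an interval to one that collapses back onto it.

  In the enlarged interval below \<open>{B}\<close>, start with the families whose union is not \<open>B\<close>
  and add the families \<open>P\<close> with \<open>\<Union>P = B\<close> one at a time. The link of \<open>P\<close> is a join: its upper part
  is a partition lattice, from which \<open>(p-1)!\<close> maximal chains can be removed so that the
  rest collapses; its lower part reduces to the subsets of \<open>B\<close> that meet each block of \<open>P\<close> in the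
  empty set or in a superset of some \<open>E\<^sub>i\<close>, where the shelling allows removing one maximal
  chain for every choice of a trapping facet in each block. Every chain removed in this way already
  consists of unions of \<open>E\<^sub>i\<close>'s.

  What remains collapses to nothing, hence is contractible, and a complex obtained
  from a contractible one by attaching simplices along their boundaries is a wedge of spheres.
\<close>

section \<open>Collapses of simplicial complexes\<close>

text \<open>Collapses run down to the void complex, with the empty face allowed as a free face. In
  this convention a single vertex collapses to nothing, whereas \<open>{{}}\<close> does so only
  once the empty simplex itself has been removed. The gain is a product rule: if
  \<open>K - S\<close> and \<open>L - R\<close> collapse to nothing, so does the join of
  \<open>K\<close> and \<open>L\<close> without the joins of members of \<open>S\<close> and
  \<open>R\<close>. Links in an order complex are joins of a lower and an upper part, so numbers of
  removed chains multiply when an element is inserted, and empty lower or upper parts need no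
  separate treatment.

  The obstacle is that a removed chain must be a facet in several posets at once: the stages of the
  construction, the enlarged interval and the interval of the lattice. Chains are therefore carried
  as saturated chains among all families; such a chain stays maximal in every smaller poset that
  contains it. In the enlarged poset a block may grow by any single point, so saturated chains are
  built point by point and their lengths are differences of cardinalities; this is the origin of the
  dimension formula.\<close>

inductive collapses :: "'v set set \<Rightarrow> 'v set set \<Rightarrow> bool" where
  refl: "collapses K K"
| step: "t \<in> K \<Longrightarrow> v \<notin> t \<Longrightarrow> insert v t \<in> K \<Longrightarrow> \<forall>s\<in>K. t \<subseteq> s \<longrightarrow> s = t \<or> s = insert v t
    \<Longrightarrow> collapses (K - {t, insert v t}) L \<Longrightarrow> collapses K L"

lemma collapses_trans: "collapses K L \<Longrightarrow> collapses L M \<Longrightarrow> collapses K M"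
proof (induction rule: collapses.induct)
  case (step t K v L)
  show ?case by (rule collapses.step[OF step.hyps(1-4) step.IH[OF step.prems]])
qed

lemma simplicial_complexD:
  assumes "simplicial_complex K" "s \<in> K"
  shows "finite s" and "t \<subseteq> s \<Longrightarrow> t \<in> K" and "{} \<in> K"
  using assms unfolding simplicial_complex_def by auto

lemma simplicial_complex_diff_facets:
  assumes "simplicial_complex K" "S \<subseteq> facets K"
  shows "simplicial_complex (K - S)"
  unfolding simplicial_complex_def
proof (intro conjI ballI allI impI)
  fix s assume s: "s \<in> K - S"
  then show "finite s" using assms(1) simplicial_complexD(1) by blast
  fix t assume ts: "t \<subseteq> s"
  have "t \<in> K" using s ts assms(1) simplicial_complexD(2) by blast
  moreover have "t \<notin> S"
  proof
    assume "t \<in> S"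
    then have "s = t" using assms(2) s ts unfolding facets_def by auto
    then show False using s \<open>t \<in> S\<close> by auto
  qed
  ultimately show "t \<in> K - S" by auto
qed

lemma simplicial_complex_remove_free_pair:
  assumes "simplicial_complex K" "\<forall>s\<in>K. t \<subseteq> s \<longrightarrow> s = t \<or> s = insert v t"
  shows "simplicial_complex (K - {t, insert v t})"
  unfolding simplicial_complex_def
proof (intro conjI ballI allI impI)
  fix s assume s: "s \<in> K - {t, insert v t}"
  then show "finite s" using assms(1) simplicial_complexD(1) by blast
  fix r assume rs: "r \<subseteq> s"
  have "r \<in> K" using s rs assms(1) simplicial_complexD(2) by blast
  moreover have "\<not> t \<subseteq> r" using assms(2) s rs by auto
  ultimately show "r \<in> K - {t, insert v t}" by auto
qed

text \<open>Faces pair off as \<open>t\<close> and \<open>insert a t\<close>. A face maximal among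
  those avoiding \<open>a\<close> is free, because a face above it can differ only by
  \<open>a\<close>, and removing the pair preserves closure under inserting
  \<open>a\<close>.\<close>

lemma collapses_cone:
  assumes "finite K" "simplicial_complex K" "\<forall>s\<in>K. insert a s \<in> K"
  shows "collapses K {}"
  using assms
proof (induction "card K" arbitrary: K rule: less_induct)
  case less
  show ?case
  proof (cases "K = {}")
    case True
    then show ?thesis by (simp add: collapses.refl)
  next
    case False
    define A where "A = {s\<in>K. a \<notin> s}"
    have "{} \<in> A" using False simplicial_complexD(3)[OF less.prems(2)] unfolding A_def by blast
    moreover have "finite A" using less.prems(1) unfolding A_def by auto
    ultimately obtain t where t: "t \<in> A" and max: "\<forall>s\<in>A. t \<subseteq> s \<longrightarrow> t = s"
      using finite_has_maximal by blast
    have tK: "t \<in> K" "a \<notin> t" "insert a t \<in> K" using t less.prems(3) unfolding A_def by auto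
    have free: "\<forall>s\<in>K. t \<subseteq> s \<longrightarrow> s = t \<or> s = insert a t"
    proof (intro ballI impI)
      fix s assume s: "s \<in> K" "t \<subseteq> s"
      have "s - {a} \<in> A" using s simplicial_complexD(2)[OF less.prems(2) s(1)] unfolding A_def by auto
      moreover have "t \<subseteq> s - {a}" using s tK by auto
      ultimately have "t = s - {a}" using max by auto
      then show "s = t \<or> s = insert a t" by auto
    qed
    let ?K' = "K - {t, insert a t}"
    have "collapses ?K' {}"
    proof (rule less.hyps)
      show "card ?K' < card K" using tK less.prems(1) by (auto intro!: psubset_card_mono)
      show "finite ?K'" using less.prems(1) by auto
      show "simplicial_complex ?K'"
        by (rule simplicial_complex_remove_free_pair[OF less.prems(2) free])
      show "\<forall>s\<in>?K'. insert a s \<in> ?K'"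
      proof
        fix s assume s: "s \<in> ?K'"
        have "insert a s \<noteq> t" using tK by auto
        moreover have "insert a s \<noteq> insert a t"
        proof
          assume eq: "insert a s = insert a t"
          show False
          proof (cases "a \<in> s")
            case True then show ?thesis using eq s by auto
          next
            case False
            then have "s = t" using eq tK(2) by (metis insert_ident)
            then show ?thesis using s by auto
          qed
        qed
        ultimately show "insert a s \<in> ?K'" using s less.prems(3) by auto
      qed
    qed
    then show ?thesis using collapses.step[OF tK(1,2,3) free] by blast
  qed
qed

text \<open>\<open>N\<close> is the link of \<open>s\<close> in the larger complex.\<close>
lemma collapses_star:
  assumes "collapses N M" "M = {}" "simplicial_complex N" "simplicial_complex A"
    "\<forall>m\<in>N. m \<inter> s = {}" "\<forall>m\<in>N. s \<union> m \<notin> A"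
  shows "collapses (A \<union> (\<union>) s ` N) A"
  using assms
proof (induction rule: collapses.induct)
  case (refl K)
  then show ?case by (simp add: collapses.refl)
next
  case (step t K v L)
  have sA: "r \<notin> A" if "s \<subseteq> r" for r
  proof
    assume "r \<in> A"
    then have "s \<in> A" using that simplicial_complexD(2) step.prems(3) by blast
    moreover have "{} \<in> K" using simplicial_complexD(3) step.prems(2) step.hyps(1) by blast
    ultimately show False using step.prems(5) by force
  qed
  let ?X = "A \<union> (\<union>) s ` K"
  have vs: "v \<notin> s" using bspec[OF step.prems(4) step.hyps(3)] by auto
  have free: "\<forall>r\<in>?X. s \<union> t \<subseteq> r \<longrightarrow> r = s \<union> t \<or> r = insert v (s \<union> t)"
  proof (intro ballI impI)
    fix r assume r: "r \<in> ?X" "s \<union> t \<subseteq> r"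
    then obtain m where m: "m \<in> K" "r = s \<union> m" using sA by auto
    have "t \<subseteq> m" using r(2) m bspec[OF step.prems(4) step.hyps(1)] by auto
    then have "m = t \<or> m = insert v t" using step.hyps(4) m by blast
    then show "r = s \<union> t \<or> r = insert v (s \<union> t)" using m by auto
  qed
  have inj: "inj_on ((\<union>) s) K"
  proof (rule inj_onI)
    fix x y assume "x \<in> K" "y \<in> K" "s \<union> x = s \<union> y"
    moreover have "x \<inter> s = {}" "y \<inter> s = {}" using step.prems(4) calculation by auto
    ultimately show "x = y" by blast
  qed
  have eq: "?X - {s \<union> t, insert v (s \<union> t)} = A \<union> (\<union>) s ` (K - {t, insert v t})"
  proof -
    have "(\<union>) s ` (K - {t, insert v t}) = (\<union>) s ` K - (\<union>) s ` {t, insert v t}"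
      using inj step.hyps(1,3) by (intro inj_on_image_set_diff) auto
    moreover have "A \<inter> {s \<union> t, insert v (s \<union> t)} = {}" using sA[of "s \<union> t"] sA[of "insert v (s \<union> t)"] by auto
    ultimately show ?thesis by auto
  qed
  have "collapses (A \<union> (\<union>) s ` (K - {t, insert v t})) A"
    using step.prems simplicial_complex_remove_free_pair[OF step.prems(2) step.hyps(4)]
    by (intro step.IH) auto
  then have "collapses (?X - {s \<union> t, insert v (s \<union> t)}) A" using eq by simp
  moreover have "s \<union> t \<in> ?X" "insert v (s \<union> t) \<in> ?X"
    using imageI[OF step.hyps(1), of "(\<union>) s"] imageI[OF step.hyps(3), of "(\<union>) s"] by auto
  moreover have "v \<notin> s \<union> t" using vs step.hyps(2) by auto
  ultimately show ?case using free by (metis collapses.step)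
qed

definition complex_join :: "'v set set \<Rightarrow> 'v set set \<Rightarrow> 'v set set" where
  "complex_join K L = {k \<union> l | k l. k \<in> K \<and> l \<in> L}"

lemma simplicial_complex_join:
  assumes "simplicial_complex K" "simplicial_complex L"
  shows "simplicial_complex (complex_join K L)"
  unfolding simplicial_complex_def
proof safe
  fix s assume "s \<in> complex_join K L"
  then obtain k l where kl: "k \<in> K" "l \<in> L" "s = k \<union> l" unfolding complex_join_def by auto
  show "finite s" using kl assms simplicial_complexD(1) by blast
  fix t assume "t \<subseteq> s"
  then have "t = (t \<inter> k) \<union> (t \<inter> l)" using kl by auto
  moreover have "t \<inter> k \<in> K" "t \<inter> l \<in> L" using kl assms simplicial_complexD(2) by (meson Int_lower2)+
  ultimately show "t \<in> complex_join K L" unfolding complex_join_def by blast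
qed

text \<open>The faces of the join that contain a free face \<open>t\<close> of \<open>K\<close> form
  a star whose link is the cone over \<open>L\<close> with apex \<open>v\<close>. That link
  collapses to nothing, so the whole star can be removed, which deletes the free pair from the
  factor \<open>K\<close>.\<close>

lemma collapses_join:
  assumes "collapses K M" "M = {}" "simplicial_complex K" "simplicial_complex L" "finite L"
    "\<forall>k\<in>K. \<forall>l\<in>L. k \<inter> l = {}"
  shows "collapses (complex_join K L) {}"
  using assms
proof (induction rule: collapses.induct)
  case (refl K)
  then show ?case by (simp add: complex_join_def collapses.refl)
next
  case (step t K v M)
  show ?case
  proof (cases "L = {}")
    case True
    then show ?thesis by (simp add: complex_join_def collapses.refl)
  next
    case False
    let ?K' = "K - {t, insert v t}"
    let ?N = "L \<union> insert v ` L"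
    have K': "simplicial_complex ?K'"
      by (rule simplicial_complex_remove_free_pair[OF step.prems(2) step.hyps(4)])
    have tL: "t \<inter> l = {}" and vL: "v \<notin> l" if "l \<in> L" for l
      using bspec[OF bspec[OF step.prems(5) step.hyps(1)] that]
        bspec[OF bspec[OF step.prems(5) step.hyps(3)] that] by auto
    have N: "simplicial_complex ?N"
      unfolding simplicial_complex_def
    proof (intro conjI ballI allI impI)
      fix s assume s: "s \<in> ?N"
      then obtain l where l: "l \<in> L" "s \<subseteq> insert v l" by auto
      then show "finite s" using simplicial_complexD(1)[OF step.prems(3) l(1)] finite_subset by blast
      fix t assume "t \<subseteq> s"
      then have "t - {v} \<subseteq> l" using l by auto
      then have tL: "t - {v} \<in> L" by (rule simplicial_complexD(2)[OF step.prems(3) l(1)])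
      show "t \<in> ?N"
      proof (cases "v \<in> t")
        case True
        then have "t = insert v (t - {v})" by auto
        then show ?thesis using tL by blast
      next
        case False
        then show ?thesis using tL by auto
      qed
    qed
    have cN: "collapses ?N {}"
      using step.prems(4) by (intro collapses_cone[OF _ N, of v]) auto
    have eq: "complex_join K L = complex_join ?K' L \<union> (\<union>) t ` ?N"
      (is "?l = ?r")
    proof
      show "?l \<subseteq> ?r"
      proof
        fix x assume "x \<in> ?l"
        then obtain k l where kl: "k \<in> K" "l \<in> L" "x = k \<union> l" unfolding complex_join_def by auto
        consider "k \<in> ?K'" | "k = t" | "k = insert v t" using kl by auto
        then show "x \<in> ?r"
        proof cases
          case 1 then show ?thesis using kl unfolding complex_join_def by auto
        next
          case 2 then show ?thesis using kl by auto
        next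
          case 3 then have "x = t \<union> insert v l" using kl by auto
          then show ?thesis using kl(2) by blast
        qed
      qed
      show "?r \<subseteq> ?l"
      proof
        fix x assume "x \<in> ?r"
        then consider k l where "k \<in> K" "l \<in> L" "x = k \<union> l" | l where "l \<in> L" "x = t \<union> l"
          | l where "l \<in> L" "x = insert v t \<union> l"
          unfolding complex_join_def by auto
        then show "x \<in> ?l" using step.hyps(1,3) unfolding complex_join_def by cases blast+
      qed
    qed
    have "collapses (complex_join ?K' L \<union> (\<union>) t ` ?N) (complex_join ?K' L)"
    proof (rule collapses_star[OF cN HOL.refl N simplicial_complex_join[OF K' step.prems(3)]])
      show "\<forall>m\<in>?N. m \<inter> t = {}" using tL step.hyps(2) by auto
      show "\<forall>m\<in>?N. t \<union> m \<notin> complex_join ?K' L"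
      proof (intro ballI notI)
        fix m assume m: "m \<in> ?N" "t \<union> m \<in> complex_join ?K' L"
        then obtain k l where kl: "k \<in> ?K'" "l \<in> L" "t \<union> m = k \<union> l" unfolding complex_join_def by auto
        have "t \<inter> l = {}" using tL kl by auto
        then have "t \<subseteq> k" using kl by blast
        then show False using kl(1) step.hyps(4) by blast
      qed
    qed
    moreover have "collapses (complex_join ?K' L) {}"
      using step.prems K' by (intro step.IH) auto
    ultimately show ?thesis unfolding eq by (rule collapses_trans)
  qed
qed

text \<open>The complex is \<open>complex_join (K - S) L\<close> together with the joins of members
  of \<open>S\<close> with \<open>L - R\<close>. Each \<open>s\<close> in \<open>S\<close> then has
  the link \<open>L - R\<close>, which collapses, so the members of \<open>S\<close> are dropped one
  by one; what remains is a join whose factor \<open>K - S\<close> collapses.\<close>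

lemma collapses_join_diff_facets:
  assumes K: "simplicial_complex K" "finite K" and L: "simplicial_complex L" "finite L"
    and dis: "\<forall>k\<in>K. \<forall>l\<in>L. k \<inter> l = {}"
    and S: "S \<subseteq> facets K" "collapses (K - S) {}"
    and R: "R \<subseteq> facets L" "collapses (L - R) {}"
  shows "collapses (complex_join K L - complex_join S R) {}"
proof -
  have SK: "S \<subseteq> K" and RL: "R \<subseteq> L" using S R unfolding facets_def by auto
  note cKS = simplicial_complex_diff_facets[OF K(1) S(1)]
  note cLR = simplicial_complex_diff_facets[OF L(1) R(1)]
  let ?X = "\<lambda>S'. complex_join (K - S) L \<union> complex_join S' (L - R)"
  have uniq: "k = k' \<and> l = l'" if "k \<union> l = k' \<union> l'" "k \<in> K" "k' \<in> K" "l \<in> L" "l' \<in> L" for k k' l l'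
  proof -
    have "k \<inter> l = {}" "k' \<inter> l' = {}" "k \<inter> l' = {}" "k' \<inter> l = {}" using that dis by auto
    then show ?thesis using that(1) by blast
  qed
  have eq: "complex_join K L - complex_join S R = ?X S"
  proof
    show "complex_join K L - complex_join S R \<subseteq> ?X S"
    proof
      fix x assume x: "x \<in> complex_join K L - complex_join S R"
      then obtain k l where kl: "k \<in> K" "l \<in> L" "x = k \<union> l" unfolding complex_join_def by auto
      then have "k \<in> K - S \<or> (k \<in> S \<and> l \<in> L - R)" using x unfolding complex_join_def by auto
      then show "x \<in> ?X S" using kl unfolding complex_join_def by auto
    qed
    show "?X S \<subseteq> complex_join K L - complex_join S R"
    proof
      fix x assume "x \<in> ?X S"
      then consider k l where "k \<in> K - S" "l \<in> L" "x = k \<union> l" | k l where "k \<in> S" "l \<in> L - R" "x = k \<union> l"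
        unfolding complex_join_def by auto
      then obtain k l where kl: "k \<in> K" "l \<in> L" "x = k \<union> l" "k \<notin> S \<or> l \<notin> R"
        using SK by cases auto
      have "x \<notin> complex_join S R"
      proof
        assume "x \<in> complex_join S R"
        then obtain k' l' where "k' \<in> S" "l' \<in> R" "x = k' \<union> l'" unfolding complex_join_def by auto
        then show False using uniq[of k l k' l'] kl SK RL by auto
      qed
      then show "x \<in> complex_join K L - complex_join S R" using kl unfolding complex_join_def by auto
    qed
  qed
  have cX: "simplicial_complex (?X S')" if "S' \<subseteq> S" for S'
    unfolding simplicial_complex_def
  proof safe
    fix s assume s: "s \<in> complex_join (K - S) L"
    note c = simplicial_complex_join[OF cKS L(1)]
    show "finite s" using simplicial_complexD(1)[OF c s] .
    fix t assume "t \<subseteq> s" "t \<notin> complex_join S' (L - R)"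
    then show "t \<in> complex_join (K - S) L" using simplicial_complexD(2)[OF c s] by auto
  next
    fix s assume "s \<in> complex_join S' (L - R)"
    then obtain k l where kl: "k \<in> S'" "l \<in> L - R" "s = k \<union> l" unfolding complex_join_def by auto
    have kK: "k \<in> K" using kl that SK by auto
    show "finite s" using kl simplicial_complexD(1)[OF K(1) kK] simplicial_complexD(1)[OF cLR kl(2)] by auto
    fix t assume t: "t \<subseteq> s" "t \<notin> complex_join S' (L - R)"
    have teq: "t = (t \<inter> k) \<union> (t \<inter> l)" using t(1) kl by auto
    have tl: "t \<inter> l \<in> L - R" using simplicial_complexD(2)[OF cLR kl(2)] by auto
    \<comment> \<open>A proper part of the facet \<open>k\<close> is not a facet and hence not in
      \<open>S\<close>. So faces that lose a vertex of \<open>k\<close> fall back into the join over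
      \<open>K - S\<close>, and every intermediate stage is a complex.\<close>
    have "t \<inter> k \<noteq> k" using t(2) teq tl kl(1) unfolding complex_join_def by blast
    moreover have "t \<inter> k \<in> K" using simplicial_complexD(2)[OF K(1) kK] by auto
    ultimately have "t \<inter> k \<in> K - S" using S(1) kK unfolding facets_def by blast
    then show "t \<in> complex_join (K - S) L" using teq tl unfolding complex_join_def by blast
  qed
  have "finite S" using SK K(2) finite_subset by auto
  have main: "collapses (?X S') (complex_join (K - S) L)" if "finite S'" "S' \<subseteq> S" for S'
    using that
  proof (induction rule: finite_subset_induct')
    case empty
    then show ?case by (simp add: complex_join_def collapses.refl)
  next
    case (insert s S')
    have eq': "?X (insert s S') = ?X S' \<union> (\<union>) s ` (L - R)" unfolding complex_join_def by auto
    have "collapses (?X S' \<union> (\<union>) s ` (L - R)) (?X S')"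
    proof (rule collapses_star[OF R(2) HOL.refl cLR cX[OF insert.hyps(3)]])
      show "\<forall>m\<in>L - R. m \<inter> s = {}" using dis insert.hyps SK by (auto simp: Int_commute)
      show "\<forall>m\<in>L - R. s \<union> m \<notin> ?X S'"
      proof (intro ballI notI)
        fix m assume m: "m \<in> L - R" "s \<union> m \<in> ?X S'"
        then obtain k l where kl: "k \<in> K - S \<or> k \<in> S'" "l \<in> L" "s \<union> m = k \<union> l"
          unfolding complex_join_def by auto
        have "s = k" using uniq[OF kl(3)] m kl insert.hyps SK by auto
        then show False using kl insert.hyps by auto
      qed
    qed
    then show ?case unfolding eq' using insert.IH by (rule collapses_trans)
  qed
  have "\<forall>k\<in>K - S. \<forall>l\<in>L. k \<inter> l = {}" using dis by (meson DiffD1)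
  then have "collapses (complex_join (K - S) L) {}"
    by (rule collapses_join[OF S(2) HOL.refl cKS L])
  then show ?thesis unfolding eq by (rule collapses_trans[OF main[OF \<open>finite S\<close> subset_refl]])
qed

lemma collapses_image:
  assumes "collapses K L" "inj_on f (\<Union>K)"
  shows "collapses ((`) f ` K) ((`) f ` L)"
  using assms
proof (induction rule: collapses.induct)
  case (refl K)
  then show ?case by (simp add: collapses.refl)
next
  case (step t K v L)
  have vt: "v \<in> \<Union>K" "t \<subseteq> \<Union>K" using step.hyps(1,3) by auto
  have inj: "inj_on ((`) f) K" using step.prems
    by (intro inj_onI) (meson Sup_upper inj_on_image_eq_iff)
  have "(`) f ` (K - {t, insert v t}) = (`) f ` K - {f ` t, insert (f v) (f ` t)}"
    using inj_on_image_set_diff[OF inj, of K "{t, insert v t}"] step.hyps(1,3) by auto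
  moreover have "collapses ((`) f ` (K - {t, insert v t})) ((`) f ` L)"
    by (rule step.IH, rule inj_on_subset[OF step.prems]) auto
  moreover have "f v \<notin> f ` t" using step.prems vt step.hyps(2) by (simp add: inj_on_image_mem_iff)
  moreover have "\<forall>s\<in>(`) f ` K. f ` t \<subseteq> s \<longrightarrow> s = f ` t \<or> s = insert (f v) (f ` t)"
  proof (intro ballI impI)
    fix s assume "s \<in> (`) f ` K" "f ` t \<subseteq> s"
    then obtain s' where s': "s' \<in> K" "s = f ` s'" by auto
    then have "t \<subseteq> s'" using \<open>f ` t \<subseteq> s\<close> step.prems vt(2)
      by (metis Sup_upper inj_on_image_subset_iff)
    then show "s = f ` t \<or> s = insert (f v) (f ` t)" using s' step.hyps(4) by auto
  qed
  moreover have "f ` t \<in> (`) f ` K" "insert (f v) (f ` t) \<in> (`) f ` K"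
    using imageI[OF step.hyps(1), of "(`) f"] imageI[OF step.hyps(3), of "(`) f"] by auto
  ultimately show ?case by (metis collapses.step)
qed

section \<open>Order complexes with removable maximal chains\<close>

definition comparable :: "('a \<Rightarrow> 'a \<Rightarrow> bool) \<Rightarrow> 'a \<Rightarrow> 'a \<Rightarrow> bool" where
  "comparable lt x y \<longleftrightarrow> x = y \<or> lt x y \<or> lt y x"

definition order_complex :: "('a \<Rightarrow> 'a \<Rightarrow> bool) \<Rightarrow> 'a set \<Rightarrow> 'a set set" where
  "order_complex lt X = {c. c \<subseteq> X \<and> finite c \<and> (\<forall>x\<in>c. \<forall>y\<in>c. comparable lt x y)}"

definition max_chain :: "('a \<Rightarrow> 'a \<Rightarrow> bool) \<Rightarrow> 'a set \<Rightarrow> 'a set \<Rightarrow> bool" where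
  "max_chain lt X c \<longleftrightarrow> c \<in> order_complex lt X \<and> (\<forall>x\<in>X. (\<forall>y\<in>c. comparable lt x y) \<longrightarrow> x \<in> c)"

text \<open>The chains in \<open>S\<close> may differ in length, and this is where spheres of
  several dimensions come from. With \<open>S = {}\<close> the whole order complex
  collapses.\<close>

definition good :: "('a \<Rightarrow> 'a \<Rightarrow> bool) \<Rightarrow> 'a set \<Rightarrow> 'a set set \<Rightarrow> bool" where
  "good lt X S \<longleftrightarrow> finite X \<and> (\<forall>c\<in>S. max_chain lt X c) \<and> collapses (order_complex lt X - S) {}"

definition glue :: "'a set set \<Rightarrow> 'a \<Rightarrow> 'a set set \<Rightarrow> 'a set set" where
  "glue A x T = {s \<union> insert x t | s t. s \<in> A \<and> t \<in> T}"

lemma comparable_commute: "comparable lt x y \<longleftrightarrow> comparable lt y x"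
  unfolding comparable_def by auto

lemma chains_converse: "order_complex (\<lambda>x y. lt y x) X = order_complex lt X"
proof -
  have "comparable (\<lambda>x y. lt y x) = comparable lt" by (auto simp: comparable_def fun_eq_iff)
  then show ?thesis unfolding order_complex_def by simp
qed

lemma chainsD: "c \<in> order_complex lt X \<Longrightarrow> c \<subseteq> X" "c \<in> order_complex lt X \<Longrightarrow> finite c"
  "c \<in> order_complex lt X \<Longrightarrow> x \<in> c \<Longrightarrow> y \<in> c \<Longrightarrow> comparable lt x y"
  unfolding order_complex_def by auto

lemma chains_empty [simp]: "order_complex lt {} = {{}}"
  unfolding order_complex_def by auto

lemma simplicial_complex_chains: "simplicial_complex (order_complex lt X)"
  unfolding simplicial_complex_def order_complex_def by (auto intro: finite_subset)

lemma finite_chains: "finite X \<Longrightarrow> finite (order_complex lt X)"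
  by (rule finite_subset[of _ "Pow X"]) (auto dest: chainsD)

lemma max_chain_facet:
  assumes "max_chain lt X c"
  shows "c \<in> facets (order_complex lt X)"
  unfolding facets_def
proof (intro CollectI conjI ballI impI)
  show "c \<in> order_complex lt X" using assms unfolding max_chain_def by auto
  fix d assume d: "d \<in> order_complex lt X" "c \<subseteq> d"
  have "x \<in> c" if "x \<in> d" for x
  proof -
    have "x \<in> X" "\<forall>y\<in>c. comparable lt x y" using d that chainsD[OF d(1)] by auto
    then show ?thesis using assms unfolding max_chain_def by auto
  qed
  then show "d = c" using d by auto
qed

lemma max_chain_subset: "max_chain lt X c \<Longrightarrow> c \<subseteq> Y \<Longrightarrow> Y \<subseteq> X \<Longrightarrow> max_chain lt Y c"
  unfolding max_chain_def order_complex_def by (simp add: subset_iff)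

lemma goodD:
  assumes "good lt X S"
  shows "finite X" "c \<in> S \<Longrightarrow> max_chain lt X c" "c \<in> S \<Longrightarrow> c \<subseteq> X" "S \<subseteq> facets (order_complex lt X)"
    "collapses (order_complex lt X - S) {}"
proof -
  show "finite X" "collapses (order_complex lt X - S) {}" using assms unfolding good_def by auto
  have m: "max_chain lt X c" if "c \<in> S" for c using assms that unfolding good_def by auto
  then show "c \<in> S \<Longrightarrow> max_chain lt X c" .
  show "c \<in> S \<Longrightarrow> c \<subseteq> X" using m[of c] chainsD(1)[of c lt X] unfolding max_chain_def by auto
  show "S \<subseteq> facets (order_complex lt X)" using m max_chain_facet[of lt X] by auto
qed

text \<open>The unit for gluing: it is the lower factor of an inserted element that has nothing
  below it, where the empty chain is the one to remove.\<close>

lemma good_empty: "good lt {} {{}}"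
  unfolding good_def max_chain_def by (simp add: collapses.refl)

lemma chains_cone:
  assumes "finite X" "a \<in> X" "\<forall>x\<in>X. comparable lt a x"
  shows "collapses (order_complex lt X) {}"
proof (rule collapses_cone[OF finite_chains[OF assms(1)] simplicial_complex_chains])
  show "\<forall>s\<in>order_complex lt X. insert a s \<in> order_complex lt X"
  proof
    fix s assume s: "s \<in> order_complex lt X"
    have "comparable lt x a" if "x \<in> s" for x
      using assms(3) chainsD(1)[OF s] that comparable_commute by (metis subsetD)
    then show "insert a s \<in> order_complex lt X"
      using s assms(2,3) unfolding order_complex_def by (auto simp: comparable_def)
  qed
qed

section \<open>Inserting and discarding elements of a finite poset\<close>

locale strict_poset =
  fixes lt :: "'a \<Rightarrow> 'a \<Rightarrow> bool"
  assumes irrefl: "\<not> lt x x" and trans: "lt x y \<Longrightarrow> lt y z \<Longrightarrow> lt x z"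
begin

lemma asym: "lt x y \<Longrightarrow> \<not> lt y x"
  using irrefl trans by metis

lemma minimal_element:
  assumes "finite A" "A \<noteq> {}"
  shows "\<exists>m\<in>A. \<forall>x\<in>A. \<not> lt x m"
  using assms
proof (induction rule: finite_ne_induct)
  case (singleton x)
  then show ?case using irrefl by auto
next
  case (insert x F)
  then obtain m where m: "m \<in> F" "\<forall>y\<in>F. \<not> lt y m" by auto
  show ?case
  proof (cases "lt x m")
    case True
    then have "\<forall>y\<in>insert x F. \<not> lt y x" using m irrefl trans by blast
    then show ?thesis by auto
  next
    case False
    then show ?thesis using m by auto
  qed
qed

lemma chains_insert:
  assumes x: "x \<notin> X"
  shows "order_complex lt (insert x X) = order_complex lt X \<union>
    (\<union>) {x} ` complex_join (order_complex lt {y\<in>X. lt y x}) (order_complex lt {z\<in>X. lt x z})" (is "?l = ?r")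
proof
  show "?l \<subseteq> ?r"
  proof
    fix c assume c: "c \<in> ?l"
    show "c \<in> ?r"
    proof (cases "x \<in> c")
      case False
      then show ?thesis using c unfolding order_complex_def by auto
    next
      case True
      let ?s = "{y\<in>c. lt y x}" and ?t = "{y\<in>c. lt x y}"
      have "c = {x} \<union> (?s \<union> ?t)" using c True unfolding order_complex_def comparable_def by auto
      moreover have "?s \<in> order_complex lt {y\<in>X. lt y x}" "?t \<in> order_complex lt {y\<in>X. lt x y}"
        using c irrefl unfolding order_complex_def by auto
      ultimately show ?thesis unfolding complex_join_def by blast
    qed
  qed
  show "?r \<subseteq> ?l"
  proof
    fix c assume "c \<in> ?r"
    then consider "c \<in> order_complex lt X" | s t where "c = {x} \<union> (s \<union> t)"
      "s \<in> order_complex lt {y\<in>X. lt y x}" "t \<in> order_complex lt {z\<in>X. lt x z}"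
      unfolding complex_join_def by auto
    then show "c \<in> ?l"
    proof cases
      case 1
      then show ?thesis unfolding order_complex_def by auto
    next
      case 2
      have s: "y \<in> X" "lt y x" if "y \<in> s" for y using 2 chainsD(1) that by blast+
      have t: "y \<in> X" "lt x y" if "y \<in> t" for y using 2 chainsD(1) that by blast+
      have "comparable lt u v" if "u \<in> c" "v \<in> c" for u v
      proof -
        have "(u = x \<or> u \<in> s \<or> u \<in> t) \<and> (v = x \<or> v \<in> s \<or> v \<in> t)" using that 2 by auto
        then show ?thesis
          using s t chainsD(3)[OF 2(2), of u v] chainsD(3)[OF 2(3), of u v] trans[of u x v] trans[of v x u]
          unfolding comparable_def by metis
      qed
      moreover have "finite c" "c \<subseteq> insert x X" using 2 s t chainsD(2) by auto
      ultimately show ?thesis unfolding order_complex_def by auto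
    qed
  qed
qed

text \<open>The faces through \<open>x\<close> form a star whose link is the join of the chains
  below and above \<open>x\<close>. Deleting the glued chains removes from that link exactly the
  facets in \<open>complex_join A T\<close>, and what is left of the link collapses.\<close>

lemma collapses_remove_vertex:
  assumes fin: "finite X" and x: "x \<notin> X"
    and S: "\<forall>c\<in>S. max_chain lt (insert x X) c \<and> c \<subseteq> X"
    and A: "A \<subseteq> facets (order_complex lt {y\<in>X. lt y x})" and T: "T \<subseteq> facets (order_complex lt {z\<in>X. lt x z})"
    and col: "collapses (complex_join (order_complex lt {y\<in>X. lt y x}) (order_complex lt {z\<in>X. lt x z}) - complex_join A T) {}"
  shows "collapses (order_complex lt (insert x X) - (S \<union> glue A x T)) (order_complex lt X - S)"
proof -
  let ?K = "order_complex lt {y\<in>X. lt y x}" and ?L = "order_complex lt {z\<in>X. lt x z}"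
  let ?N = "complex_join ?K ?L - complex_join A T"
  have AK: "A \<subseteq> ?K" and TL: "T \<subseteq> ?L" using A T unfolding facets_def by auto
  have Xs: "m \<subseteq> X" if "m \<in> complex_join ?K ?L" for m
    using that chainsD(1) unfolding complex_join_def by blast
  have uniq: "s = s' \<and> t = t'" if "s \<union> t = s' \<union> t'" "s \<in> ?K" "s' \<in> ?K" "t \<in> ?L" "t' \<in> ?L" for s s' t t'
  proof -
    have "s = {y\<in>s\<union>t. lt y x}" "s' = {y\<in>s'\<union>t'. lt y x}" "t = {y\<in>s\<union>t. lt x y}" "t' = {y\<in>s'\<union>t'. lt x y}"
      using that(2-5)[THEN chainsD(1)] asym by auto
    then show ?thesis using that(1) by metis
  qed
  have cN: "simplicial_complex ?N"
  proof (rule simplicial_complex_diff_facets[OF simplicial_complex_join[OF simplicial_complex_chains simplicial_complex_chains]])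
    show "complex_join A T \<subseteq> facets (complex_join ?K ?L)"
    proof
      fix m assume "m \<in> complex_join A T"
      then obtain s t where st: "s \<in> A" "t \<in> T" "m = s \<union> t" unfolding complex_join_def by auto
      show "m \<in> facets (complex_join ?K ?L)" unfolding facets_def
      proof (intro CollectI conjI ballI impI)
        show "m \<in> complex_join ?K ?L" using st AK TL unfolding complex_join_def by auto
        fix m' assume m': "m' \<in> complex_join ?K ?L" "m \<subseteq> m'"
        then obtain s' t' where st': "s' \<in> ?K" "t' \<in> ?L" "m' = s' \<union> t'" unfolding complex_join_def by auto
        have "s \<subseteq> s'" "t \<subseteq> t'"
          using st st' m'(2) AK TL chainsD(1)[OF st'(1)] chainsD(1)[OF st'(2)] asym
            chainsD(1)[of s] chainsD(1)[of t] by blast+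
        then have "s' = s" "t' = t" using A T st st' unfolding facets_def by auto
        then show "m' = m" using st st' by auto
      qed
    qed
  qed
  have SX: "S \<subseteq> facets (order_complex lt X)"
  proof
    fix c assume c: "c \<in> S"
    then have "max_chain lt X c" using S max_chain_subset[of lt "insert x X" c X] by auto
    then show "c \<in> facets (order_complex lt X)" by (rule max_chain_facet)
  qed
  have cA: "simplicial_complex (order_complex lt X - S)"
    by (rule simplicial_complex_diff_facets[OF simplicial_complex_chains SX])
  have eq: "order_complex lt (insert x X) - (S \<union> glue A x T) = (order_complex lt X - S) \<union> (\<union>) {x} ` ?N"
  proof (rule set_eqI)
    fix c
    show "c \<in> order_complex lt (insert x X) - (S \<union> glue A x T) \<longleftrightarrow> c \<in> (order_complex lt X - S) \<union> (\<union>) {x} ` ?N"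
    proof (cases "x \<in> c")
      case False
      have "c \<notin> glue A x T" using False unfolding glue_def by auto
      moreover have "c \<in> order_complex lt (insert x X) \<longleftrightarrow> c \<in> order_complex lt X" using False unfolding order_complex_def by auto
      ultimately show ?thesis using False by auto
    next
      case True
      have 1: "c \<notin> order_complex lt X" using True x chainsD(1) by blast
      have 2: "c \<notin> S" using True x S by auto
      have 3: "c \<in> order_complex lt (insert x X) \<longleftrightarrow> c \<in> (\<union>) {x} ` complex_join ?K ?L"
        using chains_insert[OF x] 1 by auto
      have 4: "c \<in> glue A x T \<longleftrightarrow> c \<in> (\<union>) {x} ` complex_join A T"
        unfolding glue_def complex_join_def by (auto simp: image_iff)
      have "inj_on ((\<union>) {x}) (complex_join ?K ?L)"
      proof (rule inj_onI)
        fix m m' assume "m \<in> complex_join ?K ?L" "m' \<in> complex_join ?K ?L" "{x} \<union> m = {x} \<union> m'"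
        then show "m = m'" using Xs[of m] Xs[of m'] x by auto
      qed
      moreover have "complex_join A T \<subseteq> complex_join ?K ?L" using AK TL unfolding complex_join_def by auto
      ultimately have "(\<union>) {x} ` ?N = (\<union>) {x} ` complex_join ?K ?L - (\<union>) {x} ` complex_join A T"
        by (intro inj_on_image_set_diff) auto
      then show ?thesis using 1 2 3 4 by auto
    qed
  qed
  show ?thesis unfolding eq
  proof (rule collapses_star[OF col HOL.refl cN cA])
    show "\<forall>m\<in>?N. m \<inter> {x} = {}" using Xs x by auto
    show "\<forall>m\<in>?N. {x} \<union> m \<notin> order_complex lt X - S" using x chainsD(1) by auto
  qed
qed

text \<open>Elements leave smallest first. When a minimal element of \<open>X - Y\<close> goes,
  everything below it already lies in \<open>Y\<close>, and nothing above a remaining element has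
  been lost. Hence lower parts are taken in \<open>Y\<close> but upper parts in all of
  \<open>X\<close>.\<close>

lemma collapses_remove_vertices:
  assumes "finite X" "Y \<subseteq> X"
    and "\<forall>c\<in>S. max_chain lt X c \<and> c \<subseteq> Y"
    and "\<And>x. x \<in> X - Y \<Longrightarrow> A x \<subseteq> facets (order_complex lt {y\<in>Y. lt y x}) \<and> T x \<subseteq> facets (order_complex lt {z\<in>X. lt x z}) \<and>
      collapses (complex_join (order_complex lt {y\<in>Y. lt y x}) (order_complex lt {z\<in>X. lt x z}) - complex_join (A x) (T x)) {}"
    and "\<And>x c. x \<in> X - Y \<Longrightarrow> c \<in> glue (A x) x (T x) \<Longrightarrow> max_chain lt X c"
  shows "collapses (order_complex lt X - (S \<union> (\<Union>x\<in>X-Y. glue (A x) x (T x)))) (order_complex lt Y - S)"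
  using assms
proof (induction "card (X - Y)" arbitrary: X)
  case 0
  then have "X = Y" by auto
  then show ?case by (simp add: collapses.refl)
next
  case (Suc n)
  then have "finite (X - Y)" "X - Y \<noteq> {}" by auto
  then obtain x where x: "x \<in> X - Y" and min: "\<forall>y\<in>X-Y. \<not> lt y x" using minimal_element by blast
  let ?X' = "X - {x}"
  have up: "{z\<in>?X'. lt x' z} = {z\<in>X. lt x' z}" if "x' \<in> X - Y" for x'
    using min that by auto
  have low: "{y\<in>?X'. lt y x} = {y\<in>Y. lt y x}" using min x Suc.prems(2) irrefl by auto
  let ?S' = "S \<union> (\<Union>x\<in>?X'-Y. glue (A x) x (T x))"
  have sub: "c \<subseteq> ?X'" if x': "x' \<in> ?X' - Y" and c: "c \<in> glue (A x') x' (T x')" for x' c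
  proof -
    have x'X: "x' \<in> X - Y" using x' by auto
    obtain s t where st: "s \<in> A x'" "t \<in> T x'" "c = s \<union> insert x' t" using c unfolding glue_def by auto
    have "s \<in> order_complex lt {y\<in>Y. lt y x'}" "t \<in> order_complex lt {z\<in>X. lt x' z}"
      using Suc.prems(4)[OF x'X] st unfolding facets_def by auto
    then have "s \<subseteq> Y" "t \<subseteq> ?X'" using chainsD(1) up[OF x'X] by blast+
    then show ?thesis using st x' x Suc.prems(2) by auto
  qed
  have S': "\<forall>c\<in>?S'. max_chain lt X c \<and> c \<subseteq> ?X'"
  proof
    fix c assume "c \<in> ?S'"
    then consider "c \<in> S" | x' where "x' \<in> ?X' - Y" "c \<in> glue (A x') x' (T x')" by auto
    then show "max_chain lt X c \<and> c \<subseteq> ?X'"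
    proof cases
      case 1
      then show ?thesis using Suc.prems(2,3) x by auto
    next
      case 2
      then show ?thesis using Suc.prems(5)[of x' c] sub[of x' c] by auto
    qed
  qed
  have "collapses (order_complex lt ?X' - ?S') (order_complex lt Y - S)"
  proof (rule Suc.hyps(1))
    have "?X' - Y = (X - Y) - {x}" by auto
    then show "n = card (?X' - Y)" using Suc.hyps(2) x \<open>finite (X - Y)\<close> by simp
    show "finite ?X'" using Suc.prems(1) by auto
    show "Y \<subseteq> ?X'" using Suc.prems(2) x by auto
    show "\<forall>c\<in>S. max_chain lt ?X' c \<and> c \<subseteq> Y"
    proof
      fix c assume "c \<in> S"
      then have c: "max_chain lt X c" "c \<subseteq> Y" using Suc.prems(3) by auto
      then show "max_chain lt ?X' c \<and> c \<subseteq> Y"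
        using max_chain_subset[OF c(1), of ?X'] x Suc.prems(2) by auto
    qed
    fix x' assume x': "x' \<in> ?X' - Y"
    then have x'X: "x' \<in> X - Y" by auto
    show "A x' \<subseteq> facets (order_complex lt {y\<in>Y. lt y x'}) \<and> T x' \<subseteq> facets (order_complex lt {z\<in>?X'. lt x' z}) \<and>
      collapses (complex_join (order_complex lt {y\<in>Y. lt y x'}) (order_complex lt {z\<in>?X'. lt x' z}) - complex_join (A x') (T x')) {}"
      unfolding up[OF x'X] by (rule Suc.prems(4)[OF x'X])
    fix c assume c: "c \<in> glue (A x') x' (T x')"
    show "max_chain lt ?X' c"
      by (rule max_chain_subset[OF Suc.prems(5)[OF x'X c] sub[OF x' c]]) auto
  qed
  moreover have "collapses (order_complex lt (insert x ?X') - (?S' \<union> glue (A x) x (T x))) (order_complex lt ?X' - ?S')"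
  proof (rule collapses_remove_vertex)
    have ins: "insert x ?X' = X" using x by auto
    show "finite ?X'" "x \<notin> ?X'" using Suc.prems(1) by auto
    show "\<forall>c\<in>?S'. max_chain lt (insert x ?X') c \<and> c \<subseteq> ?X'" unfolding ins by (rule S')
    show "A x \<subseteq> facets (order_complex lt {y\<in>?X'. lt y x})" "T x \<subseteq> facets (order_complex lt {z\<in>?X'. lt x z})"
      "collapses (complex_join (order_complex lt {y\<in>?X'. lt y x}) (order_complex lt {z\<in>?X'. lt x z}) - complex_join (A x) (T x)) {}"
      unfolding up[OF x] low using Suc.prems(4)[OF x] by auto
  qed
  moreover have "insert x ?X' = X" "?S' \<union> glue (A x) x (T x) = S \<union> (\<Union>x\<in>X-Y. glue (A x) x (T x))"
    using x by auto
  ultimately show ?case using collapses_trans by (metis (no_types, lifting))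
qed

lemma chains_low_up_disjoint:
  "k \<in> order_complex lt {y\<in>Y. lt y x} \<Longrightarrow> l \<in> order_complex lt {z\<in>X. lt x z} \<Longrightarrow> k \<inter> l = {}"
proof (rule equals0I)
  fix u assume "k \<in> order_complex lt {y\<in>Y. lt y x}" "l \<in> order_complex lt {z\<in>X. lt x z}" "u \<in> k \<inter> l"
  then have "lt u x" "lt x u" using chainsD(1) by auto
  then show False using asym by blast
qed

text \<open>A collapsing form of Quillen's fibre lemma. The link of a discarded element is a join,
  so it collapses as soon as its lower factor does, and no chain is removed there.\<close>

lemma collapses_chains_subposet:
  assumes fin: "finite X" and YX: "Y \<subseteq> X"
    and S: "\<forall>c\<in>S. max_chain lt X c \<and> c \<subseteq> Y"
    and low: "\<And>x. x \<in> X - Y \<Longrightarrow> collapses (order_complex lt {y\<in>Y. lt y x}) {}"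
  shows "collapses (order_complex lt X - S) (order_complex lt Y - S)"
proof -
  have "collapses (order_complex lt X - (S \<union> (\<Union>x\<in>X-Y. glue {} x {}))) (order_complex lt Y - S)"
  proof (rule collapses_remove_vertices[OF fin YX S])
    fix x assume x: "x \<in> X - Y"
    have "collapses (complex_join (order_complex lt {y\<in>Y. lt y x}) (order_complex lt {z\<in>X. lt x z})) {}"
      using fin chains_low_up_disjoint
      by (intro collapses_join[OF low[OF x] HOL.refl simplicial_complex_chains simplicial_complex_chains] finite_chains)
        auto
    then show "{} \<subseteq> facets (order_complex lt {y\<in>Y. lt y x}) \<and> {} \<subseteq> facets (order_complex lt {z\<in>X. lt x z}) \<and>
      collapses (complex_join (order_complex lt {y\<in>Y. lt y x}) (order_complex lt {z\<in>X. lt x z}) - complex_join {} {}) {}"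
      by (simp add: complex_join_def)
  qed (simp add: glue_def)
  then show ?thesis by (simp add: glue_def)
qed

text \<open>The counting device: an inserted \<open>x\<close> contributes every pair of a removed
  chain below and a removed chain above it. Maximality of a glued chain is a separate hypothesis,
  because \<open>A x\<close> is only known to be maximal among the elements of \<open>Y\<close>
  below \<open>x\<close>.\<close>

lemma good_insert_elements:
  assumes fin: "finite X" and YX: "Y \<subseteq> X"
    and Y: "good lt Y S"
    and max: "\<And>c. c \<in> S \<Longrightarrow> max_chain lt X c"
    and low: "\<And>x. x \<in> X - Y \<Longrightarrow> good lt {y\<in>Y. lt y x} (A x)"
    and up: "\<And>x. x \<in> X - Y \<Longrightarrow> good lt {z\<in>X. lt x z} (T x)"
    and max': "\<And>x c. x \<in> X - Y \<Longrightarrow> c \<in> glue (A x) x (T x) \<Longrightarrow> max_chain lt X c"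
  shows "good lt X (S \<union> (\<Union>x\<in>X-Y. glue (A x) x (T x)))"
proof -
  have "collapses (order_complex lt X - (S \<union> (\<Union>x\<in>X-Y. glue (A x) x (T x)))) (order_complex lt Y - S)"
  proof (rule collapses_remove_vertices[OF fin YX _ _ max'])
    show "\<forall>c\<in>S. max_chain lt X c \<and> c \<subseteq> Y" using max goodD(3)[OF Y] by auto
    fix x assume x: "x \<in> X - Y"
    let ?K = "order_complex lt {y\<in>Y. lt y x}" and ?L = "order_complex lt {z\<in>X. lt x z}"
    have A: "A x \<subseteq> facets ?K" by (rule goodD(4)[OF low[OF x]])
    have T: "T x \<subseteq> facets ?L" by (rule goodD(4)[OF up[OF x]])
    have "collapses (complex_join ?K ?L - complex_join (A x) (T x)) {}"
    proof (rule collapses_join_diff_facets[OF simplicial_complex_chains _ simplicial_complex_chains _ _ A _ T])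
      show "finite ?K" "finite ?L" using fin finite_subset[OF YX fin] by (auto intro: finite_chains)
      show "\<forall>k\<in>?K. \<forall>l\<in>?L. k \<inter> l = {}" using chains_low_up_disjoint by auto
      show "collapses (?K - A x) {}" "collapses (?L - T x) {}" using low[OF x] up[OF x] unfolding good_def by auto
    qed
    then show "A x \<subseteq> facets ?K \<and> T x \<subseteq> facets ?L \<and> collapses (complex_join ?K ?L - complex_join (A x) (T x)) {}"
      using A T by auto
  qed
  moreover have "collapses (order_complex lt Y - S) {}" using Y unfolding good_def by auto
  ultimately have "collapses (order_complex lt X - (S \<union> (\<Union>x\<in>X-Y. glue (A x) x (T x)))) {}" by (rule collapses_trans)
  then show ?thesis using fin max max' unfolding good_def by auto
qed

text \<open>Here \<open>m x\<close> is the meet of \<open>x\<close> with \<open>a\<close>. It is the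
  greatest element lying below both, so an element not below \<open>a\<close> has a cone underneath
  it and can be discarded; the rest is a cone with apex \<open>a\<close>.\<close>

lemma meet_contractible:
  assumes fin: "finite X" and a: "a \<in> X"
    and m: "\<And>x. x \<in> X \<Longrightarrow> m x \<in> X \<and> (m x = x \<or> lt (m x) x) \<and> (m x = a \<or> lt (m x) a)"
    and glb: "\<And>x y. x \<in> X \<Longrightarrow> y \<in> X \<Longrightarrow> lt y x \<Longrightarrow> y = a \<or> lt y a \<Longrightarrow> y = m x \<or> lt y (m x)"
  shows "collapses (order_complex lt X) {}"
proof -
  let ?Y = "{x\<in>X. x = a \<or> lt x a}"
  have "collapses (order_complex lt X - {}) (order_complex lt ?Y - {})"
  proof (rule collapses_chains_subposet[OF fin])
    fix x assume x: "x \<in> X - ?Y"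
    then have mx: "m x \<in> ?Y" "lt (m x) x" using m[of x] by auto
    show "collapses (order_complex lt {y\<in>?Y. lt y x}) {}"
    proof (rule chains_cone)
      show "m x \<in> {y\<in>?Y. lt y x}" using mx by auto
      show "\<forall>y\<in>{y\<in>?Y. lt y x}. comparable lt (m x) y"
        using glb[of x] x unfolding comparable_def by blast
    qed (use fin in auto)
  qed auto
  moreover have "collapses (order_complex lt ?Y) {}"
    by (rule chains_cone[of _ a]) (use fin a in \<open>auto simp: comparable_def\<close>)
  ultimately show ?thesis using collapses_trans by auto
qed

text \<open>\<open>x\<close> is the least member of the chain outside \<open>Y\<close>, so the chain
  determines its cutting point and with it the lower and the upper part.\<close>

lemma glue_inj:
  assumes "s \<union> insert x t = s' \<union> insert x' t'" "x \<notin> Y" "x' \<notin> Y"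
    "s \<subseteq> {y\<in>Y. lt y x}" "s' \<subseteq> {y\<in>Y. lt y x'}" "t \<subseteq> {z. lt x z}" "t' \<subseteq> {z. lt x' z}"
  shows "x = x' \<and> s = s' \<and> t = t'"
proof -
  have "x = x'"
  proof (rule ccontr)
    assume "x \<noteq> x'"
    then have "x' \<in> t" "x \<in> t'" using assms by auto
    then have "lt x x'" "lt x' x" using assms(6,7) by auto
    then show False using asym by blast
  qed
  moreover have "s = {y\<in>s \<union> insert x t. lt y x}" "s' = {y\<in>s' \<union> insert x' t'. lt y x'}"
    "t = {y\<in>s \<union> insert x t. lt x y}" "t' = {y\<in>s' \<union> insert x' t'. lt x' y}"
    using assms(4-7) asym irrefl by auto
  ultimately show ?thesis using assms(1) by metis
qed

text \<open>\<open>c\<close> is the interior of a saturated chain from \<open>a\<close> to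
  \<open>b\<close>. Without the end points, saturated chains compose by inserting the common end
  point, and an empty \<open>c\<close> expresses a covering relation.\<close>

definition sat :: "'a set \<Rightarrow> 'a \<Rightarrow> 'a set \<Rightarrow> 'a \<Rightarrow> bool" where
  "sat T a c b \<longleftrightarrow> lt a b \<and> max_chain lt {z\<in>T. lt a z \<and> lt z b} c"

lemma sat_compose:
  assumes "sat T a c x" "sat T x d b" "x \<in> T"
  shows "sat T a (c \<union> insert x d) b"
proof -
  have ab: "lt a x" "lt x b" using assms unfolding sat_def by auto
  have c: "c \<in> order_complex lt {z\<in>T. lt a z \<and> lt z x}" and d: "d \<in> order_complex lt {z\<in>T. lt x z \<and> lt z b}"
    using assms unfolding sat_def max_chain_def by auto
  have c': "y \<in> T \<and> lt a y \<and> lt y x" if "y \<in> c" for y using chainsD(1)[OF c] that by auto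
  have d': "y \<in> T \<and> lt x y \<and> lt y b" if "y \<in> d" for y using chainsD(1)[OF d] that by auto
  have "c \<union> insert x d \<in> order_complex lt {z\<in>T. lt a z \<and> lt z b}"
  proof -
    have "comparable lt u v" if "u \<in> c \<union> insert x d" "v \<in> c \<union> insert x d" for u v
      using that c' d' chainsD(3)[OF c, of u v] chainsD(3)[OF d, of u v] trans[of u x v] trans[of v x u]
      unfolding comparable_def by blast
    moreover have "y \<in> T \<and> lt a y \<and> lt y b" if "y \<in> c \<union> insert x d" for y
      using that c'[of y] d'[of y] ab assms(3) trans by blast
    ultimately show ?thesis using chainsD(2)[OF c] chainsD(2)[OF d] unfolding order_complex_def by auto
  qed
  moreover have "z \<in> c \<union> insert x d" if z: "z \<in> T" "lt a z" "lt z b" "\<forall>y\<in>c \<union> insert x d. comparable lt z y" for z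
  proof -
    have "z = x \<or> lt z x \<or> lt x z" using z(4) unfolding comparable_def by auto
    then show ?thesis using z assms(1,2) unfolding sat_def max_chain_def by auto
  qed
  ultimately show ?thesis using ab trans unfolding sat_def max_chain_def by blast
qed

lemma sat_cover:
  assumes "lt a b" "\<And>z. z \<in> T \<Longrightarrow> lt a z \<Longrightarrow> lt z b \<Longrightarrow> False"
  shows "sat T a {} b"
  using assms unfolding sat_def max_chain_def order_complex_def by auto

end

lemma strict_poset_converse:
  assumes "strict_poset lt"
  shows "strict_poset (\<lambda>x y. lt y x)"
proof
  interpret strict_poset lt by (rule assms)
  show "\<not> lt x x" for x by (rule irrefl)
  show "lt z x" if "lt y x" "lt z y" for x y z by (rule trans[OF that(2,1)])
qed

lemma join_contractible:
  assumes "strict_poset lt" and fin: "finite X" and a: "a \<in> X"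
    and m: "\<And>x. x \<in> X \<Longrightarrow> m x \<in> X \<and> (m x = x \<or> lt x (m x)) \<and> (m x = a \<or> lt a (m x))"
    and lub: "\<And>x y. x \<in> X \<Longrightarrow> y \<in> X \<Longrightarrow> lt x y \<Longrightarrow> y = a \<or> lt a y \<Longrightarrow> y = m x \<or> lt (m x) y"
  shows "collapses (order_complex lt X) {}"
proof -
  interpret c: strict_poset "\<lambda>x y. lt y x" by (rule strict_poset_converse[OF assms(1)])
  have "collapses (order_complex (\<lambda>x y. lt y x) X) {}"
    by (rule c.meet_contractible[OF fin a m lub])
  then show ?thesis using chains_converse[of lt X] by metis
qed

lemma comparable_embedding:
  assumes "inj_on f X" "\<And>x y. x \<in> X \<Longrightarrow> y \<in> X \<Longrightarrow> lt' (f x) (f y) \<longleftrightarrow> lt x y" "x \<in> X" "y \<in> X"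
  shows "comparable lt' (f x) (f y) \<longleftrightarrow> comparable lt x y"
  using inj_on_eq_iff[OF assms(1,3,4)] assms(2)[OF assms(3,4)] assms(2)[OF assms(4,3)]
  by (simp add: comparable_def)

lemma chains_image:
  assumes inj: "inj_on f X" and emb: "\<And>x y. x \<in> X \<Longrightarrow> y \<in> X \<Longrightarrow> comparable lt' (f x) (f y) \<longleftrightarrow> comparable lt x y"
  shows "order_complex lt' (f ` X) = (`) f ` order_complex lt X"
proof
  show "order_complex lt' (f ` X) \<subseteq> (`) f ` order_complex lt X"
  proof
    fix c assume c: "c \<in> order_complex lt' (f ` X)"
    then obtain d where d: "d \<subseteq> X" "c = f ` d" using chainsD(1)[OF c] subset_imageE by metis
    have "finite d" using chainsD(2)[OF c] d inj_on_subset[OF inj d(1)] by (simp add: finite_image_iff)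
    moreover have "comparable lt x y" if "x \<in> d" "y \<in> d" for x y
      using chainsD(3)[OF c, of "f x" "f y"] emb[of x y] d that by auto
    ultimately have "d \<in> order_complex lt X" using d unfolding order_complex_def by auto
    then show "c \<in> (`) f ` order_complex lt X" using d by auto
  qed
  show "(`) f ` order_complex lt X \<subseteq> order_complex lt' (f ` X)"
    using emb unfolding order_complex_def by auto (meson subsetD)
qed

lemma max_chain_image:
  assumes inj: "inj_on f X" and emb: "\<And>x y. x \<in> X \<Longrightarrow> y \<in> X \<Longrightarrow> comparable lt' (f x) (f y) \<longleftrightarrow> comparable lt x y"
    and c: "c \<subseteq> X"
  shows "max_chain lt' (f ` X) (f ` c) \<longleftrightarrow> max_chain lt X c"
proof -
  have "f ` c \<in> (`) f ` order_complex lt X \<longleftrightarrow> c \<in> order_complex lt X"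
    using c inj chainsD(1) by (smt (verit, best) image_iff inj_on_image_eq_iff)
  then have 1: "f ` c \<in> order_complex lt' (f ` X) \<longleftrightarrow> c \<in> order_complex lt X"
    using chains_image[OF inj emb] by simp
  have 2: "f x \<in> f ` c \<longleftrightarrow> x \<in> c" if "x \<in> X" for x using that c inj by (simp add: inj_on_image_mem_iff)
  have 3: "(\<forall>y\<in>f ` c. comparable lt' (f x) y) \<longleftrightarrow> (\<forall>y\<in>c. comparable lt x y)" if "x \<in> X" for x
    using emb that c by auto
  show ?thesis unfolding max_chain_def 1 using 2 3 by auto
qed

lemma good_image:
  assumes inj: "inj_on f X" and emb: "\<And>x y. x \<in> X \<Longrightarrow> y \<in> X \<Longrightarrow> comparable lt' (f x) (f y) \<longleftrightarrow> comparable lt x y"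
    and g: "good lt X S"
  shows "good lt' (f ` X) ((`) f ` S)"
proof -
  have S: "S \<subseteq> order_complex lt X" using g unfolding good_def max_chain_def by auto
  have inj': "inj_on ((`) f) (order_complex lt X)"
  proof (rule inj_onI)
    fix x y assume xy: "x \<in> order_complex lt X" "y \<in> order_complex lt X" "f ` x = f ` y"
    show "x = y" using inj_on_image_eq_iff[OF inj chainsD(1)[OF xy(1)] chainsD(1)[OF xy(2)]] xy(3) by simp
  qed
  have "\<Union>(order_complex lt X - S) \<subseteq> X" using chainsD(1) by fast
  then have "collapses ((`) f ` (order_complex lt X - S)) ((`) f ` {})"
    using g inj_on_subset[OF inj] unfolding good_def by (intro collapses_image) auto
  moreover have "(`) f ` (order_complex lt X - S) = order_complex lt' (f ` X) - (`) f ` S"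
    using inj_on_image_set_diff[OF inj' _ S, of "order_complex lt X"] chains_image[OF inj emb] by auto
  moreover have "max_chain lt' (f ` X) d" if "d \<in> (`) f ` S" for d
    using that g max_chain_image[OF inj emb] S chainsD(1) unfolding good_def by blast
  ultimately show ?thesis using g unfolding good_def by auto
qed

section \<open>Collapses and homotopy type\<close>

definition points :: "'v set set \<Rightarrow> ('v \<Rightarrow> real) set" where
  "points K = {f. (\<forall>v. 0 \<le> f v) \<and> {v. f v \<noteq> 0} \<in> K \<and> sum f {v. f v \<noteq> 0} = 1}"

lemma geom_realization_points: "geom_realization K = top_of_set (points K)"
  unfolding geom_realization_def points_def ..

lemma points_sum:
  assumes "x \<in> points K" "finite s" "{v. x v \<noteq> 0} \<subseteq> s"
  shows "sum x s = 1"
proof -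
  have "sum x s = sum x {v. x v \<noteq> 0}" using assms(2,3) by (intro sum.mono_neutral_right) auto
  then show ?thesis using assms(1) unfolding points_def by auto
qed

lemma pointsI:
  assumes K: "simplicial_complex K" "s \<in> K" and x: "\<And>v. 0 \<le> x v" "\<And>v. v \<notin> s \<Longrightarrow> x v = 0" "sum x s = 1"
  shows "x \<in> points K"
proof -
  have sub: "{v. x v \<noteq> 0} \<subseteq> s" using x(2) by auto
  have "finite s" using simplicial_complexD(1)[OF K] .
  then have "sum x s = sum x {v. x v \<noteq> 0}" using sub by (intro sum.mono_neutral_right) auto
  then show ?thesis using x simplicial_complexD(2)[OF K sub] unfolding points_def by auto
qed

lemma points_mono: "K \<subseteq> L \<Longrightarrow> points K \<subseteq> points L"
  unfolding points_def by auto

lemma points_support_nonempty: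
  assumes "x \<in> points K"
  shows "{v. x v \<noteq> 0} \<noteq> {}"
proof
  assume "{v. x v \<noteq> 0} = {}"
  then have "sum x {v. x v \<noteq> 0} = 0" by simp
  then show False using assms unfolding points_def by simp
qed

lemma continuous_on_coordinate:
  fixes f :: "'a::topological_space \<Rightarrow> 'v \<Rightarrow> real"
  shows "continuous_on S f \<Longrightarrow> continuous_on S (\<lambda>x. f x i)"
  by (rule continuous_on_product_then_coordinatewise)

lemma continuous_on_Min_image:
  fixes f :: "'a::topological_space \<Rightarrow> 'v \<Rightarrow> real"
  assumes "finite t" "t \<noteq> {}" "continuous_on S f"
  shows "continuous_on S (\<lambda>x. Min (f x ` t))"
  using assms
proof (induction rule: finite_ne_induct)
  case (singleton u)
  then show ?case by (simp add: continuous_on_coordinate)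
next
  case (insert u t)
  have "Min (f x ` insert u t) = min (f x u) (Min (f x ` t))" for x
    using insert.hyps by simp
  then show ?case using insert by (simp add: continuous_on_min continuous_on_coordinate)
qed

lemma homotopic_with_top_of_setI:
  assumes "continuous_on ({0..1::real} \<times> A) h" "h ` ({0..1} \<times> A) \<subseteq> B"
    "\<And>x. x \<in> A \<Longrightarrow> h (0, x) = p x" "\<And>x. x \<in> A \<Longrightarrow> h (1, x) = q x"
  shows "homotopic_with (\<lambda>_. True) (top_of_set A) (top_of_set B) p q"
proof -
  have "continuous_map (prod_topology (top_of_set {0..1::real}) (top_of_set A)) (top_of_set B) h"
    using assms(1,2) by (auto simp: image_subset_iff_funcset)
  then show ?thesis using assms(3,4) by (subst homotopic_with) auto
qed

text \<open>Points with a zero coordinate on \<open>t\<close> stay fixed. For any other point whose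
  support contains \<open>t\<close>, freeness forces the support to be \<open>t\<close> or
  \<open>insert v t\<close>; the motion keeps the total weight and ends with a zero on
  \<open>t\<close>, that is in the smaller complex.\<close>

lemma homotopy_equivalent_free_pair:
  fixes K :: "'v set set"
  assumes K: "simplicial_complex K" and t: "t \<in> K" "t \<noteq> {}" "v \<notin> t" "insert v t \<in> K"
    and free: "\<forall>s\<in>K. t \<subseteq> s \<longrightarrow> s = t \<or> s = insert v t"
  shows "geom_realization K homotopy_equivalent_space geom_realization (K - {t, insert v t})"
proof -
  let ?K' = "K - {t, insert v t}"
  have fin: "finite t" using simplicial_complexD(1)[OF K t(1)] .
  have K': "simplicial_complex ?K'" by (rule simplicial_complex_remove_free_pair[OF K free])
  define m where "m = (\<lambda>x :: 'v \<Rightarrow> real. Min (x ` t))"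
  \<comment> \<open>move the minimal weight of \<open>x\<close> on \<open>t\<close> to the vertex \<open>v\<close>\<close>
  define h where "h = (\<lambda>(c, x) w. if w \<in> t then x w - c * m x
     else if w = v then x w + c * m x * card t else x w)"
  have m_le: "m x \<le> x w" if "w \<in> t" for x w unfolding m_def using fin that by auto
  have m_ge: "0 \<le> m x" if "x \<in> points K" for x
    unfolding m_def using that fin t(2) by (auto simp: points_def)
  have supp: "{w. x w \<noteq> 0} \<subseteq> insert v t" if "x \<in> points K" "m x \<noteq> 0" for x
  proof -
    have "t \<subseteq> {w. x w \<noteq> 0}" using m_le[of _ x] m_ge[OF that(1)] that(2) by fastforce
    moreover have "{w. x w \<noteq> 0} \<in> K" using that unfolding points_def by auto
    ultimately show ?thesis using free by blast
  qed
  have h_in: "h (c, x) \<in> points K \<and> (c = 1 \<longrightarrow> h (c, x) \<in> points ?K')"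
    if x: "x \<in> points K" and c: "0 \<le> c" "c \<le> 1" for c x
  proof (cases "m x = 0")
    case True
    then have hx: "h (c, x) = x" unfolding h_def by auto
    obtain w where w: "w \<in> t" "x w = 0" using True fin t(2) unfolding m_def
      by (metis (mono_tags, opaque_lifting) Min_in finite_imageI image_iff image_is_empty)
    then have "{w. x w \<noteq> 0} \<notin> {t, insert v t}" by auto
    then show ?thesis using x hx unfolding points_def by auto
  next
    case False
    note s = supp[OF x False]
    have cm: "c * m x \<le> m x" using c m_ge[OF x] by (simp add: mult_left_le_one_le)
    have nonneg: "0 \<le> h (c, x) w" for w
      using x m_ge[OF x] c m_le[of w x] cm unfolding h_def points_def
      by (auto intro!: add_nonneg_nonneg mult_nonneg_nonneg)
    have out: "h (c, x) w = 0" if "w \<notin> insert v t" for w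
      using that s unfolding h_def by auto
    have "sum (h (c, x)) (insert v t) = (x v + c * m x * card t) + (\<Sum>w\<in>t. x w - c * m x)"
      using fin t(3) unfolding h_def by (simp cong: sum.cong)
    also have "\<dots> = sum x (insert v t)" using fin t(3) by (simp add: sum_subtractf)
    also have "\<dots> = 1" using points_sum[OF x _ s] fin by simp
    finally have sum1: "sum (h (c, x)) (insert v t) = 1" .
    have in1: "h (c, x) \<in> points K" by (rule pointsI[OF K t(4) nonneg out sum1])
    moreover have "h (c, x) \<in> points ?K'" if "c = 1"
    proof -
      obtain w where w: "w \<in> t" "x w = m x" using fin t(2) unfolding m_def
        by (metis (mono_tags, opaque_lifting) Min_in finite_imageI image_iff image_is_empty)
      then have "h (c, x) w = 0" unfolding h_def using that by auto
      then have "{w. h (c, x) w \<noteq> 0} \<notin> {t, insert v t}" using w(1) by auto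
      then show ?thesis using in1 unfolding points_def by auto
    qed
    ultimately show ?thesis by auto
  qed
  have h0: "h (0, x) = x" for x unfolding h_def by auto
  have h_id: "h (c, x) = x" if "x \<in> points ?K'" for c x
  proof -
    have xK: "x \<in> points K" using that points_mono[of ?K' K] by auto
    have "m x = 0"
    proof (rule ccontr)
      assume "m x \<noteq> 0"
      then have "t \<subseteq> {w. x w \<noteq> 0}" using m_le[of _ x] m_ge[OF xK] by fastforce
      then show False using that free unfolding points_def by auto
    qed
    then show ?thesis unfolding h_def by auto
  qed
  have cont_m: "continuous_on S (\<lambda>p. m (snd p))" for S :: "(real \<times> ('v \<Rightarrow> real)) set"
    unfolding m_def by (intro continuous_on_Min_image fin t(2) continuous_intros)
  have cont: "continuous_on S h" for S
  proof (rule continuous_on_coordinatewise_then_product)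
    fix w
    have *: "continuous_on S (\<lambda>p. snd p w)" by (intro continuous_on_coordinate continuous_intros)
    have eq: "(\<lambda>p. h p w) = (\<lambda>p. if w \<in> t then snd p w - fst p * m (snd p)
     else if w = v then snd p w + fst p * m (snd p) * card t else snd p w)"
      unfolding h_def by (auto simp: fun_eq_iff)
    have "continuous_on S (\<lambda>p. snd p w - fst p * m (snd p))"
      "continuous_on S (\<lambda>p. snd p w + fst p * m (snd p) * card t)"
      by (intro continuous_intros * cont_m)+
    then show "continuous_on S (\<lambda>p. h p w)" unfolding eq using *
      by (cases "w \<in> t"; cases "w = v"; simp)
  qed
  define r where "r = (\<lambda>x. h (1, x))"
  have cont_r: "continuous_on S r" for S
  proof -
    have "continuous_on S (h \<circ> (\<lambda>x. (1, x)))" by (rule continuous_on_compose[OF _ cont]) (intro continuous_intros)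
    then show ?thesis unfolding r_def o_def .
  qed
  have "homotopic_with (\<lambda>_. True) (top_of_set (points K)) (top_of_set (points K)) id (id \<circ> r)"
    by (rule homotopic_with_top_of_setI[OF cont]) (use h_in h0 in \<open>auto simp: r_def\<close>)
  then have 1: "homotopic_with (\<lambda>_. True) (top_of_set (points K)) (top_of_set (points K)) (id \<circ> r) id"
    by (simp add: homotopic_with_sym)
  have 2: "homotopic_with (\<lambda>_. True) (top_of_set (points ?K')) (top_of_set (points ?K')) (r \<circ> id) id"
    by (rule homotopic_with_top_of_setI[OF continuous_on_snd[OF continuous_on_id]]) (use h_id in \<open>auto simp: r_def\<close>)
  have "continuous_map (top_of_set (points K)) (top_of_set (points ?K')) r"
    using cont_r h_in[of _ 1] by (auto simp: r_def)
  moreover have "continuous_map (top_of_set (points ?K')) (top_of_set (points K)) id"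
    using points_mono[of ?K' K] by auto
  ultimately show ?thesis
    unfolding geom_realization_points homotopy_equivalent_space_def using 1 2 by blast
qed

lemma collapses_subset: "collapses K L \<Longrightarrow> L \<subseteq> K"
  by (induction rule: collapses.induct) auto

lemma homotopy_equivalent_collapses:
  assumes "collapses K L" "simplicial_complex K" "{} \<in> L"
  shows "geom_realization K homotopy_equivalent_space geom_realization L"
  using assms
proof (induction rule: collapses.induct)
  case (refl K)
  then show ?case by (simp add: homotopy_equivalent_space_refl)
next
  case (step t K v L)
  \<comment> \<open>The empty face survives into \<open>L\<close>, so it is never the free face of a
    step.\<close>
  have "t \<noteq> {}" using collapses_subset[OF step.hyps(5)] step.prems(2) by auto
  then have "geom_realization K homotopy_equivalent_space geom_realization (K - {t, insert v t})"
    by (rule homotopy_equivalent_free_pair[OF step.prems(1) step.hyps(1) _ step.hyps(2-4)])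
  moreover have "geom_realization (K - {t, insert v t}) homotopy_equivalent_space geom_realization L"
    using step.IH step.prems simplicial_complex_remove_free_pair[OF step.prems(1) step.hyps(4)] by auto
  ultimately show ?case by (rule homotopy_eqv_trans)
qed

lemma points_single_vertex:
  assumes K: "K = {{}, {v}}"
  shows "points K = {\<lambda>w. if w = v then 1 else 0}"
proof (rule set_eqI, rule iffI)
  fix x assume x: "x \<in> points K"
  have "{w. x w \<noteq> 0} = {v}" using x points_support_nonempty[OF x] unfolding points_def K by auto
  moreover have "sum x {w. x w \<noteq> 0} = 1" using x unfolding points_def by auto
  ultimately have "x v = 1" "\<And>w. w \<noteq> v \<Longrightarrow> x w = 0" by auto
  then have "x = (\<lambda>w. if w = v then 1 else 0)" by auto
  then show "x \<in> {\<lambda>w. if w = v then 1 else 0}" by simp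
next
  fix x assume "x \<in> {\<lambda>w. if w = v then 1 else (0::real)}"
  then have x: "x = (\<lambda>w. if w = v then 1 else 0)" by simp
  then have "{w. x w \<noteq> 0} = {v}" by auto
  then show "x \<in> points K" using x unfolding points_def K by auto
qed

lemma contractible_collapses_void:
  assumes "collapses K L" "L = {}" "simplicial_complex K" "K \<noteq> {}"
  shows "contractible_space (geom_realization K) \<and> points K \<noteq> {}"
  using assms
proof (induction rule: collapses.induct)
  case (refl K)
  then show ?case by simp
next
  case (step t K v L)
  let ?K' = "K - {t, insert v t}"
  have emp: "{} \<in> K" using simplicial_complexD(3)[OF step.prems(2) step.hyps(1)] .
  note K' = simplicial_complex_remove_free_pair[OF step.prems(2) step.hyps(4)]
  show ?case
  proof (cases "?K' = {}")
    case True
    \<comment> \<open>If the pair exhausts \<open>K\<close>, the empty face belongs to it. Thus the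
      last step of a collapse to nothing starts from a single vertex, whose realization is a
      point.\<close>
    then have "t = {}" "K = {{}, {v}}" using emp step.hyps(1,3) by auto
    then show ?thesis unfolding geom_realization_points by (simp add: points_single_vertex)
  next
    case False
    then have "{} \<in> ?K'" using simplicial_complexD(3)[OF K'] by blast
    then have "t \<noteq> {}" by auto
    have "contractible_space (geom_realization ?K')" "points ?K' \<noteq> {}"
      using step.IH[OF step.prems(1) K' False] by auto
    moreover have "points ?K' \<subseteq> points K" by (rule points_mono) auto
    ultimately show ?thesis
      using homotopy_equivalent_space_contractibility
        [OF homotopy_equivalent_free_pair[OF step.prems(2) step.hyps(1) \<open>t \<noteq> {}\<close> step.hyps(2-4)]] by auto
  qed
qed

section \<open>Cells attached to a contractible complex\<close>

lemma Hausdorff_space_fun: "Hausdorff_space (euclidean :: ('a \<Rightarrow> real) topology)"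
  using Hausdorff_space_product_topology[of "\<lambda>_. euclideanreal" "UNIV :: 'a set"]
  by (simp add: euclidean_product_topology)

definition cell :: "'v set \<Rightarrow> ('v \<Rightarrow> real) set" where
  "cell s = {x. (\<forall>v. 0 \<le> x v) \<and> (\<forall>v\<in>-s. x v = 0) \<and> sum x s = 1}"

lemma compact_cell:
  fixes s :: "'v set"
  assumes "finite s"
  shows "compact (cell s)"
proof -
  \<comment> \<open>The cell is a closed subset of a cube that is compact by Tychonoff, so the
    vertex type may be infinite.\<close>
  let ?Q = "PiE UNIV (\<lambda>_. {0..1}) :: ('v \<Rightarrow> real) set"
  have "compactin (product_topology (\<lambda>_. euclideanreal) UNIV) ?Q"
    by (subst compactin_PiE) auto
  then have Q: "compact ?Q" by (simp add: euclidean_product_topology)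
  have c: "continuous_on UNIV (\<lambda>x :: 'v \<Rightarrow> real. x v)" for v by simp
  have "closed (\<Inter>v. {x :: 'v \<Rightarrow> real. 0 \<le> x v})"
    by (intro closed_INT ballI closed_Collect_le c continuous_on_const)
  moreover have "closed (\<Inter>v\<in>-s. {x :: 'v \<Rightarrow> real. x v = 0})"
    by (intro closed_INT ballI closed_Collect_eq c continuous_on_const)
  moreover have "closed {x :: 'v \<Rightarrow> real. sum x s = 1}"
    by (intro closed_Collect_eq continuous_on_sum c continuous_on_const)
  ultimately have "closed ((\<Inter>v. {x :: 'v \<Rightarrow> real. 0 \<le> x v}) \<inter> (\<Inter>v\<in>-s. {x. x v = 0}) \<inter> {x. sum x s = 1})"
    by (intro closed_Int)
  moreover have "cell s = (\<Inter>v. {x. 0 \<le> x v}) \<inter> (\<Inter>v\<in>-s. {x. x v = 0}) \<inter> {x. sum x s = 1}"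
    unfolding cell_def by auto
  ultimately have "closed (cell s)" by simp
  then have "compact (?Q \<inter> cell s)" using Q by (rule compact_Int_closed[rotated])
  moreover have "cell s \<subseteq> ?Q"
  proof
    fix x assume x: "x \<in> cell s"
    have "x v \<le> 1" for v
    proof (cases "v \<in> s")
      case True
      then have "x v \<le> sum x s" using x assms by (intro member_le_sum) (auto simp: cell_def)
      then show ?thesis using x by (simp add: cell_def)
    next
      case False
      then show ?thesis using x by (auto simp: cell_def)
    qed
    then show "x \<in> ?Q" using x by (auto simp: cell_def)
  qed
  ultimately show ?thesis by (simp add: Int_absorb1)
qed

lemma points_eq_cells:
  assumes "simplicial_complex K"
  shows "points K = (\<Union>s\<in>K. cell s)"
proof
  show "points K \<subseteq> (\<Union>s\<in>K. cell s)" unfolding points_def cell_def by auto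
  show "(\<Union>s\<in>K. cell s) \<subseteq> points K"
    using pointsI[OF assms] unfolding cell_def by auto
qed

lemma compact_points: "finite K \<Longrightarrow> simplicial_complex K \<Longrightarrow> compact (points K)"
  unfolding points_eq_cells by (intro compact_UN compact_cell) (auto dest: simplicial_complexD(1))

text \<open>A continuous map from a compact space onto a Hausdorff space is a quotient map, so
  continuity on the image can be tested upstairs.\<close>

lemma continuous_on_lift_compact:
  assumes "compact A" "continuous_on A g" "g ` A = W" "Hausdorff_space (top_of_set W)"
    "continuous_on A (f \<circ> g)"
  shows "continuous_on W f"
proof -
  have "quotient_map (top_of_set A) (top_of_set W) g"
    using assms by (intro T1_Spaces.continuous_imp_quotient_map) (auto simp: compact_space_subtopology)
  then show ?thesis
    using continuous_compose_quotient_map[of "top_of_set A" "top_of_set W" g euclidean f] assms(5) by auto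
qed

text \<open>If \<open>A'\<close> contracts in itself along a homotopy \<open>H\<close> extending to \<open>A\<close>, then the quotient
  map \<open>g\<close> collapsing \<open>A'\<close> is a homotopy equivalence: both \<open>H\<^sub>1\<close> and \<open>g \<circ> H\<close> factor through \<open>g\<close>.\<close>
lemma homotopy_equivalent_collapse_contractible:
  fixes A :: "'a::topological_space set" and W :: "'b::topological_space set"
  assumes A: "compact A" "A' \<subseteq> A"
    and g: "continuous_on A g" "g ` A = W" and hausd: "Hausdorff_space (euclidean :: 'b topology)"
    and geq: "\<And>x y. x \<in> A \<Longrightarrow> y \<in> A \<Longrightarrow> g x = g y \<Longrightarrow> x = y \<or> (x \<in> A' \<and> y \<in> A')"
    and gA': "\<And>x y. x \<in> A' \<Longrightarrow> y \<in> A' \<Longrightarrow> g x = g y"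
    and H: "continuous_on ({0..1::real} \<times> A) H" "\<And>t x. t \<in> {0..1} \<Longrightarrow> x \<in> A \<Longrightarrow> H (t, x) \<in> A"
      "\<And>t x. t \<in> {0..1} \<Longrightarrow> x \<in> A' \<Longrightarrow> H (t, x) \<in> A'"
      "\<And>x. x \<in> A \<Longrightarrow> H (0, x) = x" "\<And>x. x \<in> A' \<Longrightarrow> H (1, x) = a"
  shows "top_of_set A homotopy_equivalent_space top_of_set W"
proof -
  have hW: "Hausdorff_space (top_of_set W)" by (rule Hausdorff_space_subtopology[OF hausd])
  \<comment> \<open>An arbitrary section of \<open>g\<close> will do. Two preimages of one point
    differ only inside \<open>A'\<close>, where neither \<open>H (1, x)\<close> nor
    \<open>g (H (t, x))\<close> depends on \<open>x\<close>.\<close>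
  define i where "i = inv_into A g"
  have i: "i w \<in> A" "g (i w) = w" if "w \<in> W" for w
    using that g(2) inv_into_into[of w g A] f_inv_into_f[of w g A] unfolding i_def by auto
  define f where "f = (\<lambda>w. H (1, i w))"
  define \<Phi> where "\<Phi> = (\<lambda>(t, w). g (H (t, i w)))"
  have fg: "f (g x) = H (1, x)" if x: "x \<in> A" for x
  proof -
    have gx: "g x \<in> W" using x g(2) by auto
    then show ?thesis unfolding f_def using geq[OF i(1)[OF gx] x i(2)[OF gx]] H(5) by auto
  qed
  have \<Phi>g: "\<Phi> (t, g x) = g (H (t, x))" if x: "x \<in> A" and t: "t \<in> {0..1}" for x t
  proof -
    have gx: "g x \<in> W" using x g(2) by auto
    then show ?thesis unfolding \<Phi>_def
      using geq[OF i(1)[OF gx] x i(2)[OF gx]] gA'[OF H(3)[OF t] H(3)[OF t]] by auto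
  qed
  have H1: "continuous_on A (\<lambda>x. H (1, x))"
    by (rule continuous_on_compose2[OF H(1)])
      (auto intro: continuous_on_Pair[OF continuous_on_const continuous_on_id])
  have cf: "continuous_on W f"
  proof (rule continuous_on_lift_compact[OF A(1) g hW])
    show "continuous_on A (f \<circ> g)" using H1 fg by (simp cong: continuous_on_cong)
  qed
  have f_in: "f w \<in> A" if "w \<in> W" for w unfolding f_def using H(2) i that by auto
  \<comment> \<open>Continuity of \<open>\<Phi>\<close> requires a quotient map on the product with
    the unit interval. \<open>?g2\<close> is one, since its domain is again compact and its image
    Hausdorff.\<close>
  let ?g2 = "\<lambda>p. (fst p, g (snd p))"
  have c\<Phi>: "continuous_on ({0..1} \<times> W) \<Phi>"
  proof (rule continuous_on_lift_compact[where A = "{0..1} \<times> A" and g = ?g2])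
    show "compact ({0..1::real} \<times> A)" using A(1) by (intro compact_Times) auto
    have "continuous_on ({0..1::real} \<times> A) (\<lambda>p. g (snd p))"
      by (rule continuous_on_compose2[OF g(1) continuous_on_snd[OF continuous_on_id]]) auto
    then show "continuous_on ({0..1::real} \<times> A) ?g2"
      by (intro continuous_on_Pair continuous_on_fst continuous_on_id)
    show "?g2 ` ({0..1} \<times> A) = {0..1} \<times> W" using g(2) by (force simp: image_iff)
    have "Hausdorff_space (prod_topology (top_of_set {0..1::real}) (top_of_set W))"
      using hW by (subst Hausdorff_space_prod_topology) (auto intro: Hausdorff_space_subtopology)
    then show "Hausdorff_space (top_of_set ({0..1::real} \<times> W))" by simp
    have "continuous_on ({0..1} \<times> A) (\<lambda>p. g (H p))"
      by (rule continuous_on_compose2[OF g(1) H(1)]) (use H(2) in auto)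
    moreover have "(\<Phi> \<circ> ?g2) p = g (H p)" if "p \<in> {0..1} \<times> A" for p
      using that \<Phi>g by (cases p) auto
    ultimately show "continuous_on ({0..1} \<times> A) (\<Phi> \<circ> ?g2)"
      by (simp cong: continuous_on_cong)
  qed
  have "homotopic_with (\<lambda>_. True) (top_of_set A) (top_of_set A) id (f \<circ> g)"
    by (rule homotopic_with_top_of_setI[OF H(1)]) (use H(2,4) fg in auto)
  then have 1: "homotopic_with (\<lambda>_. True) (top_of_set A) (top_of_set A) (f \<circ> g) id"
    by (simp add: homotopic_with_sym)
  have "homotopic_with (\<lambda>_. True) (top_of_set W) (top_of_set W) id (g \<circ> f)"
    by (rule homotopic_with_top_of_setI[OF c\<Phi>])
      (use H(2,4) i g(2) in \<open>auto simp: \<Phi>_def f_def\<close>)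
  then have 2: "homotopic_with (\<lambda>_. True) (top_of_set W) (top_of_set W) (g \<circ> f) id"
    by (simp add: homotopic_with_sym)
  have "continuous_map (top_of_set A) (top_of_set W) g" using g by auto
  moreover have "continuous_map (top_of_set W) (top_of_set A) f" using cf f_in by auto
  ultimately show ?thesis unfolding homotopy_equivalent_space_def using 1 2 by blast
qed

section \<open>Radial coordinates in the attached cells, and homotopy extension\<close>

locale cells_attached =
  fixes K S :: "'v set set"
  assumes finK: "finite K" and cK: "simplicial_complex K" and SK: "S \<subseteq> facets K" and emp: "{} \<notin> S"
begin

text \<open>The radial coordinate of the cell \<open>s\<close>: 1 at its barycentre, 0 on its
  boundary and on the rest of the complex. In the cell a point is \<open>lam s x\<close> times the
  barycentre plus a nonnegative remainder that vanishes at some vertex of \<open>s\<close>.\<close>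

definition lam :: "'v set \<Rightarrow> ('v \<Rightarrow> real) \<Rightarrow> real" where
  "lam s x = real (card s) * Min (x ` s)"

lemma finS: "finite S"
  using SK finK finite_subset unfolding facets_def by (metis (no_types, lifting) mem_Collect_eq subsetI)

lemma S_props:
  assumes "s \<in> S"
  shows "s \<in> K" "finite s" "s \<noteq> {}" "0 < card s" "\<And>t. t \<in> K \<Longrightarrow> s \<subseteq> t \<Longrightarrow> t = s"
proof -
  show "s \<in> K" "\<And>t. t \<in> K \<Longrightarrow> s \<subseteq> t \<Longrightarrow> t = s" using assms SK unfolding facets_def by auto
  then show "finite s" using simplicial_complexD(1)[OF cK] by auto
  show "s \<noteq> {}" using assms emp by auto
  then show "0 < card s" using \<open>finite s\<close> by (simp add: card_gt_0_iff)
qed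

lemma complex_diff: "simplicial_complex (K - S)"
  by (rule simplicial_complex_diff_facets[OF cK SK])

lemma lam_le:
  assumes "s \<in> S" "v \<in> s"
  shows "lam s x / card s \<le> x v"
  unfolding lam_def using S_props[OF assms(1)] assms(2) by simp

lemma lam_attained:
  assumes "s \<in> S"
  shows "\<exists>v\<in>s. x v = lam s x / card s"
proof -
  have "Min (x ` s) \<in> x ` s" using S_props[OF assms] by (intro Min_in) auto
  then obtain v where "v \<in> s" "x v = Min (x ` s)" by auto
  then show ?thesis unfolding lam_def using S_props(4)[OF assms] by auto
qed

lemma lam_ge0:
  assumes "s \<in> S" "x \<in> points K"
  shows "0 \<le> lam s x"
proof -
  obtain v where "x v = lam s x / card s" using lam_attained[OF assms(1)] by auto
  moreover have "0 \<le> x v" using assms(2) unfolding points_def by auto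
  ultimately show ?thesis using S_props(4)[OF assms(1)] by (simp add: zero_le_divide_iff)
qed

text \<open>A positive minimum puts all of \<open>s\<close> into the support, and a facet admits no
  larger support.\<close>

lemma lam_nz_iff:
  assumes "s \<in> S" "x \<in> points K"
  shows "lam s x \<noteq> 0 \<longleftrightarrow> {v. x v \<noteq> 0} = s"
proof
  assume "lam s x \<noteq> 0"
  then have "0 < lam s x" using lam_ge0[OF assms] by auto
  then have pos: "0 < lam s x / card s" using S_props(4)[OF assms(1)] by auto
  have "x v \<noteq> 0" if "v \<in> s" for v using lam_le[OF assms(1) that, of x] pos by linarith
  then have "s \<subseteq> {v. x v \<noteq> 0}" by auto
  moreover have "{v. x v \<noteq> 0} \<in> K" using assms unfolding points_def by auto
  ultimately show "{v. x v \<noteq> 0} = s" using S_props(5)[OF assms(1)] by auto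
next
  assume "{v. x v \<noteq> 0} = s"
  then show "lam s x \<noteq> 0" using lam_attained[OF assms(1), of x] by auto
qed

lemma points_diff_iff:
  assumes "x \<in> points K"
  shows "x \<in> points (K - S) \<longleftrightarrow> (\<forall>s\<in>S. lam s x = 0)"
proof -
  have "x \<in> points (K - S) \<longleftrightarrow> {v. x v \<noteq> 0} \<notin> S" using assms unfolding points_def by auto
  then show ?thesis using lam_nz_iff[OF _ assms] by metis
qed

lemma points_cases:
  assumes "x \<in> points K"
  obtains "x \<in> points (K - S)" "\<And>s. s \<in> S \<Longrightarrow> lam s x = 0"
  | s where "s \<in> S" "{v. x v \<noteq> 0} = s" "0 < lam s x" "\<And>s'. s' \<in> S \<Longrightarrow> s' \<noteq> s \<Longrightarrow> lam s' x = 0"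
proof (cases "x \<in> points (K - S)")
  case True
  then show ?thesis using that(1) points_diff_iff[OF assms] by auto
next
  case False
  then obtain s where s: "s \<in> S" "lam s x \<noteq> 0" using points_diff_iff[OF assms] by auto
  then have supp: "{v. x v \<noteq> 0} = s" using lam_nz_iff[OF _ assms] by auto
  have "lam s' x = 0" if "s' \<in> S" "s' \<noteq> s" for s' using lam_nz_iff[OF that(1) assms] supp that(2) by auto
  moreover have "0 < lam s x" using s lam_ge0[OF s(1) assms] by auto
  ultimately show ?thesis using that(2)[OF s(1) supp] by auto
qed

lemma sum_S_single:
  assumes "s \<in> S" "\<And>s'. s' \<in> S \<Longrightarrow> s' \<noteq> s \<Longrightarrow> F s' = (0::real)"
  shows "sum F S = F s"
proof -
  have "sum F S = sum F {s}" by (rule sum.mono_neutral_right) (use finS assms in auto)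
  then show ?thesis by simp
qed

lemma lam_le1:
  assumes "s \<in> S" "x \<in> points K"
  shows "lam s x \<le> 1"
proof (cases "lam s x = 0")
  case False
  then have supp: "{v. x v \<noteq> 0} = s" using lam_nz_iff[OF assms] by auto
  have "lam s x = (\<Sum>v\<in>s. lam s x / card s)" using S_props[OF assms(1)] by simp
  also have "\<dots> \<le> sum x s" using lam_le[OF assms(1)] by (intro sum_mono) auto
  also have "\<dots> = 1" using points_sum[OF assms(2) S_props(2)[OF assms(1)]] supp by auto
  finally show ?thesis .
qed auto

lemma continuous_on_lam:
  assumes "s \<in> S" "continuous_on D f"
  shows "continuous_on D (\<lambda>p. lam s (f p))"
  unfolding lam_def using S_props[OF assms(1)] assms(2)
  by (intro continuous_on_mult continuous_on_const continuous_on_Min_image) auto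

definition Lam :: "('v \<Rightarrow> real) \<Rightarrow> real" where
  "Lam x = (\<Sum>s\<in>S. lam s x)"

definition boundary_part :: "('v \<Rightarrow> real) \<Rightarrow> 'v \<Rightarrow> real" where
  "boundary_part x v = x v - (\<Sum>s\<in>S. if v \<in> s then lam s x / card s else 0)"

text \<open>Radial projection from the barycentre of a cell onto its boundary, extended by the
  identity. It is meaningful where \<open>Lam x < 1\<close>, that is away from the
  barycentres.\<close>

definition proj :: "('v \<Rightarrow> real) \<Rightarrow> 'v \<Rightarrow> real" where
  "proj x v = boundary_part x v / (1 - Lam x)"

text \<open>Radial motion away from the barycentre. The remainder is stretched by
  \<open>1 + t\<close> and the radial coordinate becomes \<open>1 - (1 + t) * (1 - lam s x)\<close>,
  so the total weight stays 1 until the boundary is reached. For a cell with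
  \<open>lam s x = 0\<close> this expression equals \<open>- t\<close>; the cut-off by
  \<open>max 0\<close> silences such cells, so that one continuous formula serves all cells
  together.\<close>

definition push :: "real \<Rightarrow> ('v \<Rightarrow> real) \<Rightarrow> 'v \<Rightarrow> real" where
  "push t x v = (1 + t) * boundary_part x v +
     (\<Sum>s\<in>S. if v \<in> s then max 0 (lam s x - t * (1 - lam s x)) / card s else 0)"

lemma continuous_on_Lam: "continuous_on D f \<Longrightarrow> continuous_on D (\<lambda>p. Lam (f p))"
  unfolding Lam_def by (intro continuous_on_sum continuous_on_lam)

lemma continuous_on_boundary_part:
  assumes "continuous_on D f"
  shows "continuous_on D (\<lambda>p. boundary_part (f p) v)"
proof -
  have "continuous_on D (\<lambda>p. if v \<in> s then lam s (f p) / card s else 0)" if "s \<in> S" for s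
    using continuous_on_lam[OF that assms] S_props(4)[OF that]
    by (cases "v \<in> s") (auto intro!: continuous_intros)
  then show ?thesis unfolding boundary_part_def
    by (intro continuous_on_diff continuous_on_sum continuous_on_coordinate[OF assms])
qed

lemma continuous_on_push:
  assumes "continuous_on D f" "continuous_on D \<tau>"
  shows "continuous_on D (\<lambda>p. push (\<tau> p) (f p))"
proof (rule continuous_on_coordinatewise_then_product)
  fix v
  have "continuous_on D (\<lambda>p. if v \<in> s then max 0 (lam s (f p) - \<tau> p * (1 - lam s (f p))) / card s else 0)"
    if "s \<in> S" for s
    using continuous_on_lam[OF that assms(1)] S_props(4)[OF that] assms(2)
    by (cases "v \<in> s") (auto intro!: continuous_intros)
  then show "continuous_on D (\<lambda>p. push (\<tau> p) (f p) v)" unfolding push_def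
    by (intro continuous_on_add continuous_on_mult continuous_on_sum continuous_on_boundary_part
        continuous_on_const assms) auto
qed

lemma outside:
  assumes "\<And>s. s \<in> S \<Longrightarrow> lam s x = 0"
  shows "Lam x = 0" "boundary_part x = x" "0 \<le> t \<Longrightarrow> push t x v = (1 + t) * x v" "proj x = x"
proof -
  show L: "Lam x = 0" unfolding Lam_def using assms by simp
  have "(\<Sum>s\<in>S. if v \<in> s then lam s x / card s else 0) = 0" for v
    by (rule sum.neutral) (use assms in auto)
  then show b: "boundary_part x = x" unfolding boundary_part_def by (auto simp: fun_eq_iff)
  show "proj x = x" unfolding proj_def L b by auto
  assume "0 \<le> t"
  then have "(\<Sum>s\<in>S. if v \<in> s then max 0 (lam s x - t * (1 - lam s x)) / card s else 0) = 0"
    by (intro sum.neutral) (use assms in auto)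
  then show "push t x v = (1 + t) * x v" unfolding push_def b by simp
qed

lemma inside:
  assumes "s \<in> S" "\<And>s'. s' \<in> S \<Longrightarrow> s' \<noteq> s \<Longrightarrow> lam s' x = 0"
  shows "Lam x = lam s x" "boundary_part x v = x v - (if v \<in> s then lam s x / card s else 0)"
    "0 \<le> t \<Longrightarrow> push t x v = (1 + t) * boundary_part x v + (if v \<in> s then max 0 (lam s x - t * (1 - lam s x)) / card s else 0)"
proof -
  show "Lam x = lam s x" unfolding Lam_def by (rule sum_S_single[OF assms])
  show "boundary_part x v = x v - (if v \<in> s then lam s x / card s else 0)"
    unfolding boundary_part_def by (subst sum_S_single[OF assms(1)]) (use assms(2) in auto)
  show "push t x v = (1 + t) * boundary_part x v + (if v \<in> s then max 0 (lam s x - t * (1 - lam s x)) / card s else 0)"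
    if "0 \<le> t" unfolding push_def by (subst sum_S_single[OF assms(1)]) (use assms(2) that in auto)
qed

lemma Lam_bounds:
  assumes "x \<in> points K"
  shows "0 \<le> Lam x" "Lam x \<le> 1"
proof -
  have "0 \<le> Lam x \<and> Lam x \<le> 1"
    using assms
  proof (cases rule: points_cases)
    case 1
    show ?thesis using outside(1)[OF 1(2)] by auto
  next
    case (2 s)
    show ?thesis using inside(1)[OF 2(1,4)] lam_ge0[OF 2(1) assms] lam_le1[OF 2(1) assms] by auto
  qed
  then show "0 \<le> Lam x" "Lam x \<le> 1" by auto
qed

lemma boundary_part_sum:
  assumes "x \<in> points K" "s \<in> S" "{v. x v \<noteq> 0} = s" "\<And>s'. s' \<in> S \<Longrightarrow> s' \<noteq> s \<Longrightarrow> lam s' x = 0"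
  shows "sum (boundary_part x) s = 1 - lam s x" "\<And>v. 0 \<le> boundary_part x v" "\<And>v. v \<notin> s \<Longrightarrow> boundary_part x v = 0"
proof -
  note b = inside(2)[OF assms(2,4)]
  have "sum (boundary_part x) s = sum x s - (\<Sum>v\<in>s. lam s x / card s)"
    unfolding sum_subtractf[symmetric] by (rule sum.cong) (auto simp: b)
  also have "\<dots> = 1 - lam s x"
    using points_sum[OF assms(1) S_props(2)[OF assms(2)]] assms(3) S_props[OF assms(2)] by simp
  finally show "sum (boundary_part x) s = 1 - lam s x" .
  show out: "boundary_part x v = 0" if "v \<notin> s" for v using b[of v] that assms(3) by auto
  show "0 \<le> boundary_part x v" for v
    using b[of v] lam_le[OF assms(2), of v x] assms(1) by (auto simp: points_def)
qed

lemma proj_points: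
  assumes x: "x \<in> points K" and l: "Lam x < 1"
  shows "proj x \<in> points (K - S)"
  using x
proof (cases rule: points_cases)
  case 1
  then show ?thesis using outside(4)[OF 1(2)] by simp
next
  case (2 s)
  note b = boundary_part_sum[OF x 2(1,2,4)]
  have L: "Lam x = lam s x" by (rule inside(1)[OF 2(1,4)])
  obtain w where w: "w \<in> s" "x w = lam s x / card s" using lam_attained[OF 2(1)] by blast
  let ?s' = "s - {w}"
  have b0: "boundary_part x w = 0" using inside(2)[OF 2(1,4), of w] w by simp
  have "?s' \<in> K" using simplicial_complexD(2)[OF cK S_props(1)[OF 2(1)]] by auto
  moreover have "?s' \<notin> S" using S_props(5)[of ?s' s] S_props(1)[OF 2(1)] w by auto
  ultimately have s': "?s' \<in> K - S" by auto
  show ?thesis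
  proof (rule pointsI[OF complex_diff s'])
    show "0 \<le> proj x v" for v unfolding proj_def using b(2)[of v] l by simp
    show "proj x v = 0" if "v \<notin> ?s'" for v
      unfolding proj_def using b(3)[of v] b0 that by (cases "v = w") auto
    have "sum (boundary_part x) s = boundary_part x w + sum (boundary_part x) ?s'"
      using S_props(2)[OF 2(1)] w(1) by (simp add: sum.remove)
    then have "sum (boundary_part x) ?s' = 1 - lam s x" using b(1) b0 by simp
    then show "sum (proj x) ?s' = 1" unfolding proj_def sum_divide_distrib[symmetric] using L l by simp
  qed
qed

lemma push_points:
  assumes x: "x \<in> points K" and t: "0 \<le> t" and l: "(1 - Lam x) * (1 + t) \<le> 1"
  shows "push t x \<in> points K"
  using x
proof (cases rule: points_cases)
  case 1
  then have "t = 0" using outside(1)[OF 1(2)] l t by simp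
  then have "push t x = x" using outside(3)[OF 1(2) t] by auto
  then show ?thesis using x by simp
next
  case (2 s)
  note b = boundary_part_sum[OF x 2(1,2,4)]
  have L: "Lam x = lam s x" by (rule inside(1)[OF 2(1,4)])
  have m: "max 0 (lam s x - t * (1 - lam s x)) = lam s x - t * (1 - lam s x)"
    using l L by (simp add: algebra_simps)
  have p: "push t x v = (1 + t) * boundary_part x v + (if v \<in> s then max 0 (lam s x - t * (1 - lam s x)) / card s else 0)" for v
    by (rule inside(3)[OF 2(1,4) t])
  show ?thesis
  proof (rule pointsI[OF cK S_props(1)[OF 2(1)]])
    show "0 \<le> push t x v" for v unfolding p using b(2)[of v] t by auto
    show "push t x v = 0" if "v \<notin> s" for v unfolding p using b(3)[of v] that by simp
    have "sum (push t x) s = (1 + t) * sum (boundary_part x) s + (\<Sum>v\<in>s. max 0 (lam s x - t * (1 - lam s x)) / card s)"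
      unfolding sum_distrib_left sum.distrib[symmetric] by (rule sum.cong) (auto simp: p)
    also have "\<dots> = (1 + t) * (1 - lam s x) + (lam s x - t * (1 - lam s x))"
      unfolding m using b(1) S_props[OF 2(1)] by simp
    also have "\<dots> = 1" by (simp add: algebra_simps)
    finally show "sum (push t x) s = 1" .
  qed
qed

lemma push_zero:
  assumes "x \<in> points K"
  shows "push 0 x = x"
  using assms
proof (cases rule: points_cases)
  case 1
  then show ?thesis using outside(3)[OF 1(2), of 0] by auto
next
  case (2 s)
  then show ?thesis
    using inside(3)[OF 2(1,4), of 0] inside(2)[OF 2(1,4)] by (auto simp: fun_eq_iff)
qed

lemma push_eq_proj:
  assumes "x \<in> points K" and t: "0 \<le> t" and l: "(1 - Lam x) * (1 + t) = 1"
  shows "push t x = proj x"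
  using assms(1)
proof (cases rule: points_cases)
  case 1
  then have "t = 0" using outside(1)[OF 1(2)] l by simp
  then show ?thesis using push_zero[OF assms(1)] outside(4)[OF 1(2)] by simp
next
  case (2 s)
  have L: "Lam x = lam s x" by (rule inside(1)[OF 2(1,4)])
  have "lam s x - t * (1 - lam s x) = 0" using l L by (simp add: algebra_simps)
  then have "push t x v = (1 + t) * boundary_part x v" for v using inside(3)[OF 2(1,4) t, of v] by simp
  moreover have "1 + t = 1 / (1 - Lam x)" using l by (metis mult_zero_left nonzero_eq_divide_eq zero_neq_one mult.commute)
  ultimately show ?thesis unfolding proj_def by (auto simp: fun_eq_iff)
qed

text \<open>A point of a cell is pushed outward until it hits the boundary, which happens when
  \<open>r\<close> reaches 1; from there it follows \<open>h\<close> for the remaining time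
  \<open>r - 1\<close>. Points outside the cells have \<open>r = 1 + t\<close> and follow
  \<open>h\<close> at once.\<close>

lemma homotopy_extension:
  fixes h :: "real \<times> ('v \<Rightarrow> real) \<Rightarrow> ('v \<Rightarrow> real)"
  assumes h: "continuous_on ({0..1} \<times> points (K - S)) h"
    "\<And>t x. t \<in> {0..1} \<Longrightarrow> x \<in> points (K - S) \<Longrightarrow> h (t, x) \<in> points (K - S)"
    "\<And>x. x \<in> points (K - S) \<Longrightarrow> h (0, x) = x"
  shows "\<exists>H. continuous_on ({0..1} \<times> points K) H \<and> (\<forall>t\<in>{0..1}. \<forall>x\<in>points K. H (t, x) \<in> points K) \<and>
    (\<forall>x\<in>points K. H (0, x) = x) \<and> (\<forall>t\<in>{0..1}. \<forall>x\<in>points (K - S). H (t, x) = h (t, x))"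
proof -
  let ?D = "{0..1::real} \<times> points K"
  define r where "r = (\<lambda>p. (1 - Lam (snd p)) * (1 + fst p))"
  define H where "H = (\<lambda>p. if r p \<le> 1 then push (fst p) (snd p) else h (r p - 1, proj (snd p)))"
  have cr: "continuous_on D r" for D unfolding r_def
    by (intro continuous_on_mult continuous_on_diff continuous_on_add continuous_on_const
        continuous_on_Lam continuous_on_fst continuous_on_snd continuous_on_id)
  have sub: "points (K - S) \<subseteq> points K" by (rule points_mono) auto
  have r1: "r p - 1 \<in> {0..1}" "Lam (snd p) < 1" if "p \<in> ?D" "1 \<le> r p" for p
  proof -
    have t: "0 \<le> fst p" "fst p \<le> 1" and L: "0 \<le> Lam (snd p)" "Lam (snd p) \<le> 1"
      using that(1) Lam_bounds[of "snd p"] by auto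
    have "r p \<le> 1 * 2" unfolding r_def using t L by (intro mult_mono) auto
    then show "r p - 1 \<in> {0..1}" using that(2) by auto
    have "Lam (snd p) \<noteq> 1" using that(2) unfolding r_def by auto
    then show "Lam (snd p) < 1" using L by auto
  qed
  have "continuous_on ?D H"
    unfolding H_def
  proof (rule continuous_on_cases_le[OF _ _ cr])
    show "continuous_on {p \<in> ?D. r p \<le> 1} (\<lambda>p. push (fst p) (snd p))"
      by (intro continuous_on_push continuous_on_fst continuous_on_snd continuous_on_id)
    let ?E = "{p \<in> ?D. 1 \<le> r p}"
    have "continuous_on ?E (\<lambda>p. proj (snd p))"
    proof (rule continuous_on_coordinatewise_then_product)
      fix v
      have "\<forall>p\<in>?E. 1 - Lam (snd p) \<noteq> 0" using r1(2) by force
      then show "continuous_on ?E (\<lambda>p. proj (snd p) v)" unfolding proj_def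
        by (intro continuous_on_divide continuous_on_boundary_part continuous_on_diff continuous_on_const
            continuous_on_Lam continuous_on_snd continuous_on_id)
    qed
    then have "continuous_on ?E (\<lambda>p. (r p - 1, proj (snd p)))"
      by (intro continuous_on_Pair continuous_on_diff cr continuous_on_const)
    moreover have "(\<lambda>p. (r p - 1, proj (snd p))) ` ?E \<subseteq> {0..1} \<times> points (K - S)"
    proof
      fix z assume "z \<in> (\<lambda>p. (r p - 1, proj (snd p))) ` ?E"
      then obtain p where p: "p \<in> ?D" "1 \<le> r p" "z = (r p - 1, proj (snd p))" by auto
      have "snd p \<in> points K" using p(1) by auto
      then show "z \<in> {0..1} \<times> points (K - S)" using r1[OF p(1,2)] proj_points[of "snd p"] p(3) by auto
    qed
    ultimately show "continuous_on ?E (\<lambda>p. h (r p - 1, proj (snd p)))"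
      by (rule continuous_on_compose2[OF h(1)])
    fix p assume p: "p \<in> ?D" "r p = 1"
    then have "Lam (snd p) < 1" "snd p \<in> points K" "0 \<le> fst p" using r1(2)[OF p(1)] by auto
    then show "push (fst p) (snd p) = h (r p - 1, proj (snd p))"
      using push_eq_proj[of "snd p" "fst p"] h(3)[OF proj_points[of "snd p"]] p(2) unfolding r_def by auto
  qed
  moreover have "H (t, x) \<in> points K" if t: "t \<in> {0..1}" and x: "x \<in> points K" for t x
  proof (cases "r (t, x) \<le> 1")
    case True
    then show ?thesis unfolding H_def using push_points[OF x, of t] t by (auto simp: r_def)
  next
    case False
    then have "r (t, x) - 1 \<in> {0..1}" "Lam x < 1" using r1[of "(t, x)"] t x by auto
    then have "h (r (t, x) - 1, proj x) \<in> points (K - S)" using h(2) proj_points[OF x] by blast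
    then show ?thesis unfolding H_def using False sub by auto
  qed
  moreover have "H (0, x) = x" if x: "x \<in> points K" for x
    using Lam_bounds[OF x] push_zero[OF x] unfolding H_def r_def by simp
  moreover have "H (t, x) = h (t, x)" if t: "t \<in> {0..1}" and x: "x \<in> points (K - S)" for t x
  proof -
    have xK: "x \<in> points K" using x sub by auto
    then have l: "\<And>s. s \<in> S \<Longrightarrow> lam s x = 0" using points_diff_iff x by auto
    show ?thesis using t push_zero[OF xK] h(3)[OF x] outside(1)[OF l] outside(4)[OF l]
      unfolding H_def r_def by auto
  qed
  ultimately show ?thesis by blast
qed

end

lemma sum_lessThan_split0:
  fixes f :: "nat \<Rightarrow> real"
  assumes "0 < c"
  shows "sum f {..<c} = f 0 + sum f {1..<c}"
proof -
  have "{..<c} = insert 0 {1..<c}" using assms by auto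
  then show ?thesis by simp
qed

lemma wedge_sphere_iff:
  assumes "0 < c"
  shows "w \<in> wedge_sphere k (int c - 1) \<longleftrightarrow> (\<forall>a i. (a \<noteq> k \<or> i \<ge> c) \<longrightarrow> w (a, i) = 0) \<and>
    (w (k, 0) - 1)\<^sup>2 + (\<Sum>i\<in>{1..<c}. (w (k, i))\<^sup>2) = 1"
proof -
  have "{i. int i \<le> int c - 1} = {..<c}" by auto
  moreover have "(\<Sum>i\<in>{..<c}. (w (k, i) - (if i = 0 then 1 else 0))\<^sup>2) =
    (w (k, 0) - 1)\<^sup>2 + (\<Sum>i\<in>{1..<c}. (w (k, i))\<^sup>2)"
    unfolding sum_lessThan_split0[OF assms] by (auto intro!: sum.cong)
  moreover have "int i > int c - 1 \<longleftrightarrow> i \<ge> c" for i by auto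
  ultimately show ?thesis using assms unfolding wedge_sphere_def by simp
qed

section \<open>The quotient map onto the wedge of spheres\<close>

locale cells_attached_list = cells_attached K S for K S :: "'v set set" +
  fixes ss :: "'v set list"
  assumes ss: "distinct ss" "set ss = S"
begin

definition en :: "'v set \<Rightarrow> nat \<Rightarrow> 'v" where
  "en s = (SOME f. bij_betw f {..<card s} s)"

lemma en: "s \<in> S \<Longrightarrow> bij_betw (en s) {..<card s} s"
  unfolding en_def using S_props(2)[of s] ex_bij_betw_nat_finite[of s]
  by (intro someI_ex[of "\<lambda>f. bij_betw f {..<card s} s"]) (auto simp: atLeast0LessThan)

text \<open>Vertex 0 of the enumeration is left out: its weight is determined by the total weight 1,
  and coordinate 0 of the target is reserved for the direction of the centre of the sphere.\<close>

definition sq :: "'v set \<Rightarrow> ('v \<Rightarrow> real) \<Rightarrow> real" where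
  "sq s x = (\<Sum>i\<in>{1..<card s}. (x (en s i) - 1 / card s)\<^sup>2)"

text \<open>The last summand vanishes on the cell of \<open>s\<close>; it keeps the denominator positive elsewhere.\<close>
definition den :: "'v set \<Rightarrow> ('v \<Rightarrow> real) \<Rightarrow> real" where
  "den s x = (lam s x)\<^sup>2 + sq s x + (1 - sum x s)"

text \<open>On the cell of \<open>s\<close> this is the homeomorphism \<open>x \<mapsto> (x - b) / lam s x\<close> of the open
  simplex with barycentre \<open>b\<close> onto Euclidean space followed by inverse stereographic projection.\<close>
definition wmap :: "('v \<Rightarrow> real) \<Rightarrow> nat \<times> nat \<Rightarrow> real" where
  "wmap x = (\<lambda>(k, i). if k < length ss \<and> i < card (ss ! k)
     then 2 * lam (ss ! k) x * (if i = 0 then lam (ss ! k) x else x (en (ss ! k) i) - 1 / card (ss ! k)) / den (ss ! k) x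
     else 0)"

lemma sum_en:
  fixes f :: "'v \<Rightarrow> real"
  assumes "s \<in> S"
  shows "sum f s = f (en s 0) + (\<Sum>i\<in>{1..<card s}. f (en s i))"
  using sum.reindex_bij_betw[OF en[OF assms], of f] sum_lessThan_split0[OF S_props(4)[OF assms], of "\<lambda>i. f (en s i)"]
  by simp

lemma en_surj: "s \<in> S \<Longrightarrow> v \<in> s \<Longrightarrow> \<exists>i<card s. v = en s i"
  using bij_betw_imp_surj_on[OF en, of s] by (metis (no_types, lifting) image_iff lessThan_iff)

lemma sum_le1:
  assumes "s \<in> S" "x \<in> points K"
  shows "sum x s \<le> 1"
proof -
  let ?t = "{v. x v \<noteq> 0}"
  have fin: "finite ?t" using assms(2) simplicial_complexD(1)[OF cK] unfolding points_def by auto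
  have "sum x s \<le> sum x (s \<union> ?t)"
    using assms(2) S_props(2)[OF assms(1)] fin by (intro sum_mono2) (auto simp: points_def)
  then show ?thesis using points_sum[OF assms(2), of "s \<union> ?t"] S_props(2)[OF assms(1)] fin by auto
qed

text \<open>All three summands are nonnegative. If they vanish together, the coordinates of
  \<open>x\<close> on \<open>s\<close> are those of the barycentre, but there \<open>lam s x\<close>
  is 1.\<close>

lemma den_pos:
  assumes "s \<in> S" "x \<in> points K"
  shows "0 < den s x"
proof (rule ccontr)
  assume "\<not> 0 < den s x"
  moreover have nn: "0 \<le> sq s x" unfolding sq_def by (intro sum_nonneg) auto
  ultimately have z: "(lam s x)\<^sup>2 = 0" "sq s x = 0" "sum x s = 1"
    using sum_le1[OF assms] zero_le_power2[of "lam s x"] unfolding den_def by linarith+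
  have c: "real (card s) > 0" using S_props(4)[OF assms(1)] by simp
  have e: "x (en s i) = 1 / card s" if "i \<in> {1..<card s}" for i
    using z(2) that unfolding sq_def by (subst (asm) sum_nonneg_eq_0_iff) auto
  have "x (en s 0) = 1 - (\<Sum>i\<in>{1..<card s}. x (en s i))" using z(3) sum_en[OF assms(1), of x] by simp
  also have "\<dots> = 1 - (real (card s) - 1) / card s"
    using e S_props(4)[OF assms(1)] by (simp add: of_nat_diff)
  also have "\<dots> = 1 / card s" using c by (simp add: field_simps)
  finally have e0: "x (en s 0) = 1 / card s" .
  have "x v = 1 / card s" if v: "v \<in> s" for v
  proof -
    obtain i where "i < card s" "v = en s i" using en_surj[OF assms(1) v] by auto
    then show ?thesis using e e0 by (cases "i = 0") auto
  qed
  then have "lam s x / card s = 1 / card s" using lam_attained[OF assms(1), of x] by auto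
  then show False using z(1) c by simp
qed

lemma continuous_on_wmap: "continuous_on (points K) wmap"
proof (rule continuous_on_coordinatewise_then_product)
  fix p :: "nat \<times> nat"
  obtain k i where p: "p = (k, i)" by (cases p)
  show "continuous_on (points K) (\<lambda>x. wmap x p)"
  proof (cases "k < length ss \<and> i < card (ss ! k)")
    case False
    then have eq: "(\<lambda>x. wmap x p) = (\<lambda>x. 0)" unfolding wmap_def p by (auto simp: fun_eq_iff)
    show ?thesis unfolding eq by (rule continuous_on_const)
  next
    case True
    let ?s = "ss ! k"
    have s: "?s \<in> S" using True ss(2) by auto
    have c: "continuous_on (points K) (\<lambda>x. x v)" for v
      by (rule continuous_on_subset[OF continuous_on_product_coordinates]) auto
    have l: "continuous_on (points K) (lam ?s)" by (rule continuous_on_lam[OF s continuous_on_id])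
    have "continuous_on (points K) (den ?s)"
      unfolding den_def sq_def
      by (intro continuous_on_add continuous_on_diff continuous_on_sum continuous_on_power continuous_on_const l c)
    moreover have "\<forall>x\<in>points K. den ?s x \<noteq> 0" using den_pos[OF s] by force
    moreover have "continuous_on (points K) (\<lambda>x. if i = 0 then lam ?s x else x (en ?s i) - 1 / card ?s)"
      using l c by (cases "i = 0") (auto intro!: continuous_intros)
    ultimately have *: "continuous_on (points K)
      (\<lambda>x. 2 * lam ?s x * (if i = 0 then lam ?s x else x (en ?s i) - 1 / card ?s) / den ?s x)"
      using l by (intro continuous_on_divide continuous_on_mult continuous_on_const)
    have eq: "(\<lambda>x. wmap x p) =
      (\<lambda>x. 2 * lam ?s x * (if i = 0 then lam ?s x else x (en ?s i) - 1 / card ?s) / den ?s x)"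
      unfolding wmap_def p using True by (auto simp: fun_eq_iff)
    show ?thesis unfolding eq by (rule *)
  qed
qed

lemma wmap_outside: "x \<in> points (K - S) \<Longrightarrow> wmap x = (\<lambda>_. 0)"
proof -
  assume x: "x \<in> points (K - S)"
  then have "x \<in> points K" using points_mono[of "K - S" K] by auto
  then have "\<forall>s\<in>S. lam s x = 0" using points_diff_iff x by auto
  then have "lam (ss ! k) x = 0" if "k < length ss" for k using that ss(2) by auto
  then show ?thesis unfolding wmap_def by (auto simp: fun_eq_iff)
qed

lemma wmap_inside:
  assumes x: "x \<in> points K" and k: "k < length ss" and s: "s = ss ! k"
    and supp: "{v. x v \<noteq> 0} = s"
  shows "wmap x (k, 0) = 2 * (lam s x)\<^sup>2 / ((lam s x)\<^sup>2 + sq s x)"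
    "i \<in> {1..<card s} \<Longrightarrow> wmap x (k, i) = 2 * lam s x * (x (en s i) - 1 / card s) / ((lam s x)\<^sup>2 + sq s x)"
    "a \<noteq> k \<or> i \<ge> card s \<Longrightarrow> wmap x (a, i) = 0"
    "0 < (lam s x)\<^sup>2 + sq s x" "0 < lam s x"
proof -
  have sS: "s \<in> S" using k s ss(2) by auto
  have "sum x s = 1" using points_sum[OF x S_props(2)[OF sS]] supp by auto
  then have den: "den s x = (lam s x)\<^sup>2 + sq s x" unfolding den_def by simp
  then show "0 < (lam s x)\<^sup>2 + sq s x" using den_pos[OF sS x] by simp
  have "lam s x \<noteq> 0" using lam_nz_iff[OF sS x] supp by auto
  then show "0 < lam s x" using lam_ge0[OF sS x] by auto
  show "wmap x (k, 0) = 2 * (lam s x)\<^sup>2 / ((lam s x)\<^sup>2 + sq s x)"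
    using k s S_props(4)[OF sS] den unfolding wmap_def by (simp add: power2_eq_square)
  show "i \<in> {1..<card s} \<Longrightarrow> wmap x (k, i) = 2 * lam s x * (x (en s i) - 1 / card s) / ((lam s x)\<^sup>2 + sq s x)"
    using k s den unfolding wmap_def by simp
  have "lam (ss ! a) x = 0" if "a < length ss" "a \<noteq> k" for a
  proof -
    have "ss ! a \<noteq> s" using that k s ss(1) nth_eq_iff_index_eq by blast
    then show ?thesis using lam_nz_iff[OF _ x, of "ss ! a"] that supp ss(2) by auto
  qed
  then show "a \<noteq> k \<or> i \<ge> card s \<Longrightarrow> wmap x (a, i) = 0"
    using s unfolding wmap_def by (cases "a = k") auto
qed

text \<open>With y for the coordinates of \<open>(x - b) / lam s x\<close> from index 1 on, the
  image is the second intersection of the sphere with the line through the origin and (1, y). The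
  wedge point is thus the centre of projection, which points approach as \<open>lam s x\<close>
  tends to 0.\<close>

lemma wmap_sphere:
  assumes x: "x \<in> points K" and k: "k < length ss" and s: "s = ss ! k" and supp: "{v. x v \<noteq> 0} = s"
  shows "wmap x \<in> wedge_sphere k (int (card s) - 1)"
proof -
  note w = wmap_inside[OF assms]
  have sS: "s \<in> S" using k s ss(2) by auto
  let ?L = "lam s x" and ?Q = "(lam s x)\<^sup>2 + sq s x"
  have "(\<Sum>i\<in>{1..<card s}. (wmap x (k, i))\<^sup>2) = (\<Sum>i\<in>{1..<card s}. (2 * ?L / ?Q)\<^sup>2 * (x (en s i) - 1 / card s)\<^sup>2)"
    by (rule sum.cong) (auto simp: w(2) power_mult_distrib power_divide)
  also have "\<dots> = (2 * ?L / ?Q)\<^sup>2 * sq s x" unfolding sq_def sum_distrib_left ..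
  also have "\<dots> = (2 * ?L / ?Q)\<^sup>2 * (?Q - ?L\<^sup>2)" by simp
  finally have "(wmap x (k, 0) - 1)\<^sup>2 + (\<Sum>i\<in>{1..<card s}. (wmap x (k, i))\<^sup>2) =
     (2 * ?L\<^sup>2 / ?Q - 1)\<^sup>2 + (2 * ?L / ?Q)\<^sup>2 * (?Q - ?L\<^sup>2)" using w(1) by simp
  also have "\<dots> = 1"
  proof -
    have *: "(2 * L\<^sup>2 / Q - 1)\<^sup>2 + (2 * L / Q)\<^sup>2 * (Q - L\<^sup>2) = 1" if "Q > 0" for L Q :: real
      using that by (simp add: field_simps power2_eq_square)
    show ?thesis by (rule *[OF w(4)])
  qed
  finally show ?thesis using w(3) by (subst wedge_sphere_iff[OF S_props(4)[OF sS]]) auto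
qed

text \<open>Dividing the image coordinates by coordinate 0 recovers
  \<open>(x - b) / lam s x\<close>, at vertex 0 through the total weight. The least entry of this
  vector is \<open>(lam s x - 1) / (lam s x * card s)\<close>, which is strictly increasing in
  \<open>lam s x\<close>; so \<open>lam s x\<close> is recovered too.\<close>

lemma wmap_inj:
  assumes x: "x \<in> points K" and y: "y \<in> points K" and eq: "wmap x = wmap y"
    and nx: "x \<notin> points (K - S)"
  shows "x = y"
proof -
  obtain s where s: "s \<in> S" "{v. x v \<noteq> 0} = s" using points_cases[OF x] nx by metis
  then obtain k where k: "k < length ss" "s = ss ! k" using ss(2) by (metis in_set_conv_nth)
  note wx = wmap_inside[OF x k s(2)]
  have nz: "wmap y (k, 0) \<noteq> 0" using wx(1,4,5) eq by simp
  then have "y \<notin> points (K - S)" using wmap_outside[of y] by auto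
  then obtain s' where s': "s' \<in> S" "{v. y v \<noteq> 0} = s'" using points_cases[OF y] by metis
  then obtain k' where k': "k' < length ss" "s' = ss ! k'" using ss(2) by (metis in_set_conv_nth)
  have "k' = k" using wmap_inside(3)[OF y k' s'(2), of k 0] nz by auto
  then have ys: "{v. y v \<noteq> 0} = s" using s' k' k by simp
  note wy = wmap_inside[OF y k ys]
  let ?L = "lam s x" and ?M = "lam s y" and ?Q = "(lam s x)\<^sup>2 + sq s x" and ?R = "(lam s y)\<^sup>2 + sq s y"
  have c: "0 < real (card s)" using S_props(4)[OF s(1)] by simp
  have e0: "?L\<^sup>2 / ?Q = ?M\<^sup>2 / ?R" using wx(1) wy(1) eq by simp
  have ratio: "(x (en s i) - 1 / card s) / ?L = (y (en s i) - 1 / card s) / ?M" if i: "i \<in> {1..<card s}" for i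
  proof -
    have "?L * (x (en s i) - 1 / card s) / ?Q = ?M * (y (en s i) - 1 / card s) / ?R"
      using wx(2)[OF i] wy(2)[OF i] eq by simp
    then have "(?L * (x (en s i) - 1 / card s) / ?Q) / (?L\<^sup>2 / ?Q) = (?M * (y (en s i) - 1 / card s) / ?R) / (?M\<^sup>2 / ?R)"
      using e0 by simp
    moreover have *: "(L * z / Q) / (L\<^sup>2 / Q) = z / L" if "L > 0" "Q > 0" for L z Q :: real
      using that by (simp add: power2_eq_square)
    ultimately show ?thesis using *[OF wx(5,4)] *[OF wy(5,4)] by simp
  qed
  have rest: "z (en s 0) - 1 / card s = - (\<Sum>i\<in>{1..<card s}. z (en s i) - 1 / card s)"
    if "z \<in> points K" "{v. z v \<noteq> 0} = s" for z
  proof -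
    have "1 = sum z s" using points_sum[OF that(1) S_props(2)[OF s(1)]] that(2) by auto
    then have "1 = z (en s 0) + (\<Sum>i\<in>{1..<card s}. z (en s i))" using sum_en[OF s(1), of z] by simp
    moreover have "(\<Sum>i\<in>{1..<card s}. z (en s i) - 1 / card s) = (\<Sum>i\<in>{1..<card s}. z (en s i)) - (real (card s) - 1) / card s"
      using c by (simp add: sum_subtractf of_nat_diff)
    moreover have "(real (card s) - 1) / card s = 1 - 1 / card s" using c by (simp add: field_simps)
    ultimately show ?thesis by linarith
  qed
  have ratio0: "(x (en s 0) - 1 / card s) / ?L = (y (en s 0) - 1 / card s) / ?M"
    unfolding rest[OF x s(2)] rest[OF y ys] minus_divide_left[symmetric] sum_divide_distrib
    by (rule arg_cong[where f = uminus], rule sum.cong) (auto simp: ratio)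
  have all: "(x v - 1 / card s) / ?L = (y v - 1 / card s) / ?M" if v: "v \<in> s" for v
  proof -
    obtain i where "i < card s" "v = en s i" using en_surj[OF s(1) v] by auto
    then show ?thesis using ratio ratio0 by (cases "i = 0") auto
  qed
  \<comment> \<open>The comparison is made at a vertex where the minimum of \<open>a\<close> is
    attained; the entry of \<open>b\<close> there is at least its own minimum.\<close>
  have le: "lam s b \<le> lam s a"
    if ab: "\<And>v. v \<in> s \<Longrightarrow> (a v - 1 / card s) / lam s a = (b v - 1 / card s) / lam s b" "0 < lam s a" "0 < lam s b" for a b
  proof -
    obtain v where v: "v \<in> s" "a v = lam s a / card s" using lam_attained[OF s(1)] by blast
    have "(lam s b / card s - 1 / card s) / lam s b \<le> (b v - 1 / card s) / lam s b"
      using lam_le[OF s(1) v(1), of b] ab(3) by (intro divide_right_mono) auto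
    also have "\<dots> = (lam s a / card s - 1 / card s) / lam s a" using ab(1)[OF v(1)] v(2) by simp
    finally have "(lam s b - 1) / lam s b / card s \<le> (lam s a - 1) / lam s a / card s"
      by (simp add: diff_divide_distrib[symmetric] mult.commute)
    then have "(lam s b - 1) / lam s b \<le> (lam s a - 1) / lam s a"
      using c by (subst (asm) divide_le_cancel) auto
    then have "1 / lam s a \<le> 1 / lam s b" using ab(2,3) by (simp add: diff_divide_distrib)
    then show ?thesis using ab(2,3) by (simp add: field_simps)
  qed
  have LM: "?L = ?M" using le[of x y] le[of y x] all wx(5) wy(5) by fastforce
  show "x = y"
  proof
    fix v show "x v = y v"
    proof (cases "v \<in> s")
      case True
      then show ?thesis using all[OF True] LM wx(5) by simp
    next
      case False
      then have "x v = 0" "y v = 0" using s(2) ys by blast+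
      then show ?thesis by simp
    qed
  qed
qed

lemma wmap_surj:
  assumes k: "k < length ss" and w: "w \<in> wedge_sphere k (int (card (ss ! k)) - 1)" and wnz: "w \<noteq> (\<lambda>_. 0)"
  shows "w \<in> wmap ` points K"
proof -
  define s where "s = ss ! k"
  have s: "s \<in> S" using k ss(2) unfolding s_def by auto
  define c where "c = card s"
  have c: "0 < c" "0 < real c" using S_props(4)[OF s] unfolding c_def by auto
  have w0: "\<And>a i. a \<noteq> k \<or> i \<ge> c \<Longrightarrow> w (a, i) = 0"
    and w1: "(w (k, 0) - 1)\<^sup>2 + (\<Sum>i\<in>{1..<c}. (w (k, i))\<^sup>2) = 1"
    using w wedge_sphere_iff[OF c(1), of w k] unfolding c_def s_def by auto
  define T where "T = (\<Sum>i\<in>{1..<c}. (w (k, i))\<^sup>2)"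
  have T0: "0 \<le> T" unfolding T_def by (intro sum_nonneg) auto
  have T: "T = 2 * w (k, 0) - (w (k, 0))\<^sup>2" using w1 unfolding T_def by (simp add: power2_eq_square algebra_simps)
  \<comment> \<open>The sphere touches the hyperplane of vanishing coordinate 0 only at the wedge
    point and otherwise lies on its positive side.\<close>
  have pos: "0 < w (k, 0)"
  proof (rule ccontr)
    assume "\<not> 0 < w (k, 0)"
    then have "w (k, 0) = 0 \<and> T = 0" using T T0 zero_le_power2[of "w (k, 0)"]
      by (smt (verit) power2_eq_square mult_eq_0_iff)
    then have "w (k, i) = 0" if "i < c" for i
      using that unfolding T_def by (cases "i = 0") (auto simp: sum_nonneg_eq_0_iff)
    then have "w (a, i) = 0" for a i using w0[of a i] by (cases "a = k \<and> i < c") auto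
    then show False using wnz by auto
  qed
  \<comment> \<open>Entry 0 is chosen to make the sum vanish, since a difference from the barycentre
    has total weight 0.\<close>
  define u where "u = (\<lambda>i. if i = 0 then - (\<Sum>j\<in>{1..<c}. w (k, j) / w (k, 0)) else w (k, i) / w (k, 0))"
  have usum: "sum u {..<c} = 0" unfolding sum_lessThan_split0[OF c(1)] u_def by simp
  define m where "m = Min (u ` {..<c})"
  have m_le: "m \<le> u i" if "i < c" for i unfolding m_def using that by auto
  have "real c * m = (\<Sum>i\<in>{..<c}. m)" by simp
  also have "\<dots> \<le> 0" unfolding usum[symmetric] using m_le by (intro sum_mono) auto
  finally have m0: "m \<le> 0" using c(2) by (simp add: mult_le_0_iff)
  \<comment> \<open>The preimage sought is the barycentre plus \<open>L * u\<close>, and its radial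
    coordinate must be \<open>L\<close> again. So its least coordinate \<open>1 / c + L * m\<close>
    has to equal \<open>L / c\<close>; this equation determines \<open>L\<close>, and
    \<open>m \<le> 0\<close> makes the solution positive.\<close>
  define L where "L = 1 / (1 - c * m)"
  have Lpos: "0 < L" unfolding L_def using mult_nonneg_nonpos[of "real c" m] m0 c(2) by simp
  have Lm: "1 / c + L * m = L / c"
  proof -
    have "1 - c * m > 0" using m0 c(2) by (smt (verit) mult_nonneg_nonpos)
    then show ?thesis unfolding L_def using c(2) by (simp add: field_simps)
  qed
  define x where "x = (\<lambda>v. if v \<in> s then 1 / c + L * u (inv_into {..<c} (en s) v) else 0)"
  have inj: "inj_on (en s) {..<c}" using en[OF s] unfolding c_def bij_betw_def by auto
  have ens: "en s i \<in> s" if "i < c" for i using en[OF s] that unfolding c_def bij_betw_def by auto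
  have xen: "x (en s i) = 1 / c + L * u i" if "i < c" for i
    using inv_into_f_f[OF inj, of i] that ens[OF that] unfolding x_def by auto
  have xge: "L / c \<le> x (en s i)" if "i < c" for i
    using xen[OF that] m_le[OF that] Lm Lpos by (smt (verit) mult_left_mono)
  have xs: "L / c \<le> x v" if v: "v \<in> s" for v
    using en_surj[OF s v] xge unfolding c_def by auto
  have Lc: "0 < L / c" using Lpos c by simp
  have "sum x s = sum (\<lambda>i. x (en s i)) {..<c}"
    using sum.reindex_bij_betw[OF en[OF s], of x] unfolding c_def by simp
  also have "\<dots> = (\<Sum>i\<in>{..<c}. 1 / c + L * u i)" by (rule sum.cong) (auto simp: xen)
  also have "\<dots> = 1" using usum c by (simp add: sum.distrib sum_distrib_left[symmetric])
  finally have xsum: "sum x s = 1" .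
  have xK: "x \<in> points K"
  proof (rule pointsI[OF cK S_props(1)[OF s] _ _ xsum])
    show "0 \<le> x v" for v using xs[of v] Lc by (cases "v \<in> s") (auto simp: x_def)
    show "x v = 0" if "v \<notin> s" for v using that unfolding x_def by simp
  qed
  have supp: "{v. x v \<noteq> 0} = s"
    using xs Lc by (auto simp: x_def split: if_splits) (smt (verit))
  have "Min (x ` s) = L / c"
  proof (rule Min_eqI)
    show "finite (x ` s)" using S_props(2)[OF s] by auto
    show "\<And>y. y \<in> x ` s \<Longrightarrow> L / c \<le> y" using xs by auto
    have "m \<in> u ` {..<c}" unfolding m_def using c(1) by (intro Min_in) auto
    then obtain i where "i < c" "u i = m" by auto
    then show "L / c \<in> x ` s" using xen[of i] Lm ens[of i] by (metis image_eqI)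
  qed
  then have lam: "lam s x = L" unfolding lam_def using c unfolding c_def by simp
  have z: "x (en s i) - 1 / c = L * (w (k, i) / w (k, 0))" if "i \<in> {1..<c}" for i
    using xen[of i] that unfolding u_def by auto
  have "sq s x = (\<Sum>i\<in>{1..<c}. (L / w (k, 0))\<^sup>2 * (w (k, i))\<^sup>2)"
    unfolding sq_def c_def[symmetric] by (rule sum.cong) (auto simp: z power_mult_distrib power_divide)
  also have "\<dots> = (L / w (k, 0))\<^sup>2 * T" unfolding T_def sum_distrib_left ..
  finally have sq: "sq s x = (L / w (k, 0))\<^sup>2 * (2 * w (k, 0) - (w (k, 0))\<^sup>2)" unfolding T .
  have Q: "(lam s x)\<^sup>2 + sq s x = 2 * L\<^sup>2 / w (k, 0)"
    unfolding lam sq using pos by (simp add: field_simps power2_eq_square)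
  note wx = wmap_inside[OF xK k s_def supp]
  have "wmap x (a, i) = w (a, i)" for a i
  proof (cases "a = k \<and> i < c")
    case False
    then show ?thesis using w0[of a i] wx(3)[of a i] unfolding c_def by auto
  next
    case True
    show ?thesis
    proof (cases "i = 0")
      case True
      have "wmap x (k, 0) = 2 * L\<^sup>2 / (2 * L\<^sup>2 / w (k, 0))" using wx(1) unfolding Q unfolding lam .
      also have "\<dots> = w (k, 0)" using pos Lpos by simp
      finally show ?thesis using True \<open>a = k \<and> i < c\<close> by simp
    next
      case False
      then have i: "i \<in> {1..<c}" using True by auto
      have "wmap x (k, i) = 2 * L * (L * (w (k, i) / w (k, 0))) / (2 * L\<^sup>2 / w (k, 0))"
        using wx(2)[of i] i z[OF i] unfolding Q unfolding lam c_def[symmetric] by simp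
      also have "\<dots> = w (k, i)" using pos Lpos by (simp add: power2_eq_square)
      finally show ?thesis using True by simp
    qed
  qed
  then have "w = wmap x" by (auto simp: fun_eq_iff)
  then show ?thesis using xK by auto
qed

text \<open>\<open>wmap\<close> crushes the residual complex to the wedge point and is injective
  elsewhere. Since the contraction of the residual complex extends over the cells, crushing it
  preserves the homotopy type.\<close>

theorem homotopy_equivalent_wedge:
  assumes con: "contractible_space (geom_realization (K - S))" and ne: "points (K - S) \<noteq> {}"
  shows "geom_realization K homotopy_equivalent_space wedge_of_spheres (map (\<lambda>s. int (card s) - 1) ss)"
proof -
  let ?ds = "map (\<lambda>s. int (card s) - 1) ss"
  let ?A = "points K" and ?A' = "points (K - S)"
  define W where "W = (if ?ds = [] then {\<lambda>_. 0} else {}) \<union> (\<Union>k<length ?ds. wedge_sphere k (?ds ! k))"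
  have sub: "?A' \<subseteq> ?A" by (rule points_mono) auto
  have img: "wmap ` ?A = W"
  proof
    show "wmap ` ?A \<subseteq> W"
    proof
      fix w assume "w \<in> wmap ` ?A"
      then obtain x where x: "x \<in> ?A" "w = wmap x" by auto
      from x(1) show "w \<in> W"
      proof (cases rule: points_cases)
        case 1
        then have w: "w = (\<lambda>_. 0)" using wmap_outside x by auto
        show ?thesis
        proof (cases "ss = []")
          case True
          then show ?thesis unfolding W_def w by simp
        next
          case False
          then have "ss ! 0 \<in> S" using ss(2) by auto
          then have "0 < card (ss ! 0)" using S_props(4) by auto
          then have "w \<in> wedge_sphere 0 (int (card (ss ! 0)) - 1)" unfolding w by (simp add: wedge_sphere_iff)
          then show ?thesis unfolding W_def using False by auto
        qed
      next
        case (2 s)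
        then obtain k where k: "k < length ss" "s = ss ! k" using ss(2) by (metis in_set_conv_nth)
        have "w \<in> wedge_sphere k (?ds ! k)" using wmap_sphere[OF x(1) k 2(2)] x(2) k by simp
        then show ?thesis unfolding W_def using k by auto
      qed
    qed
    \<comment> \<open>The residual complex has a point, and it goes to the wedge point; with no
      cells attached, that point is the whole wedge.\<close>
    have z: "(\<lambda>_. 0) \<in> wmap ` ?A" using ne wmap_outside sub by (metis (no_types, lifting) all_not_in_conv image_iff subsetD)
    show "W \<subseteq> wmap ` ?A"
    proof
      fix w assume w: "w \<in> W"
      show "w \<in> wmap ` ?A"
      proof (cases "w = (\<lambda>_. 0)")
        case True
        then show ?thesis using z by simp
      next
        case False
        then obtain k where "k < length ss" "w \<in> wedge_sphere k (int (card (ss ! k)) - 1)"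
          using w unfolding W_def by (auto split: if_splits)
        then show ?thesis using wmap_surj False by auto
      qed
    qed
  qed
  obtain h a where h: "continuous_on ({0..1::real} \<times> ?A') h" "h \<in> {0..1} \<times> ?A' \<rightarrow> ?A'"
    "\<And>x. x \<in> ?A' \<Longrightarrow> h (0, x) = x" "\<And>x. x \<in> ?A' \<Longrightarrow> h (1, x) = a"
  proof -
    obtain a where "homotopic_with (\<lambda>x. True) (top_of_set ?A') (top_of_set ?A') id (\<lambda>x. a)"
      using con unfolding contractible_space_def geom_realization_points by (elim exE)
    then obtain h where hh: "continuous_map (prod_topology (top_of_set {0..1::real}) (top_of_set ?A')) (top_of_set ?A') h"
      "\<forall>x. h (0, x) = id x" "\<forall>x. h (1, x) = a"
      unfolding homotopic_with_def by (elim exE conjE) (rule that, assumption+)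
    show thesis using hh by (intro that[of h a]) auto
  qed
  obtain H where H: "continuous_on ({0..1} \<times> ?A) H" "\<forall>t\<in>{0..1}. \<forall>x\<in>?A. H (t, x) \<in> ?A"
    "\<forall>x\<in>?A. H (0, x) = x" "\<forall>t\<in>{0..1}. \<forall>x\<in>?A'. H (t, x) = h (t, x)"
  proof -
    have "\<exists>H. continuous_on ({0..1} \<times> ?A) H \<and> (\<forall>t\<in>{0..1}. \<forall>x\<in>?A. H (t, x) \<in> ?A) \<and>
      (\<forall>x\<in>?A. H (0, x) = x) \<and> (\<forall>t\<in>{0..1}. \<forall>x\<in>?A'. H (t, x) = h (t, x))"
      by (rule homotopy_extension[OF h(1)]) (use h in auto)
    then show thesis by (elim exE conjE) (rule that, assumption+)
  qed
  have "top_of_set ?A homotopy_equivalent_space top_of_set W"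
  proof (rule homotopy_equivalent_collapse_contractible[OF compact_points[OF finK cK] sub continuous_on_wmap img
        Hausdorff_space_fun _ _ H(1)])
    show "x = y \<or> x \<in> ?A' \<and> y \<in> ?A'" if "x \<in> ?A" "y \<in> ?A" "wmap x = wmap y" for x y
      using wmap_inj[OF that] wmap_inj[OF that(2,1) that(3)[symmetric]] by auto
    show "wmap x = wmap y" if "x \<in> ?A'" "y \<in> ?A'" for x y using that wmap_outside by auto
    show "H (t, x) \<in> ?A" if "t \<in> {0..1}" "x \<in> ?A" for t x using H(2) that by auto
    show "H (t, x) \<in> ?A'" if "t \<in> {0..1}" "x \<in> ?A'" for t x using H(4) h(2) that by auto
    show "H (0, x) = x" if "x \<in> ?A" for x using H(3) that by auto
    show "H (1, x) = a" if "x \<in> ?A'" for x using H(4) h(4) that by auto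
  qed
  then show ?thesis unfolding geom_realization_points wedge_of_spheres_def W_def .
qed

end

section \<open>Disjoint families ordered by refinement\<close>

definition finer :: "'a set set \<Rightarrow> 'a set set \<Rightarrow> bool" where
  "finer P Q \<longleftrightarrow> (\<forall>X\<in>P. \<exists>Y\<in>Q. X \<subseteq> Y)"

text \<open>On arbitrary families refinement is only a preorder. Its strict part is a strict order
  nevertheless, so the poset lemmas apply on the whole type; antisymmetry is available on disjoint
  families of nonempty sets.\<close>

definition rlt :: "'a set set \<Rightarrow> 'a set set \<Rightarrow> bool" where
  "rlt P Q \<longleftrightarrow> finer P Q \<and> \<not> finer Q P"

lemma finerE:
  assumes "finer P Q" "X \<in> P"
  obtains Y where "Y \<in> Q" "X \<subseteq> Y"
  using assms unfolding finer_def by blast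

lemma finer_refl: "finer P P"
  unfolding finer_def by auto

lemma finer_trans:
  assumes "finer P Q" "finer Q S"
  shows "finer P S"
  unfolding finer_def
proof
  fix X assume "X \<in> P"
  then obtain Y where "Y \<in> Q" "X \<subseteq> Y" using assms(1) unfolding finer_def by auto
  moreover obtain Z where "Z \<in> S" "Y \<subseteq> Z" using assms(2) \<open>Y \<in> Q\<close> unfolding finer_def by auto
  ultimately show "\<exists>Z\<in>S. X \<subseteq> Z" by blast
qed

interpretation R: strict_poset "rlt :: 'a set set \<Rightarrow> 'a set set \<Rightarrow> bool"
proof
  show "\<not> rlt x x" for x :: "'a set set" unfolding rlt_def by auto
  show "rlt x z" if "rlt x y" "rlt y z" for x y z :: "'a set set"
    using that finer_trans unfolding rlt_def by metis
qed

interpretation B: strict_poset "(\<subset>) :: 'a set \<Rightarrow> 'a set \<Rightarrow> bool"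
  by standard auto

lemma rlt_singleton: "rlt {X} {Y} \<longleftrightarrow> X \<subset> Y"
  unfolding rlt_def finer_def by auto

lemma comparable_singleton: "comparable rlt {X} {Y} \<longleftrightarrow> comparable (\<subset>) X Y"
  unfolding comparable_def rlt_singleton by auto

text \<open>Closure under enlarging lets blocks grow point by point. The bound 2 excludes
  singletons, which impose no equation between coordinates and would break covering relations such
  as \<open>sat_insert\<close>.\<close>

locale upset_family =
  fixes N :: "'n::finite set set"
  assumes up: "X \<in> N \<Longrightarrow> X \<subseteq> Y \<Longrightarrow> Y \<in> N" and two: "X \<in> N \<Longrightarrow> 2 \<le> card X"
begin

definition fams :: "'n set set set" where
  "fams = {Q. Q \<subseteq> N \<and> disjoint Q}"

lemma N_nonempty: "X \<in> N \<Longrightarrow> X \<noteq> {}"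
  using two by fastforce

lemma famsD: "Q \<in> fams \<Longrightarrow> X \<in> Q \<Longrightarrow> X \<in> N" "Q \<in> fams \<Longrightarrow> X \<in> Q \<Longrightarrow> X \<noteq> {}"
  "Q \<in> fams \<Longrightarrow> X \<in> Q \<Longrightarrow> Y \<in> Q \<Longrightarrow> x \<in> X \<Longrightarrow> x \<in> Y \<Longrightarrow> X = Y"
proof -
  show 1: "X \<in> N" if "Q \<in> fams" "X \<in> Q" using that unfolding fams_def by auto
  then show "X \<noteq> {}" if "Q \<in> fams" "X \<in> Q" using that N_nonempty by auto
  show "X = Y" if "Q \<in> fams" "X \<in> Q" "Y \<in> Q" "x \<in> X" "x \<in> Y"
  proof (rule ccontr)
    assume "X \<noteq> Y"
    then have "X \<inter> Y = {}" using that unfolding fams_def by (auto simp: disjoint_def)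
    then show False using that by auto
  qed
qed

lemma famsI: "(\<And>X. X \<in> Q \<Longrightarrow> X \<in> N) \<Longrightarrow> (\<And>X Y x. X \<in> Q \<Longrightarrow> Y \<in> Q \<Longrightarrow> x \<in> X \<Longrightarrow> x \<in> Y \<Longrightarrow> X = Y) \<Longrightarrow> Q \<in> fams"
  unfolding fams_def disjoint_def by blast

lemma singleton_fams: "{X} \<in> fams \<longleftrightarrow> X \<in> N"
  unfolding fams_def disjoint_def by auto

lemma empty_fams: "{} \<in> fams"
  unfolding fams_def disjoint_def by auto

lemma finer_subset:
  assumes "P \<in> fams" "Q \<in> fams" "finer P Q" "finer Q P"
  shows "P \<subseteq> Q"
proof
  fix X assume X: "X \<in> P"
  obtain Y where Y: "Y \<in> Q" "X \<subseteq> Y" using assms(3) X unfolding finer_def by auto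
  obtain X' where X': "X' \<in> P" "Y \<subseteq> X'" using assms(4) Y unfolding finer_def by auto
  obtain x where "x \<in> X" using famsD(2)[OF assms(1) X] by auto
  then have "X = X'" using famsD(3)[OF assms(1) X X'(1), of x] Y(2) X'(2) by auto
  then show "X \<in> Q" using Y X'(2) by auto
qed

lemma finer_antisym: "P \<in> fams \<Longrightarrow> Q \<in> fams \<Longrightarrow> finer P Q \<Longrightarrow> finer Q P \<Longrightarrow> P = Q"
  using finer_subset[of P Q] finer_subset[of Q P] by auto

lemma rlt_iff: "P \<in> fams \<Longrightarrow> Q \<in> fams \<Longrightarrow> rlt P Q \<longleftrightarrow> finer P Q \<and> P \<noteq> Q"
  using finer_antisym[of P Q] finer_refl unfolding rlt_def by auto

lemma rle_iff: "P \<in> fams \<Longrightarrow> Q \<in> fams \<Longrightarrow> finer P Q \<longleftrightarrow> P = Q \<or> rlt P Q"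
  using rlt_iff[of P Q] finer_refl by auto

lemma finer_top: "finer Q {B} \<longleftrightarrow> \<Union>Q \<subseteq> B"
  unfolding finer_def by auto

lemma rlt_bot: "Q \<in> fams \<Longrightarrow> rlt {} Q \<longleftrightarrow> Q \<noteq> {}"
  unfolding rlt_def finer_def by auto

lemma interval_bot_top:
  assumes "B \<in> N"
  shows "{Q\<in>fams. rlt {} Q \<and> rlt Q {B}} = {Q\<in>fams. Q \<noteq> {} \<and> \<Union>Q \<subseteq> B \<and> Q \<noteq> {B}}"
proof (rule Collect_cong)
  fix Q
  show "(Q \<in> fams \<and> rlt {} Q \<and> rlt Q {B}) \<longleftrightarrow> (Q \<in> fams \<and> Q \<noteq> {} \<and> \<Union>Q \<subseteq> B \<and> Q \<noteq> {B})"
    using rlt_bot[of Q] rlt_iff[of Q "{B}"] assms singleton_fams[of B] finer_top[of Q B] by metis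
qed

lemma interval_bot_topD:
  assumes "B \<in> N" "Q \<in> fams" "rlt {} Q" "rlt Q {B}"
  shows "Q \<noteq> {}" "\<Union>Q \<subseteq> B" "Q \<noteq> {B}"
proof -
  have "Q \<in> {Q\<in>fams. rlt {} Q \<and> rlt Q {B}}" using assms by simp
  then show "Q \<noteq> {}" "\<Union>Q \<subseteq> B" "Q \<noteq> {B}" unfolding interval_bot_top[OF assms(1)] by simp_all
qed

lemma sat_minimal:
  assumes "E \<in> N" "\<And>X. X \<in> N \<Longrightarrow> X \<subseteq> E \<Longrightarrow> X = E"
  shows "R.sat fams {} {} {E}"
proof (rule R.sat_cover)
  show "rlt {} {E}" using rlt_bot singleton_fams assms by auto
  fix z assume z: "z \<in> fams" "rlt {} z" "rlt z {E}"
  note zE = interval_bot_topD[OF assms(1) z]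
  have "X = E" if "X \<in> z" for X using assms(2)[OF famsD(1)[OF z(1) that]] zE(2) that by auto
  then have "z = {E}" using zE(1) by auto
  then show False using zE(3) by simp
qed

lemma sat_insert:
  assumes X: "X \<in> N" "a \<notin> X"
  shows "R.sat fams {X} {} {insert a X}"
proof (rule R.sat_cover)
  show "rlt {X} {insert a X}" using X by (auto simp: rlt_singleton)
  fix z assume z: "z \<in> fams" "rlt {X} z" "rlt z {insert a X}"
  then obtain C where C: "C \<in> z" "X \<subseteq> C" unfolding rlt_def finer_def by auto
  have zi: "\<Union>z \<subseteq> insert a X" using z(3) unfolding rlt_def finer_top by auto
  have same: "D = C" if D: "D \<in> z" for D
  proof (rule ccontr)
    assume "D \<noteq> C"
    then have "D \<inter> X = {}" using famsD(3)[OF z(1) D C(1)] C(2) by auto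
    then have "D \<subseteq> {a}" using zi D by auto
    then have "card D \<le> 1" using card_mono[of "{a}" D] by auto
    then show False using two[OF famsD(1)[OF z(1) D]] by auto
  qed
  have "z \<subseteq> {C}" using same by auto
  then have "z = {C}" using C(1) by auto
  moreover have "C \<subseteq> insert a X" using zi C(1) by auto
  then have "C = X \<or> C = insert a X" using C(2) by auto
  ultimately show False using z(2,3) R.irrefl by metis
qed

text \<open>Between \<open>P\<close> and \<open>insert B P\<close> the blocks of \<open>P\<close>
  stay untouched and the only freedom is a nonempty family inside \<open>B\<close> other than
  \<open>{B}\<close>. Adding \<open>P\<close> is therefore an isomorphism from the interval under
  \<open>{B}\<close>.\<close>

lemma sat_extend:
  assumes P: "P \<in> fams" and B: "B \<in> N" "B \<inter> \<Union>P = {}" and sat: "R.sat fams {} c {B}"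
  shows "R.sat fams P ((\<union>) P ` c) (insert B P)"
proof -
  let ?I = "{z\<in>fams. rlt {} z \<and> rlt z {B}}"
  let ?J = "{z\<in>fams. rlt P z \<and> rlt z (insert B P)}"
  have BP: "insert B P \<in> fams"
  proof (rule famsI)
    show "X \<in> N" if "X \<in> insert B P" for X using that famsD(1)[OF P] B by auto
    show "X = Y" if "X \<in> insert B P" "Y \<in> insert B P" "x \<in> X" "x \<in> Y" for X Y x
      using that famsD(3)[OF P, of X Y x] B(2) by auto
  qed
  have BnP: "B \<notin> P" using B(2) N_nonempty[OF B(1)] by auto
  have lt: "rlt P (insert B P)" using rlt_iff[OF P BP] BnP unfolding finer_def by auto
  have I: "?I = {Q\<in>fams. Q \<noteq> {} \<and> \<Union>Q \<subseteq> B \<and> Q \<noteq> {B}}" by (rule interval_bot_top[OF B(1)])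
  have dis: "Q \<inter> P = {}" if "Q \<in> ?I" for Q
  proof -
    have "X \<notin> P" if X: "X \<in> Q" for X
    proof
      assume "X \<in> P"
      moreover have "X \<subseteq> B" "X \<noteq> {}" using X \<open>Q \<in> ?I\<close> famsD(2)[of Q X] unfolding I by auto
      ultimately have "X \<subseteq> B \<inter> \<Union>P" by auto
      then show False using B(2) \<open>X \<noteq> {}\<close> by simp
    qed
    then show ?thesis by auto
  qed
  have fam: "P \<union> Q \<in> fams" if "Q \<in> ?I" for Q
  proof (rule famsI)
    have Q: "Q \<in> fams" "\<Union>Q \<subseteq> B" using that unfolding I by auto
    show "X \<in> N" if "X \<in> P \<union> Q" for X using that famsD(1)[OF P] famsD(1)[OF Q(1)] by auto
    show "X = Y" if "X \<in> P \<union> Q" "Y \<in> P \<union> Q" "x \<in> X" "x \<in> Y" for X Y x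
    proof -
      have no: False if "x \<in> \<Union>P" "x \<in> \<Union>Q"
      proof -
        have "x \<in> B \<inter> \<Union>P" using that Q(2) by auto
        then show False using B(2) by simp
      qed
      have "\<not> (X \<in> P \<and> Y \<in> Q)" "\<not> (X \<in> Q \<and> Y \<in> P)" using that(3,4) no by auto
      then show ?thesis using that famsD(3)[OF P, of X Y x] famsD(3)[OF Q(1), of X Y x] by auto
    qed
  qed
  have ref: "finer (P \<union> Q) (P \<union> Q') \<longleftrightarrow> finer Q Q'" if "Q \<in> ?I" "Q' \<in> ?I" for Q Q'
  proof
    assume r: "finer (P \<union> Q) (P \<union> Q')"
    show "finer Q Q'" unfolding finer_def
    proof
      fix X assume X: "X \<in> Q"
      then obtain Y where Y: "Y \<in> P \<union> Q'" "X \<subseteq> Y" using r unfolding finer_def by auto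
      have "X \<subseteq> B" "X \<noteq> {}" using X that(1) famsD(2)[of Q X] unfolding I by auto
      then have "X \<subseteq> B \<inter> \<Union>P" if "Y \<in> P" using that Y(2) by auto
      then have "Y \<notin> P" using B(2) \<open>X \<noteq> {}\<close> by auto
      then show "\<exists>Y\<in>Q'. X \<subseteq> Y" using Y by auto
    qed
  qed (auto simp: finer_def)
  have inj: "inj_on ((\<union>) P) ?I"
  proof (rule inj_onI)
    fix Q Q' assume "Q \<in> ?I" "Q' \<in> ?I" "P \<union> Q = P \<union> Q'"
    then show "Q = Q'" using dis[of Q] dis[of Q'] by blast
  qed
  have emb: "comparable rlt (P \<union> Q) (P \<union> Q') \<longleftrightarrow> comparable rlt Q Q'" if "Q \<in> ?I" "Q' \<in> ?I" for Q Q'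
    by (rule comparable_embedding[OF inj _ that]) (simp add: rlt_def ref)
  have img: "(\<union>) P ` ?I = ?J"
  proof
    show "(\<union>) P ` ?I \<subseteq> ?J"
    proof
      fix z assume "z \<in> (\<union>) P ` ?I"
      then obtain Q where Q: "Q \<in> ?I" "z = P \<union> Q" by auto
      have zf: "z \<in> fams" using fam Q by auto
      have QI: "Q \<in> fams" "Q \<noteq> {}" "\<Union>Q \<subseteq> B" "Q \<noteq> {B}" using Q(1) unfolding I by auto
      have "rlt P z" using rlt_iff[OF P zf] dis[OF Q(1)] QI(2) Q(2) unfolding finer_def by auto
      moreover have "z \<noteq> insert B P"
      proof
        assume "z = insert B P"
        then have "Q = {B}" using Q(2) dis[OF Q(1)] BnP by blast
        then show False using QI by auto
      qed
      then have "rlt z (insert B P)" using rlt_iff[OF zf BP] Q(2) QI(3) unfolding finer_def by auto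
      ultimately show "z \<in> ?J" using zf by auto
    qed
    show "?J \<subseteq> (\<union>) P ` ?I"
    proof
      fix z assume z: "z \<in> ?J"
      then have zf: "z \<in> fams" and r1: "finer P z" "P \<noteq> z" and r2: "finer z (insert B P)" "z \<noteq> insert B P"
        using rlt_iff[OF P] rlt_iff[OF _ BP] by auto
      have "P \<subseteq> z"
      proof
        fix X assume X: "X \<in> P"
        obtain Y where Y: "Y \<in> z" "X \<subseteq> Y" using finerE[OF r1(1) X] by metis
        obtain X' where X': "X' \<in> insert B P" "Y \<subseteq> X'" using finerE[OF r2(1) Y(1)] by metis
        obtain x where "x \<in> X" using famsD(2)[OF P X] by auto
        then have "X = X'" using famsD(3)[OF BP _ X'(1), of X x] X Y(2) X'(2) by auto
        then show "X \<in> z" using Y X'(2) by auto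
      qed
      moreover have "z - P \<in> ?I" unfolding I
      proof (intro CollectI conjI)
        show "z - P \<in> fams" using famsD(1,3)[OF zf] by (intro famsI) auto
        show "z - P \<noteq> {}" using \<open>P \<subseteq> z\<close> r1(2) by auto
        show "z - P \<noteq> {B}" using \<open>P \<subseteq> z\<close> r2(2) by auto
        have "X \<subseteq> B" if X: "X \<in> z" "X \<notin> P" for X
        proof -
          obtain Y where Y: "Y \<in> insert B P" "X \<subseteq> Y" using finerE[OF r2(1) X(1)] by metis
          obtain x where x: "x \<in> X" using famsD(2)[OF zf X(1)] by auto
          have "Y \<notin> P"
          proof
            assume "Y \<in> P"
            then have "X = Y" using famsD(3)[OF zf X(1), of Y x] \<open>P \<subseteq> z\<close> Y x by auto
            then show False using X \<open>Y \<in> P\<close> by auto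
          qed
          then show ?thesis using Y by auto
        qed
        then show "\<Union>(z - P) \<subseteq> B" by auto
      qed
      ultimately show "z \<in> (\<union>) P ` ?I" by (intro image_eqI[of _ _ "z - P"]) auto
    qed
  qed
  have mc: "max_chain rlt ?I c" using sat unfolding R.sat_def by auto
  then have "c \<subseteq> ?I" unfolding max_chain_def by (auto dest: chainsD(1))
  from max_chain_image[OF inj emb this] mc have "max_chain rlt ((\<union>) P ` ?I) ((\<union>) P ` c)" by simp
  then show ?thesis unfolding R.sat_def img using lt by simp
qed

definition merge :: "'n set \<Rightarrow> 'n set \<Rightarrow> 'n set set \<Rightarrow> 'n set set" where
  "merge a b P = insert (a \<union> b) (P - {a, b})"

lemma merge_fams:
  assumes P: "P \<in> fams" "a \<in> P" "b \<in> P"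
  shows "merge a b P \<in> fams"
proof (rule famsI)
  show "X \<in> N" if "X \<in> merge a b P" for X
    using that famsD(1)[OF P(1)] up[of a "a \<union> b"] P unfolding merge_def by auto
  show "X = Y" if "X \<in> merge a b P" "Y \<in> merge a b P" "x \<in> X" "x \<in> Y" for X Y x
  proof -
    have "x \<notin> Z" if "Z \<in> P - {a, b}" "x \<in> a \<union> b" for Z
      using that famsD(3)[OF P(1) P(2), of Z x] famsD(3)[OF P(1) P(3), of Z x] by auto
    then show ?thesis using that famsD(3)[OF P(1), of X Y x] unfolding merge_def by auto
  qed
qed

lemma merge_Union: "a \<in> P \<Longrightarrow> b \<in> P \<Longrightarrow> \<Union>(merge a b P) = \<Union>P"
  unfolding merge_def by auto

lemma merge_union_notin:
  assumes "P \<in> fams" "a \<in> P" "b \<in> P" "a \<noteq> b"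
  shows "a \<union> b \<notin> P"
proof
  assume "a \<union> b \<in> P"
  moreover obtain x y where "x \<in> a" "y \<in> b" using famsD(2)[OF assms(1)] assms(2,3) by blast
  ultimately have "a = a \<union> b" "b = a \<union> b"
    using famsD(3)[OF assms(1,2), of "a \<union> b" x] famsD(3)[OF assms(1,3), of "a \<union> b" y] by auto
  then show False using assms(4) by auto
qed

lemma sat_merge:
  assumes P: "P \<in> fams" "a \<in> P" "b \<in> P" "a \<noteq> b"
  shows "R.sat fams P {} (merge a b P)"
proof (rule R.sat_cover)
  have M: "merge a b P \<in> fams" by (rule merge_fams[OF P(1-3)])
  have "merge a b P \<noteq> P" using merge_union_notin[OF P] unfolding merge_def by auto
  then show "rlt P (merge a b P)" using rlt_iff[OF P(1) M] unfolding finer_def merge_def by auto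
  fix z assume z: "z \<in> fams" "rlt P z" "rlt z (merge a b P)"
  have r: "finer P z" "P \<noteq> z" "finer z (merge a b P)" "z \<noteq> merge a b P"
    using z rlt_iff[OF P(1) z(1)] rlt_iff[OF z(1) M] by auto
  obtain A where A: "A \<in> z" "a \<subseteq> A" using r(1) P(2) unfolding finer_def by auto
  obtain B where B: "B \<in> z" "b \<subseteq> B" using r(1) P(3) unfolding finer_def by auto
  obtain x y where xy: "x \<in> a" "y \<in> b" using famsD(2)[OF P(1)] P(2,3) by blast
  have bound: "\<exists>Y\<in>merge a b P. X \<subseteq> Y" if "X \<in> z" for X using r(3) that unfolding finer_def by auto
  have ab: "X \<subseteq> a \<union> b" if X: "X \<in> z" "u \<in> X" "u \<in> a \<union> b" for X u
  proof -
    obtain Y where Y: "Y \<in> merge a b P" "X \<subseteq> Y" using bound[OF X(1)] by auto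
    have "a \<union> b \<in> merge a b P" unfolding merge_def by auto
    then have "Y = a \<union> b" using famsD(3)[OF M Y(1), of "a \<union> b" u] Y X by auto
    then show ?thesis using Y by auto
  qed
  have blocks: "X \<in> z" if X: "X \<in> P - {a, b}" for X
  proof -
    obtain Y where Y: "Y \<in> z" "X \<subseteq> Y" using r(1) X unfolding finer_def by auto
    obtain Z where Z: "Z \<in> merge a b P" "Y \<subseteq> Z" using bound[OF Y(1)] by auto
    obtain u where "u \<in> X" using famsD(2)[OF P(1)] X by blast
    moreover have "X \<in> merge a b P" using X unfolding merge_def by auto
    ultimately have "X = Z" using famsD(3)[OF M _ Z(1), of X u] Y Z by auto
    then show ?thesis using Y Z by auto
  qed
  \<comment> \<open>A family in between either joins the two blocks, and is then at least as coarse
    as the merge, or keeps them apart, and then refines \<open>P\<close>.\<close>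
  show False
  proof (cases "A = B")
    case True
    then have AB: "A = a \<union> b" using A B ab[OF A(1), of x] xy by auto
    have "finer (merge a b P) z" unfolding finer_def merge_def using AB A blocks by blast
    then show False using z(3) unfolding rlt_def by auto
  next
    case False
    have "A \<subseteq> a"
    proof
      fix u assume u: "u \<in> A"
      then have "u \<in> a \<union> b" using ab[OF A(1), of x] xy A by auto
      moreover have "u \<notin> b" using famsD(3)[OF z(1) A(1) B(1), of u] u B False by auto
      ultimately show "u \<in> a" by auto
    qed
    moreover have "B \<subseteq> b"
    proof
      fix u assume u: "u \<in> B"
      then have "u \<in> a \<union> b" using ab[OF B(1), of y] xy B by auto
      moreover have "u \<notin> a" using famsD(3)[OF z(1) A(1) B(1), of u] u A False by auto
      ultimately show "u \<in> b" by auto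
    qed
    ultimately have AB: "A = a" "B = b" using A B by auto
    have "finer z P" unfolding finer_def
    proof
      fix X assume X: "X \<in> z"
      obtain Y where Y: "Y \<in> merge a b P" "X \<subseteq> Y" using bound[OF X] by auto
      show "\<exists>Y\<in>P. X \<subseteq> Y"
      proof (cases "Y \<in> P")
        case True then show ?thesis using Y by auto
      next
        case False
        then have "X \<subseteq> a \<union> b" using Y unfolding merge_def by auto
        moreover obtain u where "u \<in> X" using famsD(2)[OF z(1) X] by auto
        ultimately have "X = a \<or> X = b"
          using famsD(3)[OF z(1) X A(1), of u] famsD(3)[OF z(1) X B(1), of u] AB by auto
        then show ?thesis using P by auto
      qed
    qed
    then show False using z(2) unfolding rlt_def by auto
  qed
qed

end

section \<open>Boolean intervals and their flags\<close>

inductive flag :: "'a set \<Rightarrow> 'a set \<Rightarrow> 'a set set \<Rightarrow> bool" where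
  flag_base: "a \<notin> X \<Longrightarrow> flag X (insert a X) {}"
| flag_step: "a \<notin> X \<Longrightarrow> flag (insert a X) B c \<Longrightarrow> flag X B (insert (insert a X) c)"

lemma flag_sat: "flag X B c \<Longrightarrow> B.sat UNIV X c B"
proof (induction rule: flag.induct)
  case (flag_base a X)
  then show ?case by (intro B.sat_cover) auto
next
  case (flag_step a X B c)
  have "B.sat UNIV X {} (insert a X)" using flag_step by (intro B.sat_cover) auto
  from B.sat_compose[OF this flag_step.IH] show ?case by simp
qed

lemma flag_max_chain: "flag X B c \<Longrightarrow> max_chain (\<subset>) {Z. X \<subset> Z \<and> Z \<subset> B} c"
  using flag_sat[of X B c] unfolding B.sat_def by simp

lemma flag_subset:
  assumes "flag X B c"
  shows "c \<subseteq> {Z. X \<subset> Z \<and> Z \<subset> B}"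
proof -
  have "c \<in> order_complex (\<subset>) {Z. X \<subset> Z \<and> Z \<subset> B}"
    using flag_max_chain[OF assms] unfolding max_chain_def by simp
  then show ?thesis by (rule chainsD(1))
qed

lemma flag_card:
  "flag X B c \<Longrightarrow> finite X \<Longrightarrow> finite c \<and> card B = card X + card c + 1"
proof (induction rule: flag.induct)
  case (flag_step a X B c)
  have "insert a X \<notin> c" using flag_subset[OF flag_step.hyps(2)] by auto
  then show ?case using flag_step by auto
qed auto

text \<open>A flag of sets stays saturated when its members are read as one-block families, because
  no second block fits into a single added point.\<close>

lemma (in upset_family) flag_fams_sat:
  "flag X B c \<Longrightarrow> X \<in> N \<Longrightarrow> R.sat fams {X} ((\<lambda>Z. {Z}) ` c) {B}"
proof (induction rule: flag.induct)
  case (flag_base a X)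
  then show ?case using sat_insert by auto
next
  case (flag_step a X B c)
  have aX: "insert a X \<in> N" using up[OF flag_step.prems] by auto
  have "R.sat fams {X} ({} \<union> insert {insert a X} ((\<lambda>Z. {Z}) ` c)) {B}"
    using flag_step aX by (intro R.sat_compose[OF sat_insert]) (auto simp: singleton_fams)
  then show ?case by simp
qed

text \<open>Fix \<open>a\<close> in \<open>B - X\<close>. Without the atom \<open>insert a X\<close>
  the interval contracts by \<open>Z \<mapsto> Z - {a}\<close> towards \<open>B - {a}\<close>. The
  atom has nothing below it and a shorter Boolean interval above it, so exactly one chain is passed
  on by the induction.\<close>

lemma flag_good_exists:
  fixes X B :: "'a set"
  assumes "finite B" "X \<subset> B"
  shows "\<exists>c. flag X B c \<and> good (\<subset>) {Z. X \<subset> Z \<and> Z \<subset> B} {c}"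
  using assms
proof (induction "card (B - X)" arbitrary: X rule: less_induct)
  case less
  obtain a where a: "a \<in> B" "a \<notin> X" using less.prems by auto
  show ?case
  proof (cases "B = insert a X")
    case True
    have "{Z. X \<subset> Z \<and> Z \<subset> B} = {}" using True by auto
    then show ?thesis using flag_base[OF a(2)] True good_empty by metis
  next
    case False
    let ?x = "insert a X"
    have xB: "?x \<subset> B" using False a less.prems by auto
    have "B - ?x \<subset> B - X" using a by auto
    then have "card (B - ?x) < card (B - X)" using less.prems(1) by (intro psubset_card_mono) auto
    then obtain c where c: "flag ?x B c" "good (\<subset>) {Z. ?x \<subset> Z \<and> Z \<subset> B} {c}"
      using less.hyps[of ?x] less.prems(1) xB by auto
    have f: "flag X B (insert ?x c)" by (rule flag_step[OF a(2) c(1)])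
    let ?X = "{Z. X \<subset> Z \<and> Z \<subset> B}" and ?Y = "{Z. X \<subset> Z \<and> Z \<subset> B} - {?x}"
    have fin: "finite ?X" by (rule finite_subset[of _ "Pow B"]) (use less.prems(1) in auto)
    have colY: "collapses (order_complex (\<subset>) ?Y) {}"
    proof (rule B.meet_contractible[where a = "B - {a}" and m = "\<lambda>Z. Z - {a}"])
      show "finite ?Y" using fin by auto
      show "B - {a} \<in> ?Y" using a less.prems False by auto
      fix Z assume Z: "Z \<in> ?Y"
      then have "X \<subset> Z - {a}" using a(2) by auto
      then show "Z - {a} \<in> ?Y \<and> (Z - {a} = Z \<or> Z - {a} \<subset> Z) \<and> (Z - {a} = B - {a} \<or> Z - {a} \<subset> B - {a})"
        using Z by auto
      fix Z' assume "Z' \<subset> Z" "Z' = B - {a} \<or> Z' \<subset> B - {a}"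
      then show "Z' = Z - {a} \<or> Z' \<subset> Z - {a}" by auto
    qed
    have "good (\<subset>) ?X ({} \<union> (\<Union>x\<in>?X - ?Y. glue {{}} x {c}))"
    proof (rule B.good_insert_elements[OF fin])
      have XY: "x = ?x" if "x \<in> ?X - ?Y" for x using that by auto
      show "good (\<subset>) ?Y {}" using colY fin unfolding good_def by auto
      fix x assume x: "x \<in> ?X - ?Y"
      have "{y\<in>?Y. y \<subset> x} = {}" unfolding XY[OF x] by auto
      then show "good (\<subset>) {y\<in>?Y. y \<subset> x} {{}}" using good_empty by metis
      have "{z\<in>?X. x \<subset> z} = {Z. ?x \<subset> Z \<and> Z \<subset> B}" unfolding XY[OF x] by auto
      then show "good (\<subset>) {z\<in>?X. x \<subset> z} {c}" using c(2) by simp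
      fix d assume "d \<in> glue {{}} x {c}"
      then have "d = insert ?x c" unfolding glue_def XY[OF x] by auto
      then show "max_chain (\<subset>) ?X d" using flag_max_chain[OF f] by simp
    qed auto
    moreover have "?X - ?Y = {?x}" using xB a by auto
    ultimately have "good (\<subset>) ?X {insert ?x c}" by (simp add: glue_def)
    then show ?thesis using f by blast
  qed
qed

section \<open>Shellings, and the sets below a given set\<close>

lemma max_chain_converse: "max_chain (\<lambda>x y. lt y x) X c \<longleftrightarrow> max_chain lt X c"
proof -
  have "comparable (\<lambda>x y. lt y x) = comparable lt" by (auto simp: comparable_def fun_eq_iff)
  then show ?thesis unfolding max_chain_def chains_converse[of lt X] by simp
qed

lemma good_converse: "good (\<lambda>x y. lt y x) X S \<longleftrightarrow> good lt X S"
  unfolding good_def chains_converse[of lt X] max_chain_converse[of lt X] ..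

lemma (in strict_poset) good_superposet:
  assumes "finite X" "Y \<subseteq> X" "good lt Y S" "\<And>c. c \<in> S \<Longrightarrow> max_chain lt X c"
    "\<And>x. x \<in> X - Y \<Longrightarrow> collapses (order_complex lt {y\<in>Y. lt y x}) {}"
  shows "good lt X S"
proof -
  have "\<forall>c\<in>S. max_chain lt X c \<and> c \<subseteq> Y" using assms(4) goodD(3)[OF assms(3)] by auto
  from collapses_chains_subposet[OF assms(1,2) this assms(5)]
  have "collapses (order_complex lt X - S) {}" using goodD(5)[OF assms(3)] by (rule collapses_trans)
  then show ?thesis using assms(1,4) unfolding good_def by auto
qed

lemma good_superposet_up:
  assumes "strict_poset lt" "finite X" "Y \<subseteq> X" "good lt Y S" "\<And>c. c \<in> S \<Longrightarrow> max_chain lt X c"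
    "\<And>x. x \<in> X - Y \<Longrightarrow> collapses (order_complex lt {y\<in>Y. lt x y}) {}"
  shows "good lt X S"
proof -
  interpret c: strict_poset "\<lambda>x y. lt y x" by (rule strict_poset_converse[OF assms(1)])
  have "good (\<lambda>x y. lt y x) X S"
  proof (rule c.good_superposet[OF assms(2,3)])
    show "good (\<lambda>x y. lt y x) Y S" using assms(4) good_converse[of lt Y S] by simp
    show "max_chain (\<lambda>x y. lt y x) X c" if "c \<in> S" for c
      using assms(5)[OF that] max_chain_converse[of lt X c] by simp
    show "collapses (order_complex (\<lambda>x y. lt y x) {y\<in>Y. lt x y}) {}" if "x \<in> X - Y" for x
      using assms(6)[OF that] chains_converse[of lt "{y\<in>Y. lt x y}"] by simp
  qed
  then show ?thesis using good_converse[of lt X S] by simp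
qed

text \<open>The sets \<open>E i\<close> are the complements of the facets; the axiom \<open>shell\<close> is the shelling condition read on complements.\<close>
locale edge_order =
  fixes E :: "nat \<Rightarrow> 'n::finite set" and q :: nat
  assumes anti: "i < q \<Longrightarrow> j < q \<Longrightarrow> E i \<subseteq> E j \<Longrightarrow> i = j"
    and card_two: "i < q \<Longrightarrow> 2 \<le> card (E i)"
    and shell: "i < j \<Longrightarrow> j < q \<Longrightarrow> \<exists>v\<in>E i. v \<notin> E j \<and> (\<exists>k<j. E k \<subseteq> insert v (E j))"
begin

text \<open>The complement of \<open>E i \<union> R i\<close> is the paper's \<open>G\<^sub>i\<close>.\<close>
definition R :: "nat \<Rightarrow> 'n set" where
  "R i = {v. v \<notin> E i \<and> (\<exists>k<i. E k \<subseteq> insert v (E i))}"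

definition N :: "'n set set" where
  "N = {X. \<exists>i<q. E i \<subseteq> X}"

sublocale upset_family N
proof
  show "Y \<in> N" if "X \<in> N" "X \<subseteq> Y" for X Y
    using that order_trans unfolding N_def by blast
  show "2 \<le> card X" if X: "X \<in> N" for X
  proof -
    obtain i where "i < q" "E i \<subseteq> X" using X unfolding N_def by auto
    then show ?thesis using card_two[of i] card_mono[of X "E i"] by auto
  qed
qed

definition below :: "nat \<Rightarrow> 'n set \<Rightarrow> 'n set set" where
  "below m B = {X. X \<subset> B \<and> (\<exists>i<m. E i \<subseteq> X)}"

text \<open>The condition on a pair in a shelling-trapped decomposition, read on complements. The
  bound \<open>m\<close> restricts it to an initial segment of the shelling, over which
  \<open>below_good\<close> inducts.\<close>

definition trapped :: "nat \<Rightarrow> 'n set \<Rightarrow> nat set" where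
  "trapped m B = {i. i < m \<and> E i \<subseteq> B \<and> B \<subseteq> E i \<union> R i}"

definition fl :: "nat \<Rightarrow> 'n set \<Rightarrow> 'n set set" where
  "fl i B = (SOME c. flag (E i) B c \<and> good (\<subset>) {Z. E i \<subset> Z \<and> Z \<subset> B} {c})"

definition bchain :: "nat \<Rightarrow> 'n set \<Rightarrow> 'n set set" where
  "bchain i B = (if B = E i then {} else insert (E i) (fl i B))"

lemma fl:
  assumes "E i \<subset> B"
  shows "flag (E i) B (fl i B)" "good (\<subset>) {Z. E i \<subset> Z \<and> Z \<subset> B} {fl i B}"
  using someI_ex[OF flag_good_exists[OF finite assms]] unfolding fl_def by auto

lemma E_in_N: "i < q \<Longrightarrow> E i \<in> N"
  unfolding N_def by auto

lemma E_minimal: "i < q \<Longrightarrow> X \<in> N \<Longrightarrow> X \<subseteq> E i \<Longrightarrow> X = E i"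
  unfolding N_def using anti by blast

lemma R_edge: "v \<in> R j \<Longrightarrow> \<exists>k<j. E k \<subseteq> insert v (E j)"
  unfolding R_def by auto

lemma meet_R: "i < j \<Longrightarrow> j < q \<Longrightarrow> \<exists>v. v \<in> E i \<and> v \<in> R j"
  using shell[of i j] unfolding R_def by auto

lemma bchain_sat:
  assumes "i < q" "E i \<subseteq> B"
  shows "R.sat fams {} ((\<lambda>Z. {Z}) ` bchain i B) {B}"
proof -
  have m: "R.sat fams {} {} {E i}" using sat_minimal[OF E_in_N] E_minimal assms by auto
  show ?thesis
  proof (cases "B = E i")
    case True
    then show ?thesis using m unfolding bchain_def by simp
  next
    case False
    then have "flag (E i) B (fl i B)" using fl assms by auto
    from R.sat_compose[OF m flag_fams_sat[OF this E_in_N[OF assms(1)]]]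
    show ?thesis using False E_in_N[OF assms(1)] unfolding bchain_def by (simp add: singleton_fams)
  qed
qed

lemma bchain_above:
  assumes "E i \<subseteq> B" "X \<in> bchain i B"
  shows "E i \<subseteq> X" "X \<subset> B"
proof -
  have B: "E i \<subset> B" "X = E i \<or> X \<in> fl i B" using assms unfolding bchain_def by (auto split: if_splits)
  then show "E i \<subseteq> X" "X \<subset> B" using flag_subset[OF fl(1)[OF B(1)]] by auto
qed

lemma bchain_card:
  assumes "E i \<subseteq> B"
  shows "card (bchain i B) + card (E i) = card B"
proof (cases "B = E i")
  case False
  then have B: "E i \<subset> B" using assms by auto
  have "E i \<notin> fl i B" using flag_subset[OF fl(1)[OF B]] by auto
  then show ?thesis using flag_card[OF fl(1)[OF B]] False unfolding bchain_def by auto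
qed (simp add: bchain_def)

text \<open>\<open>Z \<mapsto> {Z}\<close> embeds \<open>below m B\<close> into the families under
  \<open>{B}\<close>, where the chain is saturated; maximality passes to the smaller poset.\<close>

lemma bchain_max:
  assumes "i < m" "m \<le> q" "E i \<subseteq> B"
  shows "max_chain (\<subset>) (below m B) (bchain i B)"
proof -
  have sub: "bchain i B \<subseteq> below m B" using bchain_above[OF assms(3)] assms(1) unfolding below_def by auto
  let ?f = "\<lambda>Z::'n set. {Z}"
  have bf: "?f ` below m B \<subseteq> {z\<in>fams. rlt {} z \<and> rlt z {B}}"
  proof
    fix z assume "z \<in> ?f ` below m B"
    then obtain X where X: "z = {X}" "X \<subset> B" "X \<in> N" using assms(2) unfolding below_def N_def by (auto intro: less_le_trans)
    then show "z \<in> {z\<in>fams. rlt {} z \<and> rlt z {B}}" by (simp add: singleton_fams rlt_bot rlt_singleton)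
  qed
  have "max_chain rlt {z\<in>fams. rlt {} z \<and> rlt z {B}} (?f ` bchain i B)"
    using bchain_sat[of i B] assms unfolding R.sat_def by simp
  then have "max_chain rlt (?f ` below m B) (?f ` bchain i B)"
    by (rule max_chain_subset) (use sub bf in auto)
  moreover have "inj_on ?f (below m B)" by (auto intro: inj_onI)
  ultimately show ?thesis using max_chain_image[of ?f "below m B" rlt "(\<subset>)"] sub by (simp add: comparable_singleton)
qed

text \<open>\<open>E i\<close> is the least member of its chain, unless the chain is empty and
  \<open>E i\<close> is \<open>B\<close> itself. In both cases the antichain condition recovers
  \<open>i\<close>.\<close>

lemma bchain_inj: "inj_on (\<lambda>i. bchain i B) (trapped q B)"
proof (rule inj_onI)
  fix i j assume ij: "i \<in> trapped q B" "j \<in> trapped q B" "bchain i B = bchain j B"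
  then have q: "i < q" "j < q" "E i \<subseteq> B" "E j \<subseteq> B" unfolding trapped_def by auto
  show "i = j"
  proof (cases "B = E i")
    case True
    then show ?thesis using anti[of j i] q by auto
  next
    case False
    then have "E i \<in> bchain i B" unfolding bchain_def by auto
    then have "E i \<in> bchain j B" unfolding ij(3) .
    then show ?thesis using bchain_above(1)[OF q(4)] anti[of j i] q by auto
  qed
qed

text \<open>Passing from \<open>m\<close> to \<open>Suc m\<close> adds the sets that contain
  \<open>E m\<close> but no earlier edge. If \<open>B\<close> lies in
  \<open>E m \<union> R m\<close>, every proper superset of \<open>E m\<close> inside
  \<open>B\<close> is old, so only \<open>E m\<close> is new, with a full Boolean interval above it,
  and one chain is added. Otherwise the old sets above \<open>E m\<close> contract and the removed
  chains stay the same. If no earlier edge lies in \<open>B\<close>, the poset is a cone with apex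
  \<open>E m\<close>, or empty when \<open>B = E m\<close>.\<close>

lemma below_good:
  "m \<le> q \<Longrightarrow> \<exists>i<m. E i \<subseteq> B \<Longrightarrow> good (\<subset>) (below m B) ((\<lambda>i. bchain i B) ` trapped m B)"
proof (induction m)
  case 0
  then show ?case by simp
next
  case (Suc m)
  let ?e = "E m"
  let ?S = "(\<lambda>i. bchain i B) ` trapped m B"
  have mq: "m < q" using Suc.prems(1) by auto
  have maxS: "max_chain (\<subset>) (below (Suc m) B) c" if c: "c \<in> ?S" for c
  proof -
    obtain i where "i \<in> trapped m B" "c = bchain i B" using c by auto
    then show ?thesis using bchain_max[of i "Suc m" B] Suc.prems(1) unfolding trapped_def by auto
  qed
  have RB: "\<exists>i<m. E i \<subseteq> X" if "v \<in> R m" "v \<in> X" "?e \<subseteq> X" for v X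
    using R_edge[OF that(1)] that(2,3) by blast
  consider "\<not> ?e \<subseteq> B" | "?e \<subseteq> B" "\<not> (\<exists>i<m. E i \<subseteq> B)" | "?e \<subseteq> B" "\<exists>i<m. E i \<subseteq> B" by auto
  then show ?case
  proof cases
    case 1
    then have "below (Suc m) B = below m B" "trapped (Suc m) B = trapped m B" "\<exists>i<m. E i \<subseteq> B"
      using Suc.prems(2) unfolding below_def trapped_def by (auto simp: less_Suc_eq)
    then show ?thesis using Suc.IH Suc.prems(1) by simp
  next
    case 2
    have bel: "below (Suc m) B = {X. X \<subset> B \<and> ?e \<subseteq> X}"
      using 2(2) unfolding below_def by (auto simp: less_Suc_eq)
    \<comment> \<open>A point of \<open>R m\<close> inside \<open>B\<close> would put an earlier
      edge into \<open>B\<close>.\<close>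
    have BR: "B \<inter> R m = {}" using RB[of _ B] 2 by auto
    show ?thesis
    proof (cases "B = ?e")
      case True
      have "trapped (Suc m) B = {m}"
        using 2(2) True unfolding trapped_def by (auto simp: less_Suc_eq)
      moreover have "below (Suc m) B = {}" using bel True by auto
      ultimately show ?thesis using True good_empty by (simp add: bchain_def)
    next
      case False
      have "trapped (Suc m) B = {}"
        using 2 BR False unfolding trapped_def by (auto simp: less_Suc_eq)
      moreover have "collapses (order_complex (\<subset>) (below (Suc m) B)) {}"
        by (rule chains_cone[of _ ?e]) (use False 2(1) in \<open>auto simp: bel comparable_def\<close>)
      ultimately show ?thesis unfolding good_def by auto
    qed
  next
    case 3
    have IH: "good (\<subset>) (below m B) ?S" using Suc.IH 3 Suc.prems(1) by simp
    have eB: "?e \<subset> B" using 3 anti[OF _ mq] mq by (metis less_trans nat_neq_iff psubsetI)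
    have low: "{y\<in>below m B. y \<subset> ?e} = {}"
    proof (rule ccontr)
      assume "{y\<in>below m B. y \<subset> ?e} \<noteq> {}"
      then obtain y i where "i < m" "E i \<subseteq> y" "y \<subset> ?e" unfolding below_def by auto
      then show False using anti[of i m] mq by auto
    qed
    have enb: "?e \<notin> below m B"
    proof
      assume "?e \<in> below m B"
      then obtain i where "i < m" "E i \<subseteq> ?e" unfolding below_def by auto
      then show False using anti[of i m] mq by auto
    qed
    show ?thesis
    proof (cases "B \<subseteq> ?e \<union> R m")
      case True
      have tr: "trapped (Suc m) B = insert m (trapped m B)"
        using 3 True unfolding trapped_def by (auto simp: less_Suc_eq)
      have bel: "below (Suc m) B = insert ?e (below m B)"
      proof
        show "below (Suc m) B \<subseteq> insert ?e (below m B)"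
        proof
          fix X assume X: "X \<in> below (Suc m) B"
          show "X \<in> insert ?e (below m B)"
          proof (cases "X = ?e \<or> \<not> ?e \<subseteq> X")
            case True
            then show ?thesis using X unfolding below_def by (auto simp: less_Suc_eq)
          next
            case False
            then obtain v where "v \<in> X" "v \<notin> ?e" by auto
            then have "v \<in> R m" using True X unfolding below_def by auto
            then have "\<exists>i<m. E i \<subseteq> X" using RB[of v X] \<open>v \<in> X\<close> False by auto
            then show ?thesis using X unfolding below_def by auto
          qed
        qed
        show "insert ?e (below m B) \<subseteq> below (Suc m) B" using eB unfolding below_def by (auto simp: less_Suc_eq)
      qed
      have dif: "below (Suc m) B - below m B = {?e}" using bel enb by auto
      have "good (\<subset>) (below (Suc m) B) (?S \<union> (\<Union>x\<in>below (Suc m) B - below m B. glue {{}} x {fl m B}))"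
      proof (rule B.good_insert_elements[OF _ _ IH maxS])
        show "finite (below (Suc m) B)" by simp
        show "below m B \<subseteq> below (Suc m) B" using bel by auto
        fix x assume "x \<in> below (Suc m) B - below m B"
        then have x: "x = ?e" using dif by auto
        show "good (\<subset>) {y\<in>below m B. y \<subset> x} {{}}" unfolding x low by (rule good_empty)
        have "{z\<in>below (Suc m) B. x \<subset> z} = {Z. ?e \<subset> Z \<and> Z \<subset> B}" unfolding x below_def by auto
        then show "good (\<subset>) {z\<in>below (Suc m) B. x \<subset> z} {fl m B}" using fl(2)[OF eB] by simp
        fix c assume "c \<in> glue {{}} x {fl m B}"
        then have "c = bchain m B" using eB unfolding glue_def x bchain_def by auto
        then show "max_chain (\<subset>) (below (Suc m) B) c" using bchain_max[of m "Suc m" B] Suc.prems(1) 3 by auto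
      qed
      moreover have "?S \<union> (\<Union>x\<in>below (Suc m) B - below m B. glue {{}} x {fl m B}) = (\<lambda>i. bchain i B) ` trapped (Suc m) B"
        unfolding dif tr using eB by (auto simp: glue_def bchain_def)
      ultimately show ?thesis by simp
    next
      case False
      have tr: "trapped (Suc m) B = trapped m B"
        using False unfolding trapped_def by (auto simp: less_Suc_eq)
      \<comment> \<open>Cutting an old set above \<open>E m\<close> down to \<open>a\<close> leaves
        it old: by \<open>meet_R\<close> its earlier edge contains a point of \<open>R m\<close>,
        and \<open>E m\<close> together with that point contains an earlier edge again.\<close>
      define a where "a = B \<inter> (?e \<union> R m)"
      have aB: "a \<subset> B" using False unfolding a_def by auto
      have inU: "z \<inter> a \<in> {z\<in>below m B. ?e \<subset> z}" if z: "?e \<subseteq> z" "z \<subseteq> B" "\<exists>i<m. E i \<subseteq> z" for z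
      proof -
        obtain i where i: "i < m" "E i \<subseteq> z" using z by auto
        obtain v where v: "v \<in> E i" "v \<in> R m" using meet_R[OF i(1) mq] by auto
        have vz: "v \<in> z \<inter> a" using v i z unfolding a_def by auto
        have ez: "?e \<subseteq> z \<inter> a" using z eB unfolding a_def by auto
        have "v \<notin> ?e" using v(2) unfolding R_def by auto
        then have "?e \<subset> z \<inter> a" using vz ez by auto
        moreover have "z \<inter> a \<subset> B" using aB by auto
        ultimately show ?thesis using RB[OF v(2) vz ez] unfolding below_def by auto
      qed
      let ?U = "{z\<in>below m B. ?e \<subset> z}"
      have colU: "collapses (order_complex (\<subset>) ?U) {}"
      proof (rule B.meet_contractible[where a = a and m = "\<lambda>z. z \<inter> a"])
        show "finite ?U" by simp
        show "a \<in> ?U" using inU[of B] 3 aB by (auto simp: Int_absorb1)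
        fix z assume z: "z \<in> ?U"
        have "z \<inter> a \<in> ?U" by (rule inU) (use z in \<open>auto simp: below_def\<close>)
        then show "z \<inter> a \<in> ?U \<and> (z \<inter> a = z \<or> z \<inter> a \<subset> z) \<and> (z \<inter> a = a \<or> z \<inter> a \<subset> a)" by auto
        fix y assume "y \<subset> z" "y = a \<or> y \<subset> a"
        then show "y = z \<inter> a \<or> y \<subset> z \<inter> a" by auto
      qed
      \<comment> \<open>The new sets enter in two stages. \<open>E m\<close> comes first, with a
        contractible upper part among the old sets; each further new set then has \<open>E m\<close>
        as the only element of \<open>?Y1\<close> below it.\<close>
      let ?Y1 = "insert ?e (below m B)"
      have Y1: "?Y1 \<subseteq> below (Suc m) B" using eB unfolding below_def by (auto simp: less_Suc_eq)
      have dif: "?Y1 - below m B = {?e}" using enb by auto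
      have maxS1: "max_chain (\<subset>) ?Y1 c" if "c \<in> ?S" for c
        using max_chain_subset[OF maxS[OF that] _ Y1] goodD(3)[OF IH that] by auto
      have "good (\<subset>) ?Y1 (?S \<union> (\<Union>x\<in>?Y1 - below m B. glue {{}} x {}))"
      proof (rule B.good_insert_elements[OF _ _ IH maxS1])
        fix x assume "x \<in> ?Y1 - below m B"
        then have x: "x = ?e" using dif by auto
        show "good (\<subset>) {y\<in>below m B. y \<subset> x} {{}}" unfolding x low by (rule good_empty)
        have "{z\<in>?Y1. x \<subset> z} = ?U" unfolding x by auto
        then show "good (\<subset>) {z\<in>?Y1. x \<subset> z} {}" using colU unfolding good_def by simp
        fix c assume "c \<in> glue {{}} x {}"
        then show "max_chain (\<subset>) ?Y1 c" unfolding glue_def by simp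
      qed auto
      then have good1: "good (\<subset>) ?Y1 ?S" by (simp add: glue_def)
      have "good (\<subset>) (below (Suc m) B) ?S"
      proof (rule B.good_superposet[OF _ Y1 good1 maxS])
        fix x assume x: "x \<in> below (Suc m) B - ?Y1"
        then have xn: "?e \<subset> x" "\<not> (\<exists>i<m. E i \<subseteq> x)" unfolding below_def by (auto simp: less_Suc_eq)
        have "{y\<in>?Y1. y \<subset> x} = {?e}"
        proof
          show "{y\<in>?Y1. y \<subset> x} \<subseteq> {?e}"
          proof
            fix y assume y: "y \<in> {y\<in>?Y1. y \<subset> x}"
            have "y \<notin> below m B"
            proof
              assume "y \<in> below m B"
              then obtain i where "i < m" "E i \<subseteq> y" unfolding below_def by auto
              then show False using xn(2) y by auto
            qed
            then show "y \<in> {?e}" using y by auto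
          qed
        qed (use xn in auto)
        then show "collapses (order_complex (\<subset>) {y\<in>?Y1. y \<subset> x}) {}"
          using chains_cone[of "{?e}" ?e "(\<subset>)"] by (simp add: comparable_def)
      qed auto
      then show ?thesis unfolding tr .
    qed
  qed
qed

end

section \<open>Sets meeting the blocks of a family\<close>

context edge_order
begin

text \<open>A family strictly finer than \<open>P\<close> on a smaller ground set lies below \<open>psi P X\<close>, where \<open>X\<close> is its union; this closure reduces such families to \<open>V P\<close>.\<close>
definition V :: "'n set set \<Rightarrow> 'n set set" where
  "V P = {X. X \<noteq> {} \<and> X \<subset> \<Union>P \<and> (\<forall>A\<in>P. X \<inter> A = {} \<or> X \<inter> A \<in> N)}"

definition psi :: "'n set set \<Rightarrow> 'n set \<Rightarrow> 'n set set" where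
  "psi P X = (\<lambda>A. X \<inter> A) ` P - {{}}"

text \<open>The graph of a choice of one trapping index per block. As a set of pairs it matches the
  shape of the decompositions in the theorem.\<close>

definition decs :: "'n set set \<Rightarrow> ('n set \<times> nat) set set" where
  "decs P = {D. fst ` D = P \<and> inj_on fst D \<and> (\<forall>p\<in>D. snd p \<in> trapped q (fst p))}"

text \<open>The unions of sets \<open>E i\<close>. The empty union is included, so that a set
  disjoint from a block needs no exception when the two are intersected.\<close>

definition uni :: "'n set set" where
  "uni = {X. \<forall>x\<in>X. \<exists>i<q. E i \<subseteq> X \<and> x \<in> E i}"

text \<open>A point of \<open>X\<close> outside \<open>E i\<close> lies in \<open>R i\<close>, so
  some earlier edge is contained in \<open>E i\<close> plus that point, and the antichain condition
  forces it to contain the point. This is why the chains removed from the enlarged poset already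
  belong to the lattice.\<close>

lemma trapped_uni:
  assumes "i \<in> trapped q B" "E i \<subseteq> X" "X \<subseteq> B"
  shows "X \<in> uni"
  unfolding uni_def
proof (intro CollectI ballI)
  fix x assume x: "x \<in> X"
  have iq: "i < q" using assms(1) unfolding trapped_def by auto
  show "\<exists>i<q. E i \<subseteq> X \<and> x \<in> E i"
  proof (cases "x \<in> E i")
    case True
    then show ?thesis using iq assms(2) by auto
  next
    case False
    then have "x \<in> R i" using assms x unfolding trapped_def by auto
    then obtain k where k: "k < i" "E k \<subseteq> insert x (E i)" using R_edge by metis
    have "x \<in> E k"
    proof (rule ccontr)
      assume "x \<notin> E k"
      then have "E k \<subseteq> E i" using k(2) by auto
      then show False using anti[of k i] k(1) iq by auto
    qed
    moreover have "E k \<subseteq> X" using k(2) x assms(2) by auto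
    moreover have "k < q" using k(1) iq by simp
    ultimately show ?thesis by blast
  qed
qed

lemma empty_uni: "{} \<in> uni"
  unfolding uni_def by auto

lemma psi_Union:
  assumes "X \<subseteq> \<Union>P"
  shows "\<Union>(psi P X) = X"
proof
  show "\<Union>(psi P X) \<subseteq> X" unfolding psi_def by auto
  show "X \<subseteq> \<Union>(psi P X)"
  proof
    fix x assume x: "x \<in> X"
    then obtain A where A: "A \<in> P" "x \<in> A" using assms by auto
    then have "X \<inter> A \<in> psi P X" using x unfolding psi_def by auto
    then show "x \<in> \<Union>(psi P X)" using x A by blast
  qed
qed

text \<open>The union of \<open>psi P X\<close> is \<open>X\<close> again, so cutting a set along
  the blocks of \<open>P\<close> loses nothing and embeds sets into families.\<close>

lemma psi_finer: "X \<subseteq> \<Union>P \<Longrightarrow> Y \<subseteq> \<Union>P \<Longrightarrow> finer (psi P X) (psi P Y) \<longleftrightarrow> X \<subseteq> Y"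
proof
  assume XY: "X \<subseteq> \<Union>P" "Y \<subseteq> \<Union>P" and f: "finer (psi P X) (psi P Y)"
  have "\<Union>(psi P X) \<subseteq> \<Union>(psi P Y)" using f unfolding finer_def by fast
  then show "X \<subseteq> Y" unfolding psi_Union[OF XY(1)] psi_Union[OF XY(2)] .
next
  assume XY: "X \<subseteq> Y"
  show "finer (psi P X) (psi P Y)" unfolding finer_def
  proof
    fix C assume "C \<in> psi P X"
    then obtain A where A: "A \<in> P" "C = X \<inter> A" "X \<inter> A \<noteq> {}" unfolding psi_def by auto
    then have "Y \<inter> A \<in> psi P Y" using XY unfolding psi_def by auto
    moreover have "C \<subseteq> Y \<inter> A" using A(2) XY by auto
    ultimately show "\<exists>Z\<in>psi P Y. C \<subseteq> Z" by (rule bexI[rotated])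
  qed
qed

lemma psi_rlt: "X \<subseteq> \<Union>P \<Longrightarrow> Y \<subseteq> \<Union>P \<Longrightarrow> rlt (psi P X) (psi P Y) \<longleftrightarrow> X \<subset> Y"
  unfolding rlt_def using psi_finer[of X P Y] psi_finer[of Y P X] by auto

lemma psi_fams:
  assumes P: "P \<in> fams" and X: "\<forall>A\<in>P. X \<inter> A = {} \<or> X \<inter> A \<in> N"
  shows "psi P X \<in> fams"
proof (rule famsI)
  show "C \<in> N" if "C \<in> psi P X" for C using that X unfolding psi_def by auto
  show "C = C'" if CC: "C \<in> psi P X" "C' \<in> psi P X" "x \<in> C" "x \<in> C'" for C C' x
  proof -
    obtain A A' where "A \<in> P" "A' \<in> P" "C = X \<inter> A" "C' = X \<inter> A'" using CC unfolding psi_def by auto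
    then show ?thesis using famsD(3)[OF P, of A A' x] CC by auto
  qed
qed

lemma psi_finer_P: "finer (psi P X) P"
  unfolding psi_def finer_def by auto

lemma psi_top:
  assumes "P \<in> fams"
  shows "psi P (\<Union>P) = P"
proof -
  have "\<Union>P \<inter> A = A" if "A \<in> P" for A using that by auto
  then have "(\<lambda>A. \<Union>P \<inter> A) ` P = P" by (auto simp: image_iff)
  then show ?thesis unfolding psi_def using famsD(2)[OF assms] by auto
qed

lemma psi_inj: "inj_on (psi P) {X. X \<subseteq> \<Union>P}"
  by (rule inj_on_inverseI[of _ "\<Union>"]) (auto simp: psi_Union)

lemma psi_V_interval:
  assumes P: "P \<in> fams" and X: "X \<in> V P"
  shows "psi P X \<in> fams" "rlt {} (psi P X)" "rlt (psi P X) P"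
proof -
  show f: "psi P X \<in> fams" using psi_fams[OF P] X unfolding V_def by auto
  have XP: "X \<subset> \<Union>P" "X \<noteq> {}" using X unfolding V_def by auto
  have "\<Union>(psi P X) = X" using psi_Union[of X P] XP by simp
  then have "psi P X \<noteq> {}" using XP(2) by (metis Union_empty)
  then show "rlt {} (psi P X)" using rlt_bot[OF f] by simp
  have "rlt (psi P X) (psi P (\<Union>P))" using psi_rlt[of X P "\<Union>P"] XP by simp
  then show "rlt (psi P X) P" unfolding psi_top[OF P] .
qed

lemma V_psi_emb:
  assumes "X \<in> V P" "Y \<in> V P"
  shows "comparable rlt (psi P X) (psi P Y) \<longleftrightarrow> comparable (\<subset>) X Y"
proof -
  have "X \<subseteq> \<Union>P" "Y \<subseteq> \<Union>P" using assms unfolding V_def by auto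
  then show ?thesis using psi_rlt[of X P Y] psi_rlt[of Y P X] inj_on_eq_iff[OF psi_inj, of X P Y]
    unfolding comparable_def by auto
qed

lemma V_psi_inj: "inj_on (psi P) (V P)"
  by (rule inj_on_subset[OF psi_inj]) (auto simp: V_def)

lemma V_max:
  assumes P: "P \<in> fams" and c: "c \<subseteq> V P" and sat: "R.sat fams {} (psi P ` c) P"
  shows "max_chain (\<subset>) (V P) c"
proof -
  have mc: "max_chain rlt {z\<in>fams. rlt {} z \<and> rlt z P} (psi P ` c)" using sat unfolding R.sat_def by simp
  have sub: "psi P ` V P \<subseteq> {z\<in>fams. rlt {} z \<and> rlt z P}" using psi_V_interval[OF P] by auto
  have "max_chain rlt (psi P ` V P) (psi P ` c)"
    by (rule max_chain_subset[OF mc image_mono[OF c] sub])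
  then show ?thesis using max_chain_image[OF V_psi_inj V_psi_emb c] by simp
qed

text \<open>The number of covering steps from \<open>{}\<close> to the family of blocks: a block
  \<open>A\<close> with index \<open>i\<close> takes one step to create \<open>E i\<close> and
  \<open>card A - card (E i)\<close> steps to grow.\<close>

definition dec_size :: "('n set \<times> nat) set \<Rightarrow> nat" where
  "dec_size D = (\<Sum>p\<in>D. card (fst p) - card (E (snd p)) + 1)"

text \<open>Saturation is required among all families, which is stronger than maximality in
  \<open>V P\<close>: it lets the chain be continued when a further block is added or the blocks are
  merged.\<close>

definition V_chains :: "'n set set \<Rightarrow> (('n set \<times> nat) set \<Rightarrow> 'n set set) \<Rightarrow> bool" where
  "V_chains P cV \<longleftrightarrow> inj_on cV (decs P) \<and> good (\<subset>) (V P) (cV ` decs P) \<and>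
    (\<forall>D\<in>decs P. cV D \<subseteq> V P \<and> R.sat fams {} (psi P ` cV D) P \<and> card (cV D) + 1 = dec_size D \<and>
      (\<forall>X\<in>cV D. \<forall>A\<in>P. X \<inter> A \<in> uni))"

lemma V_single:
  assumes "B \<in> N"
  shows "V {B} = below q B"
proof -
  have "V {B} = {X. X \<subset> B \<and> X \<in> N}"
    unfolding V_def
  proof (rule Collect_cong)
    fix X
    show "(X \<noteq> {} \<and> X \<subset> \<Union>{B} \<and> (\<forall>A\<in>{B}. X \<inter> A = {} \<or> X \<inter> A \<in> N)) \<longleftrightarrow> (X \<subset> B \<and> X \<in> N)"
      using N_nonempty[of X] by (cases "X \<subset> B") (auto simp: Int_absorb2 psubset_imp_subset)
  qed
  then show ?thesis unfolding below_def N_def by simp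
qed

lemma decs_single: "decs {B} = (\<lambda>i. {(B, i)}) ` trapped q B"
proof
  show "decs {B} \<subseteq> (\<lambda>i. {(B, i)}) ` trapped q B"
  proof
    fix D assume D: "D \<in> decs {B}"
    then have f: "fst ` D = {B}" "inj_on fst D" "\<forall>p\<in>D. snd p \<in> trapped q (fst p)" unfolding decs_def by auto
    obtain p where p: "p \<in> D" "fst p = B" using f(1) by (metis imageE singletonI)
    have same: "p' = p" if "p' \<in> D" for p'
    proof (rule inj_onD[OF f(2) _ that p(1)])
      have "fst p' \<in> {B}" unfolding f(1)[symmetric] using that by (rule imageI)
      then show "fst p' = fst p" using p(2) by simp
    qed
    have "D \<subseteq> {p}" using same by auto
    then have "D = {p}" using p(1) by auto
    then have "D = {(B, snd p)}" using p(2) by (cases p) auto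
    then show "D \<in> (\<lambda>i. {(B, i)}) ` trapped q B" using f(3) p by auto
  qed
qed (auto simp: decs_def)

lemma V_chains_single:
  assumes B: "B \<in> N"
  shows "V_chains {B} (\<lambda>D. bchain (snd (the_elem D)) B)"
  unfolding V_chains_def
proof (intro conjI ballI)
  let ?cV = "\<lambda>D. bchain (snd (the_elem D)) B"
  have q: "i < q" "E i \<subseteq> B" if "i \<in> trapped q B" for i using that unfolding trapped_def by auto
  show "inj_on ?cV (decs {B})"
    unfolding decs_single using bchain_inj[of B] by (auto simp: inj_on_def)
  have "?cV ` decs {B} = (\<lambda>i. bchain i B) ` trapped q B" unfolding decs_single by (simp add: image_image)
  moreover have "\<exists>i<q. E i \<subseteq> B" using B unfolding N_def by auto
  ultimately show "good (\<subset>) (V {B}) (?cV ` decs {B})" unfolding V_single[OF B] using below_good[of q B] by simp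
  fix D assume "D \<in> decs {B}"
  then obtain i where i: "i \<in> trapped q B" "D = {(B, i)}" unfolding decs_single by auto
  have cV: "?cV D = bchain i B" using i by simp
  have sub: "bchain i B \<subseteq> below q B" using bchain_above[OF q(2)[OF i(1)]] q[OF i(1)] unfolding below_def by auto
  show "?cV D \<subseteq> V {B}" unfolding cV V_single[OF B] by (rule sub)
  have "psi {B} X = {X}" if "X \<in> bchain i B" for X
  proof -
    have "X \<in> V {B}" using subsetD[OF sub that] V_single[OF B] by simp
    then have "X \<subseteq> B" "X \<noteq> {}" unfolding V_def by auto
    then show ?thesis unfolding psi_def by (auto simp: Int_absorb2)
  qed
  then have "psi {B} ` bchain i B = (\<lambda>Z. {Z}) ` bchain i B" by auto
  then show "R.sat fams {} (psi {B} ` ?cV D) {B}" unfolding cV using bchain_sat q[OF i(1)] by simp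
  show "card (?cV D) + 1 = dec_size D"
    unfolding cV using bchain_card[OF q(2)[OF i(1)]] i(2) by (simp add: dec_size_def)
  fix X A assume XA: "X \<in> ?cV D" "A \<in> {B}"
  then have "E i \<subseteq> X" "X \<subseteq> B" "A = B" using bchain_above[OF q(2)[OF i(1)], of X] unfolding cV by auto
  then show "X \<inter> A \<in> uni" using trapped_uni[OF i(1)] by (auto simp: Int_absorb2)
qed

lemma decs_finite: "D \<in> decs P \<Longrightarrow> finite D"
  unfolding decs_def using finite_imageD[of fst D] by simp

lemma decs_block: "D \<in> decs P \<Longrightarrow> A \<in> P \<Longrightarrow> A \<in> uni"
proof -
  assume D: "D \<in> decs P" and A: "A \<in> P"
  then obtain p where p: "p \<in> D" "fst p = A" unfolding decs_def by auto
  then have "snd p \<in> trapped q A" using D unfolding decs_def by auto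
  moreover then have "E (snd p) \<subseteq> A" unfolding trapped_def by auto
  ultimately show "A \<in> uni" using trapped_uni by blast
qed

lemma decs_insert_iff:
  assumes "B \<notin> P"
  shows "D \<in> decs P \<Longrightarrow> i \<in> trapped q B \<Longrightarrow> insert (B, i) D \<in> decs (insert B P)"
    "D \<in> decs P \<Longrightarrow> {p\<in>insert (B, i) D. fst p \<noteq> B} = D"
    "D \<in> decs P \<Longrightarrow> {p\<in>insert (B, i) D. fst p = B} = {(B, i)}"
    "D' \<in> decs (insert B P) \<Longrightarrow> \<exists>D i. D \<in> decs P \<and> i \<in> trapped q B \<and> D' = insert (B, i) D"
proof -
  have nB: "fst p \<noteq> B" if "D \<in> decs P" "p \<in> D" for D p
    using that assms unfolding decs_def by auto
  show "{p\<in>insert (B, i) D. fst p \<noteq> B} = D" if "D \<in> decs P" using nB[OF that] by auto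
  show "{p\<in>insert (B, i) D. fst p = B} = {(B, i)}" if "D \<in> decs P" using nB[OF that] by auto
  show "insert (B, i) D \<in> decs (insert B P)" if "D \<in> decs P" "i \<in> trapped q B"
    using that nB[OF that(1)] unfolding decs_def by (auto simp: inj_on_def)
  show "\<exists>D i. D \<in> decs P \<and> i \<in> trapped q B \<and> D' = insert (B, i) D" if D': "D' \<in> decs (insert B P)"
  proof -
    have f: "fst ` D' = insert B P" "inj_on fst D'" "\<forall>p\<in>D'. snd p \<in> trapped q (fst p)" using D' unfolding decs_def by auto
    obtain p where p: "p \<in> D'" "fst p = B" using f(1) by (metis imageE insertI1)
    let ?D = "D' - {p}"
    have "fst ` ?D = fst ` D' - {fst p}" using f(2) p(1) inj_on_image_set_diff[OF f(2), of D' "{p}"] by auto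
    then have "fst ` ?D = P" using f(1) p(2) assms by auto
    moreover have "inj_on fst ?D" using f(2) by (rule inj_on_subset) auto
    ultimately have "?D \<in> decs P" using f(3) unfolding decs_def by auto
    moreover have "snd p \<in> trapped q B" using f(3) p by auto
    moreover have "D' = insert (B, snd p) ?D" using p by (cases p) auto
    ultimately show ?thesis by blast
  qed
qed

text \<open>The union \<open>T\<close> of the old blocks is inserted last. Without it, the sets not
  containing \<open>T\<close> contract by joining with \<open>B\<close>, and a set
  \<open>T \<union> Z\<close> strictly above \<open>T\<close> has a part below it that contracts by
  joining with \<open>Z\<close>. Below \<open>T\<close> lies \<open>V P\<close> and above it a copy
  of \<open>below q B\<close>, so the choices for the old blocks and for \<open>B\<close>
  multiply.\<close>

lemma V_chains_insert:
  assumes P': "insert B P \<in> fams" "B \<notin> P" "P \<noteq> {}" and cV: "V_chains P cV"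
  shows "\<exists>cV'. V_chains (insert B P) cV'"
proof -
  define T where "T = \<Union>P"
  let ?P' = "insert B P"
  have P: "P \<in> fams" using famsD(1,3)[OF P'(1)] by (intro famsI) auto
  have B: "B \<in> N" "B \<noteq> {}" using famsD(1,2)[OF P'(1)] by auto
  have dA: "x \<notin> A" if "A \<in> P" "x \<in> B" for A x
    using famsD(3)[OF P'(1), of B A x] that P'(2) by auto
  have dT: "x \<notin> T" if "x \<in> B" for x using dA that unfolding T_def by auto
  have Tne: "T \<noteq> {}" using P'(3) famsD(2)[OF P] unfolding T_def by auto
  have AT: "A \<subseteq> T" if "A \<in> P" for A using that unfolding T_def by auto
  have UP': "\<Union>?P' = B \<union> T" unfolding T_def by auto
  have V': "X \<in> V ?P' \<longleftrightarrow> X \<noteq> {} \<and> X \<subset> B \<union> T \<and> (X \<inter> B = {} \<or> X \<inter> B \<in> N) \<and> (\<forall>A\<in>P. X \<inter> A = {} \<or> X \<inter> A \<in> N)" for X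
    unfolding V_def UP' by auto
  have VP: "X \<in> V P \<longleftrightarrow> X \<noteq> {} \<and> X \<subset> T \<and> (\<forall>A\<in>P. X \<inter> A = {} \<or> X \<inter> A \<in> N)" for X
    unfolding V_def T_def by auto
  have TA: "T \<inter> A = A" if "A \<in> P" for A using AT[OF that] by auto
  have TB: "T \<inter> B = {}" using dT by auto
  have TV: "T \<in> V ?P'" unfolding V' using Tne TB TA famsD(1)[OF P] B(2) by auto
  let ?Y = "V ?P' - {T}"
  let ?Low = "{X\<in>V ?P'. \<not> T \<subseteq> X}"
  have add: "(X \<union> Z) \<inter> A = X \<inter> A" if "Z \<subseteq> B" "A \<in> P" for X Z A
    using dA[OF that(2)] that(1) by auto
  have nT: "\<not> T \<subseteq> X \<union> Z" if "\<not> T \<subseteq> X" "Z \<subseteq> B" for X Z using that dT by auto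
  have BY0: "Z \<in> ?Low" if Z: "Z \<in> N" "Z \<subseteq> B" for Z
  proof -
    have "Z \<inter> A = {}" if "A \<in> P" for A using dA[OF that] Z by auto
    moreover have "\<not> T \<subseteq> Z" using nT[of "{}" Z] Tne Z by auto
    ultimately show ?thesis using Z N_nonempty[OF Z(1)] unfolding V' by (auto simp: Int_absorb2)
  qed
  have joinY0: "X \<union> Z \<in> ?Low" if X: "X \<in> ?Low" and Z: "Z \<in> N" "Z \<subseteq> B" "X \<inter> B \<subseteq> Z" for X Z
  proof -
    have 1: "\<not> T \<subseteq> X \<union> Z" using nT X Z by auto
    have "(X \<union> Z) \<inter> B = Z" using Z by auto
    then show ?thesis using 1 X Z add[OF Z(2), of _ X] unfolding V' by auto
  qed
  have colY0: "collapses (order_complex (\<subset>) ?Low) {}"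
  proof (rule join_contractible[OF B.strict_poset_axioms, where a = B and m = "\<lambda>X. X \<union> B"])
    show "finite ?Low" by simp
    show "B \<in> ?Low" using BY0 B by auto
    fix X assume X: "X \<in> ?Low"
    have "X \<union> B \<in> ?Low" using joinY0[OF X B(1)] by auto
    then show "X \<union> B \<in> ?Low \<and> (X \<union> B = X \<or> X \<subset> X \<union> B) \<and> (X \<union> B = B \<or> B \<subset> X \<union> B)" by auto
    fix Y assume "X \<subset> Y" "Y = B \<or> B \<subset> Y"
    then show "Y = X \<union> B \<or> X \<union> B \<subset> Y" by auto
  qed
  have goodY: "good (\<subset>) ?Y {}"
  proof (rule B.good_superposet)
    show "finite ?Y" by simp
    show "?Low \<subseteq> ?Y" by auto
    show "good (\<subset>) ?Low {}" using colY0 unfolding good_def by auto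
    fix x assume x: "x \<in> ?Y - ?Low"
    then have xV: "x \<in> V ?P'" and Tx: "T \<subset> x" by auto
    define Z where "Z = x \<inter> B"
    have xe: "x = T \<union> Z" using xV Tx unfolding V' Z_def by auto
    have "Z \<noteq> {}" using xe Tx by auto
    then have Z: "Z \<in> N" "Z \<subseteq> B" using xV unfolding V' Z_def by auto
    have Zx: "Z \<subset> x" using xe dT Z(2) Tne by auto
    show "collapses (order_complex (\<subset>) {y\<in>?Low. y \<subset> x}) {}"
    proof (rule join_contractible[OF B.strict_poset_axioms, where a = Z and m = "\<lambda>y. y \<union> Z"])
      show "finite {y\<in>?Low. y \<subset> x}" by simp
      show "Z \<in> {y\<in>?Low. y \<subset> x}" using BY0[OF Z] Zx by auto
      fix y assume y: "y \<in> {y\<in>?Low. y \<subset> x}"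
      then have y0: "y \<in> ?Low" and yx: "y \<subset> x" by auto
      have yZ: "y \<union> Z \<in> ?Low" by (rule joinY0[OF y0 Z]) (use yx Z_def in auto)
      moreover have "y \<union> Z \<subset> x" using yZ yx Zx Tx by auto
      ultimately show "y \<union> Z \<in> {y\<in>?Low. y \<subset> x} \<and> (y \<union> Z = y \<or> y \<subset> y \<union> Z) \<and> (y \<union> Z = Z \<or> Z \<subset> y \<union> Z)" by auto
      fix w assume "y \<subset> w" "w = Z \<or> Z \<subset> w"
      then show "w = y \<union> Z \<or> y \<union> Z \<subset> w" by auto
    qed
  qed auto
  \<comment> \<open>The chain climbs through \<open>V P\<close> up to \<open>T\<close> and then adds
    to \<open>T\<close> the chain of sets inside \<open>B\<close>. The pair with first component
    \<open>B\<close> is split off in order to read its index.\<close>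
  define cV' where "cV' = (\<lambda>D'. cV {p\<in>D'. fst p \<noteq> B} \<union>
     insert T ((\<union>) T ` bchain (snd (the_elem {p\<in>D'. fst p = B})) B))"
  have cV'_eq: "cV' (insert (B, i) D) = cV D \<union> insert T ((\<union>) T ` bchain i B)" if "D \<in> decs P" for D i
    unfolding cV'_def decs_insert_iff(2,3)[OF P'(2) that] by simp
  note dec = decs_insert_iff[OF P'(2)]
  have cVD: "cV D \<subseteq> V P" "R.sat fams {} (psi P ` cV D) P" "card (cV D) + 1 = dec_size D"
    "\<And>X A. X \<in> cV D \<Longrightarrow> A \<in> P \<Longrightarrow> X \<inter> A \<in> uni" if "D \<in> decs P" for D
    using cV that unfolding V_chains_def by auto
  have cVinj: "inj_on cV (decs P)" and cVgood: "good (\<subset>) (V P) (cV ` decs P)"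
    using cV unfolding V_chains_def by simp_all
  have cVT: "X \<subset> T" if "D \<in> decs P" "X \<in> cV D" for D X
  proof -
    have "X \<in> V P" using cVD(1)[OF that(1)] that(2) by (rule subsetD)
    then show ?thesis unfolding VP by simp
  qed
  have bch: "Z \<subset> B" "Z \<noteq> {}" "E i \<subseteq> Z" "Z \<in> N" if "i \<in> trapped q B" "Z \<in> bchain i B" for i Z
  proof -
    have i: "i < q" "E i \<subseteq> B" using that(1) unfolding trapped_def by auto
    show 1: "Z \<subset> B" "E i \<subseteq> Z" using bchain_above[OF i(2) that(2)] by auto
    show "Z \<in> N" using i(1) 1(2) unfolding N_def by auto
    then show "Z \<noteq> {}" by (rule N_nonempty)
  qed
  have up_img: "{z\<in>V ?P'. T \<subset> z} = (\<union>) T ` below q B"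
  proof
    show "{z\<in>V ?P'. T \<subset> z} \<subseteq> (\<union>) T ` below q B"
    proof
      fix z assume z: "z \<in> {z\<in>V ?P'. T \<subset> z}"
      have ze: "z = T \<union> (z \<inter> B)" using z unfolding V' by auto
      then have "z \<inter> B \<noteq> {}" using z by auto
      then have "z \<inter> B \<in> N" using z unfolding V' by auto
      moreover have "z \<inter> B \<subset> B" using z ze unfolding V' by auto
      ultimately have "z \<inter> B \<in> below q B" unfolding below_def N_def by auto
      then show "z \<in> (\<union>) T ` below q B" using ze by blast
    qed
    show "(\<union>) T ` below q B \<subseteq> {z\<in>V ?P'. T \<subset> z}"
    proof
      fix z assume "z \<in> (\<union>) T ` below q B"
      then obtain Z where Z: "z = T \<union> Z" "Z \<subset> B" "Z \<in> N" unfolding below_def N_def by auto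
      have "z \<inter> B = Z" using Z dT by auto
      moreover have "z \<inter> A = A" if "A \<in> P" for A using add[of Z A T] TA[OF that] Z that by auto
      moreover have "T \<subset> z" using Z N_nonempty[OF Z(3)] dT by auto
      moreover have "z \<subset> B \<union> T" using Z dT by auto
      ultimately show "z \<in> {z\<in>V ?P'. T \<subset> z}" unfolding V' using Z Tne famsD(1)[OF P] by auto
    qed
  qed
  have T_inj: "inj_on ((\<union>) T) (Pow B)"
    by (rule inj_on_inverseI[of _ "\<lambda>z. z \<inter> B"]) (use dT in auto)
  have belB: "below q B \<subseteq> Pow B" unfolding below_def by auto
  have T_le: "T \<union> Z \<subseteq> T \<union> Z' \<longleftrightarrow> Z \<subseteq> Z'" if "Z \<subseteq> B" for Z Z'
    using that dT by auto
  have T_lt: "T \<union> Z \<subset> T \<union> Z' \<longleftrightarrow> Z \<subset> Z'" if "Z \<subseteq> B" "Z' \<subseteq> B" for Z Z'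
    using T_le[OF that(1), of Z'] T_le[OF that(2), of Z] by (simp add: less_le_not_le)
  have T_emb: "comparable (\<subset>) (T \<union> Z) (T \<union> Z') \<longleftrightarrow> comparable (\<subset>) Z Z'" if "Z \<in> below q B" "Z' \<in> below q B" for Z Z'
  proof -
    have "Z \<subseteq> B" "Z' \<subseteq> B" using that belB by auto
    then have "T \<union> Z \<subset> T \<union> Z' \<longleftrightarrow> Z \<subset> Z'" "T \<union> Z' \<subset> T \<union> Z \<longleftrightarrow> Z' \<subset> Z" "T \<union> Z = T \<union> Z' \<longleftrightarrow> Z = Z'"
      using T_lt T_le[of Z Z'] T_le[of Z' Z] by (simp_all add: set_eq_subset)
    then show ?thesis unfolding comparable_def by simp
  qed
  have exB: "\<exists>i<q. E i \<subseteq> B" using B unfolding N_def by auto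
  have good_up: "good (\<subset>) {z\<in>V ?P'. T \<subset> z} ((`) ((\<union>) T) ` (\<lambda>i. bchain i B) ` trapped q B)"
    unfolding up_img by (rule good_image[OF inj_on_subset[OF T_inj belB] T_emb below_good[OF order_refl exB]])
  have low_eq: "{y\<in>?Y. y \<subset> T} = V P"
  proof (rule set_eqI)
    fix y
    show "y \<in> {y\<in>?Y. y \<subset> T} \<longleftrightarrow> y \<in> V P"
    proof (cases "y \<subset> T")
      case True
      then have "y \<inter> B = {}" "y \<subset> B \<union> T" "y \<noteq> T" using dT by auto
      moreover have "\<not> T \<subseteq> y" using True by auto
      ultimately show ?thesis using True by (simp add: V' VP)
    next
      case False
      then show ?thesis by (simp add: VP)
    qed
  qed
  have psiT: "psi ?P' X = psi P X" if "X \<subseteq> T" for X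
  proof -
    have "X \<inter> B = {}" using that dT by auto
    then show ?thesis unfolding psi_def by simp
  qed
  have psiTZ: "psi ?P' (T \<union> Z) = P \<union> {Z}" if Z: "Z \<subseteq> B" "Z \<noteq> {}" for Z
  proof -
    have "(\<lambda>A. (T \<union> Z) \<inter> A) ` P = (\<lambda>A. A) ` P"
      by (rule image_cong) (simp_all only: add[OF Z(1)] TA)
    moreover have "(T \<union> Z) \<inter> B = Z" using Z(1) dT by auto
    moreover have "{} \<notin> P" using famsD(2)[OF P] by auto
    ultimately show ?thesis unfolding psi_def using Z(2) by simp
  qed
  have subV: "cV' (insert (B, i) D) \<subseteq> V ?P'" if D: "D \<in> decs P" and i: "i \<in> trapped q B" for D i
  proof -
    have 1: "cV D \<subseteq> V ?P'" using cVD(1)[OF D] low_eq by auto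
    have "bchain i B \<subseteq> below q B" using bch[OF i] unfolding below_def N_def by auto
    then have 2: "(\<union>) T ` bchain i B \<subseteq> V ?P'" using up_img by auto
    show ?thesis unfolding cV'_eq[OF D] using 1 2 TV by auto
  qed
  have sat': "R.sat fams {} (psi ?P' ` cV' (insert (B, i) D)) ?P'" if D: "D \<in> decs P" and i: "i \<in> trapped q B" for D i
  proof -
    have iq: "i < q" "E i \<subseteq> B" using i unfolding trapped_def by auto
    have "psi ?P' ` cV D = psi P ` cV D"
      by (rule image_cong) (simp_all add: psiT psubset_imp_subset[OF cVT[OF D]])
    moreover have "psi ?P' T = P" using psiT[of T] psi_top[OF P] unfolding T_def by simp
    moreover have "psi ?P' ` (\<union>) T ` bchain i B = (\<union>) P ` (\<lambda>Z. {Z}) ` bchain i B"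
      unfolding image_image by (rule image_cong) (simp_all add: psiTZ psubset_imp_subset[OF bch(1)[OF i]] bch(2)[OF i])
    ultimately have eq: "psi ?P' ` cV' (insert (B, i) D) = psi P ` cV D \<union> insert P ((\<union>) P ` (\<lambda>Z. {Z}) ` bchain i B)"
      unfolding cV'_eq[OF D] by (simp add: image_Un)
    have "B \<inter> \<Union>P = {}" using TB unfolding T_def by (simp add: Int_commute)
    from R.sat_compose[OF cVD(2)[OF D] sat_extend[OF P B(1) this bchain_sat[OF iq]] P]
    show ?thesis unfolding eq .
  qed
  have up_T: "(\<union>) T ` bchain i B \<subseteq> {z. T \<subset> z}" if i: "i \<in> trapped q B" for i
  proof
    fix z assume "z \<in> (\<union>) T ` bchain i B"
    then obtain Z where Z: "Z \<in> bchain i B" "z = T \<union> Z" by auto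
    obtain x where "x \<in> Z" "x \<in> B" using bch(1,2)[OF i Z(1)] by auto
    then show "z \<in> {z. T \<subset> z}" using Z(2) dT by auto
  qed
  have "V_chains ?P' cV'"
    unfolding V_chains_def
  proof (intro conjI)
    show "inj_on cV' (decs ?P')"
    proof (rule inj_onI)
      fix D1' D2' assume D': "D1' \<in> decs ?P'" "D2' \<in> decs ?P'" and eq: "cV' D1' = cV' D2'"
      obtain D1 i1 where 1: "D1 \<in> decs P" "i1 \<in> trapped q B" "D1' = insert (B, i1) D1" using dec(4)[OF D'(1)] by auto
      obtain D2 i2 where 2: "D2 \<in> decs P" "i2 \<in> trapped q B" "D2' = insert (B, i2) D2" using dec(4)[OF D'(2)] by auto
      have up: "(\<union>) T ` bchain i B \<subseteq> {z. T \<subset> z}" if "i \<in> trapped q B" for i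
        using up_T[OF that] .
      have low: "cV D \<subseteq> {y\<in>V P. y \<subset> T}" if "D \<in> decs P" for D
        using subsetD[OF cVD(1)[OF that]] cVT[OF that] by auto
      have TnV: "T \<notin> V P" unfolding VP by auto
      have "cV D1 = cV D2 \<and> (\<union>) T ` bchain i1 B = (\<union>) T ` bchain i2 B"
        using B.glue_inj[OF _ TnV TnV low[OF 1(1)] low[OF 2(1)] up[OF 1(2)] up[OF 2(2)]] eq
        unfolding 1(3) 2(3) cV'_eq[OF 1(1)] cV'_eq[OF 2(1)] by simp
      moreover then have "bchain i1 B = bchain i2 B"
        using inj_on_image_eq_iff[OF T_inj, of "bchain i1 B" "bchain i2 B"] bch(1)[OF 1(2)] bch(1)[OF 2(2)] by auto
      ultimately have "D1 = D2" "i1 = i2"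
        using inj_onD[OF bchain_inj[of B], of i1 i2] inj_onD[OF cVinj, of D1 D2] 1(1,2) 2(1,2) by simp_all
      then show "D1' = D2'" using 1 2 by simp
    qed
    let ?A = "cV ` decs P" and ?Tt = "(`) ((\<union>) T) ` (\<lambda>i. bchain i B) ` trapped q B"
    have glue_eq: "glue ?A T ?Tt = cV' ` decs ?P'"
    proof
      show "glue ?A T ?Tt \<subseteq> cV' ` decs ?P'"
      proof
        fix c assume "c \<in> glue ?A T ?Tt"
        then obtain D i where Di: "D \<in> decs P" "i \<in> trapped q B" "c = cV D \<union> insert T ((\<union>) T ` bchain i B)"
          unfolding glue_def by auto
        then have "c = cV' (insert (B, i) D)" using cV'_eq by simp
        then show "c \<in> cV' ` decs ?P'" using dec(1)[OF Di(1,2)] by auto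
      qed
      show "cV' ` decs ?P' \<subseteq> glue ?A T ?Tt"
      proof
        fix c assume "c \<in> cV' ` decs ?P'"
        then obtain D' where D': "D' \<in> decs ?P'" "c = cV' D'" by auto
        obtain D i where Di: "D \<in> decs P" "i \<in> trapped q B" "D' = insert (B, i) D" using dec(4)[OF D'(1)] by auto
        then have "c = cV D \<union> insert T ((\<union>) T ` bchain i B)" using cV'_eq D'(2) by simp
        then show "c \<in> glue ?A T ?Tt" using Di(1,2) unfolding glue_def by blast
      qed
    qed
    have max': "max_chain (\<subset>) (V ?P') c" if c: "c \<in> cV' ` decs ?P'" for c
    proof -
      obtain D' where D': "D' \<in> decs ?P'" "c = cV' D'" using c by auto
      obtain D i where Di: "D \<in> decs P" "i \<in> trapped q B" "D' = insert (B, i) D" using dec(4)[OF D'(1)] by auto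
      show ?thesis unfolding D'(2) Di(3) by (rule V_max[OF P'(1) subV[OF Di(1,2)] sat'[OF Di(1,2)]])
    qed
    have dif: "V ?P' - ?Y = {T}" using TV by (simp add: Diff_Diff_Int)
    have "good (\<subset>) (V ?P') ({} \<union> (\<Union>x\<in>V ?P' - ?Y. glue ?A x ?Tt))"
    proof (rule B.good_insert_elements[OF _ _ goodY])
      fix x assume "x \<in> V ?P' - ?Y"
      then have x: "x = T" using dif by auto
      show "good (\<subset>) {y\<in>?Y. y \<subset> x} ?A" unfolding x low_eq by (rule cVgood)
      show "good (\<subset>) {z\<in>V ?P'. x \<subset> z} ?Tt" unfolding x by (rule good_up)
      fix c assume "c \<in> glue ?A x ?Tt"
      then show "max_chain (\<subset>) (V ?P') c" unfolding x glue_eq by (rule max')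
    qed auto
    then show "good (\<subset>) (V ?P') (cV' ` decs ?P')" unfolding dif by (simp add: glue_eq)
    show "\<forall>D\<in>decs ?P'. cV' D \<subseteq> V ?P' \<and> R.sat fams {} (psi ?P' ` cV' D) ?P' \<and> card (cV' D) + 1 = dec_size D \<and>
      (\<forall>X\<in>cV' D. \<forall>A\<in>?P'. X \<inter> A \<in> uni)"
    proof
      fix D' assume D': "D' \<in> decs ?P'"
      obtain D i where Di: "D \<in> decs P" "i \<in> trapped q B" "D' = insert (B, i) D" using dec(4)[OF D'] by auto
      have iB: "E i \<subseteq> B" using Di(2) unfolding trapped_def by auto
      have d2: "T \<notin> (\<union>) T ` bchain i B" using up_T[OF Di(2)] by auto
      have d1: "cV D \<inter> insert T ((\<union>) T ` bchain i B) = {}" using cVT[OF Di(1)] up_T[OF Di(2)] by auto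
      have "card ((\<union>) T ` bchain i B) = card (bchain i B)"
        using bch(1)[OF Di(2)] by (intro card_image inj_on_subset[OF T_inj]) auto
      then have "card (cV' D') = card (cV D) + (1 + card (bchain i B))"
        unfolding Di(3) cV'_eq[OF Di(1)] using d1 d2 by (simp add: card_Un_disjoint)
      moreover have "(B, i) \<notin> D"
      proof
        assume "(B, i) \<in> D"
        then have "B \<in> fst ` D" by (metis fst_conv imageI)
        then show False using Di(1) P'(2) unfolding decs_def by simp
      qed
      then have "dec_size D' = (card B - card (E i) + 1) + dec_size D"
        unfolding dec_size_def Di(3) by (subst sum.insert[OF decs_finite[OF Di(1)]]) simp_all
      ultimately have "card (cV' D') + 1 = dec_size D'" using cVD(3)[OF Di(1)] bchain_card[OF iB] by simp
      moreover have "X \<inter> A \<in> uni" if X: "X \<in> cV' D'" and A: "A \<in> ?P'" for X A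
      proof -
        consider "X \<in> cV D" | "X = T" | Z where "Z \<in> bchain i B" "X = T \<union> Z"
          using X unfolding Di(3) cV'_eq[OF Di(1)] by auto
        then show ?thesis
        proof cases
          case 1
          then have "X \<subseteq> T" using cVT[OF Di(1)] by auto
          then have "X \<inter> B = {}" using dT by auto
          then show ?thesis using 1 A cVD(4)[OF Di(1)] empty_uni by auto
        next
          case 2
          show ?thesis
          proof (cases "A = B")
            case True
            then show ?thesis using 2 TB empty_uni by simp
          next
            case False
            then have AP: "A \<in> P" using A by auto
            show ?thesis using 2 TA[OF AP] decs_block[OF Di(1) AP] by simp
          qed
        next
          case 3
          note b = bch[OF Di(2) 3(1)]
          show ?thesis
          proof (cases "A = B")
            case True
            have "X \<inter> A = Z" using True 3(2) dT b(1) by auto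
            then show ?thesis using trapped_uni[OF Di(2) b(3)] b(1) by auto
          next
            case False
            then have AP: "A \<in> P" using A by auto
            then have "X \<inter> A = A" using add[of Z A T] TA 3(2) b by auto
            then show ?thesis using decs_block[OF Di(1) AP] by simp
          qed
        qed
      qed
      ultimately show "cV' D' \<subseteq> V ?P' \<and> R.sat fams {} (psi ?P' ` cV' D') ?P' \<and> card (cV' D') + 1 = dec_size D' \<and>
        (\<forall>X\<in>cV' D'. \<forall>A\<in>?P'. X \<inter> A \<in> uni)"
        using subV[OF Di(1,2)] sat'[OF Di(1,2)] unfolding Di(3) by simp
    qed
  qed
  then show ?thesis by blast
qed

lemma V_chains_exists:
  assumes "P \<in> fams" "P \<noteq> {}"
  shows "\<exists>cV. V_chains P cV"
proof -
  have "finite P" by simp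
  then show ?thesis using assms(2,1)
  proof (induction rule: finite_ne_induct)
    case (singleton B)
    then show ?case using V_chains_single singleton_fams by blast
  next
    case (insert B P)
    have "P \<in> fams" using famsD(1,3)[OF insert.prems] by (intro famsI) auto
    then obtain cV where "V_chains P cV" using insert.IH by auto
    then show ?case using V_chains_insert insert by blast
  qed
qed

end

section \<open>Coarsenings of a family\<close>

context upset_family
begin

text \<open>The proper part of the partition lattice on the blocks of \<open>P\<close>: each member
  arises by merging blocks.\<close>

definition Pi :: "'n set set \<Rightarrow> 'n set set set" where
  "Pi P = {Q\<in>fams. rlt P Q \<and> rlt Q {\<Union>P}}"

lemma finer_Union: "finer P Q \<Longrightarrow> \<Union>P \<subseteq> \<Union>Q"
  unfolding finer_def by fast

lemma Union_N:
  assumes "P \<in> fams" "P \<noteq> {}"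
  shows "\<Union>P \<in> N"
proof -
  obtain A where "A \<in> P" using assms(2) by auto
  then show ?thesis using up[OF famsD(1)[OF assms(1)], of A "\<Union>P"] by auto
qed

lemma PiD:
  assumes P: "P \<in> fams" "P \<noteq> {}" and Q: "Q \<in> Pi P"
  shows "Q \<in> fams" "finer P Q" "P \<noteq> Q" "\<Union>Q = \<Union>P" "Q \<noteq> {\<Union>P}"
proof -
  have PN: "{\<Union>P} \<in> fams" using Union_N[OF P] singleton_fams by simp
  show Qf: "Q \<in> fams" using Q unfolding Pi_def by simp
  have *: "finer P Q \<and> P \<noteq> Q" "finer Q {\<Union>P} \<and> Q \<noteq> {\<Union>P}"
    using Q rlt_iff[OF P(1) Qf] rlt_iff[OF Qf PN] unfolding Pi_def by simp_all
  then show "finer P Q" "P \<noteq> Q" "Q \<noteq> {\<Union>P}" by simp_all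
  show "\<Union>Q = \<Union>P" using finer_Union[of P Q] * finer_top[of Q "\<Union>P"] by (simp add: subset_antisym)
qed

lemma PiI:
  assumes P: "P \<in> fams" "P \<noteq> {}" and Q: "Q \<in> fams" "finer P Q" "P \<noteq> Q" "\<Union>Q = \<Union>P" "Q \<noteq> {\<Union>P}"
  shows "Q \<in> Pi P"
proof -
  have PN: "{\<Union>P} \<in> fams" using Union_N[OF P] singleton_fams by simp
  show ?thesis using rlt_iff[OF P(1) Q(1)] rlt_iff[OF Q(1) PN] Q finer_top[of Q "\<Union>P"] unfolding Pi_def by simp
qed

lemma block_contains:
  assumes Q: "Q \<in> fams" "finer P Q" "\<Union>Q = \<Union>P" and C: "C \<in> Q" "x \<in> C"
  shows "\<exists>A\<in>P. x \<in> A \<and> A \<subseteq> C"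
proof -
  have "x \<in> \<Union>P" unfolding Q(3)[symmetric] using C by auto
  then obtain A where A: "A \<in> P" "x \<in> A" by auto
  obtain C' where C': "C' \<in> Q" "A \<subseteq> C'" using finerE[OF Q(2) A(1)] by metis
  have "C' = C" using famsD(3)[OF Q(1) C'(1) C(1), of x] C' A C by auto
  then show ?thesis using A C' by auto
qed

text \<open>For \<open>Q\<close> coarser than \<open>P\<close> with the same union, this is the meet
  of \<open>Q\<close> with the two-block family \<open>{a, \<Union>(P - {a})}\<close>.\<close>

definition separate :: "'n set \<Rightarrow> 'n set set \<Rightarrow> 'n set set" where
  "separate a Q = insert a ((\<lambda>C. C - a) ` Q - {{}})"

lemma separate:
  assumes P: "P \<in> fams" "a \<in> P" and Q: "Q \<in> fams" "finer P Q" "\<Union>Q = \<Union>P"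
  shows "separate a Q \<in> fams" "finer P (separate a Q)" "finer (separate a Q) Q"
    "finer (separate a Q) {a, \<Union>(P - {a})}" "\<Union>(separate a Q) = \<Union>P"
    "\<And>Z. Z \<in> fams \<Longrightarrow> finer Z Q \<Longrightarrow> finer Z {a, \<Union>(P - {a})} \<Longrightarrow> finer Z (separate a Q)"
proof -
  have dis: "A \<inter> a = {}" if "A \<in> P" "A \<noteq> a" for A
    using famsD(3)[OF P(1) that(1) P(2)] that(2) by auto
  have mem: "X = a \<or> (\<exists>C\<in>Q. X = C - a \<and> X \<noteq> {})" if "X \<in> separate a Q" for X
    using that unfolding separate_def by auto
  have memI: "C - a \<in> separate a Q" if "C \<in> Q" "x \<in> C" "x \<notin> a" for C x
    using that unfolding separate_def by auto
  show "separate a Q \<in> fams"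
  proof (rule famsI)
    show "X \<in> N" if X: "X \<in> separate a Q" for X
    proof (cases "X = a")
      case True
      then show ?thesis using famsD(1)[OF P] by simp
    next
      case False
      then obtain C where C: "C \<in> Q" "X = C - a" "X \<noteq> {}" using mem[OF X] by auto
      then obtain x where x: "x \<in> C" "x \<notin> a" by auto
      obtain A where A: "A \<in> P" "x \<in> A" "A \<subseteq> C" using block_contains[OF Q C(1) x(1)] by auto
      have "A \<noteq> a" using A(2) x(2) by auto
      then have "A \<subseteq> X" using dis[OF A(1)] A(3) C(2) by auto
      then show ?thesis using up[OF famsD(1)[OF P(1) A(1)]] by simp
    qed
    show "X = Y" if XY: "X \<in> separate a Q" "Y \<in> separate a Q" "x \<in> X" "x \<in> Y" for X Y x
    proof (cases "x \<in> a")
      case True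
      then show ?thesis using mem[OF XY(1)] mem[OF XY(2)] XY(3,4) by auto
    next
      case False
      then obtain C C' where C: "C \<in> Q" "X = C - a" "C' \<in> Q" "Y = C' - a"
        using mem[OF XY(1)] mem[OF XY(2)] XY(3,4) by auto
      then show ?thesis using famsD(3)[OF Q(1), of C C' x] XY(3,4) by auto
    qed
  qed
  show "finer P (separate a Q)" unfolding finer_def
  proof
    fix A assume A: "A \<in> P"
    show "\<exists>Y\<in>separate a Q. A \<subseteq> Y"
    proof (cases "A = a")
      case True
      then show ?thesis unfolding separate_def by auto
    next
      case False
      obtain C where C: "C \<in> Q" "A \<subseteq> C" using finerE[OF Q(2) A] by metis
      obtain x where x: "x \<in> A" using famsD(2)[OF P(1) A] by auto
      have d: "A \<inter> a = {}" by (rule dis[OF A False])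
      then have "x \<notin> a" using x by auto
      then have "C - a \<in> separate a Q" using memI[OF C(1), of x] x C(2) by auto
      moreover have "A \<subseteq> C - a" using C(2) d by auto
      ultimately show ?thesis by auto
    qed
  qed
  show sQ: "finer (separate a Q) Q" unfolding finer_def
  proof
    fix X assume X: "X \<in> separate a Q"
    show "\<exists>Y\<in>Q. X \<subseteq> Y"
    proof (cases "X = a")
      case True
      then show ?thesis using finerE[OF Q(2) P(2)] by metis
    next
      case False
      then show ?thesis using mem[OF X] by auto
    qed
  qed
  show "finer (separate a Q) {a, \<Union>(P - {a})}" unfolding finer_def
  proof
    fix X assume X: "X \<in> separate a Q"
    show "\<exists>Y\<in>{a, \<Union>(P - {a})}. X \<subseteq> Y"
    proof (cases "X = a")
      case True
      then show ?thesis by auto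
    next
      case False
      then obtain C where C: "C \<in> Q" "X = C - a" using mem[OF X] by auto
      have "X \<subseteq> \<Union>(P - {a})"
      proof
        fix x assume x: "x \<in> X"
        then have "x \<in> \<Union>P" "x \<notin> a" unfolding Q(3)[symmetric] using C by auto
        then show "x \<in> \<Union>(P - {a})" by auto
      qed
      then show ?thesis by auto
    qed
  qed
  show "\<Union>(separate a Q) = \<Union>P"
  proof
    show "\<Union>(separate a Q) \<subseteq> \<Union>P" using finer_Union[OF sQ] Q(3) by simp
    show "\<Union>P \<subseteq> \<Union>(separate a Q)"
      by (rule finer_Union) fact
  qed
  fix Z assume Z: "Z \<in> fams" "finer Z Q" "finer Z {a, \<Union>(P - {a})}"
  show "finer Z (separate a Q)" unfolding finer_def
  proof
    fix X assume X: "X \<in> Z"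
    obtain C where C: "C \<in> Q" "X \<subseteq> C" using finerE[OF Z(2) X] by metis
    obtain Y where Y: "Y \<in> {a, \<Union>(P - {a})}" "X \<subseteq> Y" using finerE[OF Z(3) X] by metis
    show "\<exists>Y\<in>separate a Q. X \<subseteq> Y"
    proof (cases "Y = a")
      case True
      then show ?thesis using Y unfolding separate_def by auto
    next
      case False
      then have "X \<subseteq> \<Union>(P - {a})" using Y by auto
      then have na: "x \<notin> a" if "x \<in> X" for x using dis that by auto
      obtain x where x: "x \<in> X" using famsD(2)[OF Z(1) X] by auto
      have "C - a \<in> separate a Q" using memI[OF C(1), of x] x C(2) na by auto
      moreover have "X \<subseteq> C - a" using C(2) na by auto
      ultimately show ?thesis by auto
    qed
  qed
qed

text \<open>Splitting off \<open>a\<close> changes only the block of \<open>Q\<close> that contains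
  \<open>a\<close>. If the result is \<open>P\<close>, that block was \<open>a\<close> itself or
  \<open>a\<close> together with one other block.\<close>

lemma separate_eq_bottom:
  assumes P: "P \<in> fams" "a \<in> P" and Q: "Q \<in> fams" "finer P Q" "\<Union>Q = \<Union>P" and eq: "separate a Q = P"
  shows "Q = P \<or> (\<exists>b\<in>P - {a}. Q = merge a b P)"
proof -
  obtain C0 where C0: "C0 \<in> Q" "a \<subseteq> C0" using finerE[OF Q(2) P(2)] by metis
  obtain x0 where x0: "x0 \<in> a" using famsD(2)[OF P] by auto
  have other: "C \<in> P" "C \<inter> C0 = {}" if C: "C \<in> Q" "C \<noteq> C0" for C
  proof -
    show d: "C \<inter> C0 = {}" using famsD(3)[OF Q(1) C(1) C0(1)] C(2) by auto
    have "C - a = C" using d C0(2) by auto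
    moreover have "C \<noteq> {}" using famsD(2)[OF Q(1) C(1)] .
    ultimately have "C \<in> separate a Q" using C(1) unfolding separate_def by (auto intro!: image_eqI[of _ _ C])
    then show "C \<in> P" unfolding eq .
  qed
  show ?thesis
  proof (cases "C0 = a")
    case True
    have "finer Q P" unfolding finer_def
    proof
      fix C assume "C \<in> Q"
      then have "C \<in> P" using other(1)[of C] True P(2) by (cases "C = C0") auto
      then show "\<exists>Y\<in>P. C \<subseteq> Y" by auto
    qed
    then show ?thesis using finer_antisym[OF Q(1) P(1) _ Q(2)] by simp
  next
    case False
    define b where "b = C0 - a"
    have bne: "b \<noteq> {}" using False C0(2) unfolding b_def by auto
    then have "b \<in> separate a Q" using C0(1) unfolding separate_def b_def by auto
    then have b: "b \<in> P" unfolding eq .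
    have C0ab: "C0 = a \<union> b" using C0(2) unfolding b_def by auto
    have ba: "b \<noteq> a" using x0 unfolding b_def by auto
    have M: "merge a b P \<in> fams" by (rule merge_fams[OF P b])
    have "finer Q (merge a b P)" unfolding finer_def
    proof
      fix C assume C: "C \<in> Q"
      show "\<exists>Y\<in>merge a b P. C \<subseteq> Y"
      proof (cases "C = C0")
        case True
        then show ?thesis unfolding merge_def C0ab by auto
      next
        case False
        note o = other[OF C False]
        obtain x where x: "x \<in> C" using famsD(2)[OF Q(1) C] by auto
        then have "x \<notin> a" "x \<notin> b" using o(2) unfolding C0ab by auto
        then have "C \<noteq> a" "C \<noteq> b" using x by auto
        then show ?thesis using o(1) unfolding merge_def by auto
      qed
    qed
    moreover have "finer (merge a b P) Q" unfolding finer_def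
    proof
      fix X assume "X \<in> merge a b P"
      then consider "X = a \<union> b" | "X \<in> P" unfolding merge_def by auto
      then show "\<exists>Y\<in>Q. X \<subseteq> Y"
      proof cases
        case 1
        then show ?thesis using C0(1) C0ab by auto
      next
        case 2
        then show ?thesis using finerE[OF Q(2)] by metis
      qed
    qed
    ultimately have "Q = merge a b P" by (rule finer_antisym[OF Q(1) M])
    then show ?thesis using b ba by auto
  qed
qed

lemma merge_card:
  assumes P: "P \<in> fams" "a \<in> P" "b \<in> P" "a \<noteq> b"
  shows "card (merge a b P) = card P - 1"
proof -
  have fin: "finite P" by simp
  have "2 \<le> card P" using card_mono[OF fin, of "{a, b}"] P(2,3,4) by simp
  moreover have "card (P - {a, b}) = card P - 2" using P(2,3,4) by (simp add: card_Diff_subset)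
  moreover have "a \<union> b \<notin> P - {a, b}" using merge_union_notin[OF P] by simp
  ultimately show ?thesis unfolding merge_def by simp
qed

lemma merge_inj:
  assumes P: "P \<in> fams" "a \<in> P"
  shows "inj_on (\<lambda>b. merge a b P) (P - {a})"
proof (rule inj_onI)
  fix b b' assume b: "b \<in> P - {a}" "b' \<in> P - {a}" and eq: "merge a b P = merge a b' P"
  have "a \<union> b \<in> merge a b P" unfolding merge_def by simp
  then have "a \<union> b \<in> merge a b' P" unfolding eq .
  moreover have "a \<union> b \<notin> P" using merge_union_notin[OF P, of b] b by auto
  ultimately have e: "a \<union> b = a \<union> b'" unfolding merge_def by auto
  obtain x where x: "x \<in> b" using famsD(2)[OF P(1), of b] b by auto
  have "x \<notin> a" using famsD(3)[OF P(1), of b a x] b P(2) x by auto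
  then have "x \<in> b'" using e x by auto
  then show "b = b'" using famsD(3)[OF P(1), of b b' x] b x by auto
qed

lemma Pi_upper:
  assumes P: "P \<in> fams" "P \<noteq> {}" and H: "H \<in> Pi P"
  shows "{z\<in>Pi P. rlt H z} = Pi H"
proof -
  have U: "\<Union>H = \<Union>P" by (rule PiD(4)[OF P H])
  have PH: "rlt P H" using H unfolding Pi_def by simp
  show ?thesis unfolding Pi_def U using R.trans[OF PH] by auto
qed

text \<open>Fix a block \<open>a\<close> and let p be the number of blocks. The p - 1 families
  merging \<open>a\<close> with one other block are exactly the members of \<open>Pi P\<close> whose
  meet with the two-block family of \<open>a\<close> and the rest is \<open>P\<close>. Without them
  these meets contract \<open>Pi P\<close>; each of them covers \<open>P\<close> and has the
  partition lattice on p - 1 blocks above it, whence the factorial.\<close>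

lemma partition_good:
  assumes "P \<in> fams" "2 \<le> card P"
  shows "\<exists>S. good rlt (Pi P) S \<and> card S = fact (card P - 1) \<and>
    (\<forall>c\<in>S. R.sat fams P c {\<Union>P} \<and> card c + 2 = card P)"
  using assms
proof (induction "card P" arbitrary: P rule: less_induct)
  case less
  note P = less.prems(1)
  have fin: "finite P" by simp
  have Pne: "P \<noteq> {}" using less.prems(2) by auto
  then obtain a where a: "a \<in> P" by auto
  have "card (P - {a}) \<ge> 1" using less.prems(2) a by simp
  then obtain b0 where b0: "b0 \<in> P - {a}" by (metis card.empty all_not_in_conv not_one_le_zero)
  let ?H = "\<lambda>b. merge a b P"
  have sm: "R.sat fams P {} (?H b)" if "b \<in> P - {a}" for b using sat_merge[OF P a] that by auto
  show ?case
  proof (cases "card P = 2")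
    case True
    have "a \<noteq> b0" using b0 by auto
    then have "card {a, b0} = 2" by simp
    moreover have "{a, b0} \<subseteq> P" using a b0 by auto
    ultimately have Pab: "P = {a, b0}" using card_subset_eq[OF fin, of "{a, b0}"] True by simp
    \<comment> \<open>With two blocks a single merge reaches the top, so the open interval is empty
      and its empty chain is the one to remove.\<close>
    have "?H b0 = {\<Union>P}" unfolding merge_def Pab by auto
    then have s: "R.sat fams P {} {\<Union>P}" using sm[OF b0] by simp
    then have "max_chain rlt (Pi P) {}" unfolding R.sat_def Pi_def by simp
    then have "Pi P = {}" unfolding max_chain_def by auto
    then show ?thesis using good_empty[of rlt] s True by (intro exI[of _ "{{}}"]) simp
  next
    case False
    then have c3: "3 \<le> card P" using less.prems(2) by simp
    define \<kappa> where "\<kappa> = {a, \<Union>(P - {a})}"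
    have aU: "a \<noteq> \<Union>P"
    proof
      assume "a = \<Union>P"
      then have "b0 \<subseteq> a" using b0 by auto
      moreover obtain x where "x \<in> b0" using famsD(2)[OF P, of b0] b0 by auto
      ultimately show False using famsD(3)[OF P, of b0 a x] a b0 by auto
    qed
    have Pa: "P - {a} \<in> fams" using famsD(1,3)[OF P] by (intro famsI) auto
    have \<kappa>f: "\<kappa> \<in> fams"
    proof (rule famsI)
      show "X \<in> N" if "X \<in> \<kappa>" for X
        using that famsD(1)[OF P a] Union_N[OF Pa] b0 unfolding \<kappa>_def by auto
      have d: "x \<notin> \<Union>(P - {a})" if "x \<in> a" for x using famsD(3)[OF P _ a, of _ x] that by auto
      show "X = Y" if "X \<in> \<kappa>" "Y \<in> \<kappa>" "x \<in> X" "x \<in> Y" for X Y x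
        using that d[of x] unfolding \<kappa>_def by auto
    qed
    have U\<kappa>: "\<Union>\<kappa> = \<Union>P" unfolding \<kappa>_def using a by auto
    have aH: "a \<notin> ?H b" if b: "b \<in> P - {a}" for b
    proof
      assume "a \<in> ?H b"
      then have "b \<subseteq> a" unfolding merge_def by auto
      moreover obtain x where "x \<in> b" using famsD(2)[OF P, of b] b by auto
      ultimately show False using famsD(3)[OF P, of b a x] a b by auto
    qed
    have HPi: "?H b \<in> Pi P" if b: "b \<in> P - {a}" for b
    proof (rule PiI[OF P Pne merge_fams[OF P a]])
      show "b \<in> P" using b by simp
      have "rlt P (?H b)" using sm[OF b] unfolding R.sat_def by simp
      then show "finer P (?H b)" unfolding rlt_def by simp
      show "P \<noteq> ?H b" using aH[OF b] a by metis
      show "\<Union>(?H b) = \<Union>P" using merge_Union[OF a] b by simp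
      have "a \<noteq> b" "b \<in> P" using b by blast+
      then have "card (?H b) \<ge> 2" using merge_card[OF P a, of b] c3 by simp
      then show "?H b \<noteq> {\<Union>P}" by auto
    qed
    let ?Y = "Pi P - ?H ` (P - {a})"
    have sepY: "separate a Q \<in> ?Y" if Q: "Q \<in> ?Y" for Q
    proof -
      have QP: "Q \<in> Pi P" using Q by simp
      note D = PiD[OF P Pne QP]
      note s = separate[OF P a D(1,2,4)]
      \<comment> \<open>Having \<open>a\<close> as a block distinguishes the meet from the top and
        from all the merges, whose blocks properly absorb \<open>a\<close>.\<close>
      have aS: "a \<in> separate a Q" unfolding separate_def by simp
      have "separate a Q \<noteq> P" using separate_eq_bottom[OF P a D(1,2,4)] D(3) Q by auto
      moreover have "separate a Q \<noteq> {\<Union>P}" using aS aU by auto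
      ultimately have "separate a Q \<in> Pi P" using s by (intro PiI[OF P Pne]) auto
      moreover have "separate a Q \<notin> ?H ` (P - {a})" using aS aH by auto
      ultimately show ?thesis by simp
    qed
    have \<kappa>Y: "\<kappa> \<in> ?Y"
    proof -
      have "finer P \<kappa>" unfolding finer_def \<kappa>_def by auto
      moreover have "P \<noteq> \<kappa>"
      proof
        assume "P = \<kappa>"
        moreover have "card \<kappa> \<le> 2" unfolding \<kappa>_def by (simp add: card_insert_if)
        ultimately have "card P \<le> 2" by simp
        then show False using c3 by simp
      qed
      moreover have "a \<in> \<kappa>" unfolding \<kappa>_def by simp
      moreover then have "\<kappa> \<noteq> {\<Union>P}" using aU by auto
      ultimately have "\<kappa> \<in> Pi P" using U\<kappa> by (intro PiI[OF P Pne \<kappa>f]) auto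
      moreover have "\<kappa> \<notin> ?H ` (P - {a})" using \<open>a \<in> \<kappa>\<close> aH by auto
      ultimately show ?thesis by simp
    qed
    have colY: "collapses (order_complex rlt ?Y) {}"
    proof (rule R.meet_contractible[where a = \<kappa> and m = "separate a"])
      show "finite ?Y" by simp
      show "\<kappa> \<in> ?Y" by (rule \<kappa>Y)
      fix Q assume Q: "Q \<in> ?Y"
      then have QP: "Q \<in> Pi P" by simp
      note D = PiD[OF P Pne QP]
      note s = separate[OF P a D(1,2,4)]
      show "separate a Q \<in> ?Y \<and> (separate a Q = Q \<or> rlt (separate a Q) Q) \<and> (separate a Q = \<kappa> \<or> rlt (separate a Q) \<kappa>)"
        using sepY[OF Q] rle_iff[OF s(1) D(1)] rle_iff[OF s(1) \<kappa>f] s(3,4) unfolding \<kappa>_def[symmetric] by simp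
      fix Z assume Z: "Z \<in> ?Y" "rlt Z Q" "Z = \<kappa> \<or> rlt Z \<kappa>"
      have Zf: "Z \<in> fams" using Z(1) unfolding Pi_def by simp
      have "finer Z Q" "finer Z \<kappa>" using Z(2,3) finer_refl unfolding rlt_def by auto
      then have "finer Z (separate a Q)" using s(6)[OF Zf] unfolding \<kappa>_def by simp
      then show "Z = separate a Q \<or> rlt Z (separate a Q)" using rle_iff[OF Zf s(1)] by simp
    qed
    have dif: "Pi P - ?Y = ?H ` (P - {a})" using HPi by auto
    have "\<forall>x\<in>?H ` (P - {a}). \<exists>S. good rlt (Pi x) S \<and> card S = fact (card x - 1) \<and>
      (\<forall>c\<in>S. R.sat fams x c {\<Union>x} \<and> card c + 2 = card x)"
    proof
      fix x assume "x \<in> ?H ` (P - {a})"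
      then obtain b where b: "b \<in> P" "a \<noteq> b" "x = ?H b" by auto
      have "card x = card P - 1" unfolding b(3) by (rule merge_card[OF P a b(1,2)])
      then show "\<exists>S. good rlt (Pi x) S \<and> card S = fact (card x - 1) \<and>
        (\<forall>c\<in>S. R.sat fams x c {\<Union>x} \<and> card c + 2 = card x)"
        using less.hyps[of x] merge_fams[OF P a b(1)] c3 b(3) by simp
    qed
    then obtain T where T: "\<And>x. x \<in> ?H ` (P - {a}) \<Longrightarrow> good rlt (Pi x) (T x) \<and> card (T x) = fact (card x - 1) \<and>
      (\<forall>c\<in>T x. R.sat fams x c {\<Union>x} \<and> card c + 2 = card x)"
      by (metis (no_types, lifting) bchoice)
    let ?S = "\<Union>x\<in>Pi P - ?Y. glue {{}} x (T x)"
    have glue_eq: "glue {{}} x (T x) = insert x ` T x" for x unfolding glue_def by auto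
    have chain: "R.sat fams P c {\<Union>P} \<and> card c + 2 = card P" if c: "c \<in> glue {{}} x (T x)" and x: "x \<in> ?H ` (P - {a})" for c x
    proof -
      obtain t where t: "t \<in> T x" "c = insert x t" using c unfolding glue_eq by auto
      obtain b where b: "b \<in> P - {a}" "x = ?H b" using x by auto
      have xU: "\<Union>x = \<Union>P" using merge_Union[OF a] b by simp
      have st: "R.sat fams x t {\<Union>P}" "card t + 2 = card x" using T[OF x] t xU by auto
      have xf: "x \<in> fams" using HPi[OF b(1)] unfolding b(2) Pi_def by simp
      have "R.sat fams P ({} \<union> insert x t) {\<Union>P}"
        by (rule R.sat_compose[OF sm[OF b(1), folded b(2)] st(1) xf])
      moreover have "x \<notin> t" using goodD(3)[of rlt "Pi x" "T x" t] T[OF x] t R.irrefl unfolding Pi_def by auto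
      then have "card c = card t + 1" unfolding t(2) by simp
      moreover have "card x = card P - 1" unfolding b(2) using merge_card[OF P a] b(1) by auto
      ultimately show ?thesis using t(2) st(2) c3 by simp
    qed
    have "good rlt (Pi P) ({} \<union> ?S)"
    proof (rule R.good_insert_elements)
      show "good rlt ?Y {}" using colY unfolding good_def by simp
      fix x assume "x \<in> Pi P - ?Y"
      then have x: "x \<in> ?H ` (P - {a})" using dif by simp
      then obtain b where b: "b \<in> P - {a}" "x = ?H b" by auto
      have low: "{y\<in>?Y. rlt y x} = {}"
      proof (rule ccontr)
        assume "{y\<in>?Y. rlt y x} \<noteq> {}"
        then obtain y where y: "y \<in> fams" "rlt P y" "rlt y x" unfolding Pi_def by auto
        then have "y \<in> {}" using sm[OF b(1)] unfolding R.sat_def max_chain_def b(2) by auto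
        then show False by simp
      qed
      show "good rlt {y\<in>?Y. rlt y x} {{}}" unfolding low by (rule good_empty)
      show "good rlt {z\<in>Pi P. rlt x z} (T x)"
        unfolding Pi_upper[OF P Pne HPi[OF b(1), folded b(2)]] using T[OF x] by simp
      fix c assume "c \<in> glue {{}} x (T x)"
      then show "max_chain rlt (Pi P) c" using chain[OF _ x] unfolding R.sat_def Pi_def by simp
    qed auto
    moreover have "card ?S = fact (card P - 1)"
    proof -
      have up: "t \<subseteq> {z. rlt x z}" if "x \<in> ?H ` (P - {a})" "t \<in> T x" for x t
        using goodD(3)[of rlt "Pi x" "T x" t] T[OF that(1)] that(2) unfolding Pi_def by auto
      have cg: "card (glue {{}} x (T x)) = fact (card P - 2)" if x: "x \<in> ?H ` (P - {a})" for x
      proof -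
        have "inj_on (insert x) (T x)"
        proof (rule inj_onI)
          fix t t' assume "t \<in> T x" "t' \<in> T x" "insert x t = insert x t'"
          moreover have "x \<notin> t" "x \<notin> t'" using up[OF x] calculation(1,2) R.irrefl by auto
          ultimately show "t = t'" by (metis insert_ident)
        qed
        then have "card (glue {{}} x (T x)) = card (T x)" unfolding glue_eq by (rule card_image)
        also have "\<dots> = fact (card x - 1)" using T[OF x] by simp
        also have "card x = card P - 1" using x merge_card[OF P a] by auto
        finally show ?thesis by (simp add: numeral_2_eq_2)
      qed
      have "card ?S = (\<Sum>x\<in>?H ` (P - {a}). card (glue {{}} x (T x)))"
        unfolding dif
      proof (rule card_UN_disjoint)
        show "\<forall>x\<in>?H ` (P - {a}). \<forall>y\<in>?H ` (P - {a}). x \<noteq> y \<longrightarrow> glue {{}} x (T x) \<inter> glue {{}} y (T y) = {}"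
        proof (intro ballI impI equals0I)
          fix x y c assume xy: "x \<in> ?H ` (P - {a})" "y \<in> ?H ` (P - {a})" "x \<noteq> y"
            and c: "c \<in> glue {{}} x (T x) \<inter> glue {{}} y (T y)"
          obtain t t' where t: "t \<in> T x" "t' \<in> T y" "insert x t = insert y t'" using c unfolding glue_eq by auto
          then have "y \<in> t" "x \<in> t'" using xy(3) by auto
          then have "rlt x y" "rlt y x" using up[OF xy(1) t(1)] up[OF xy(2) t(2)] by auto
          then show False using R.asym by auto
        qed
      qed auto
      also have "\<dots> = card (?H ` (P - {a})) * fact (card P - 2)" using cg by simp
      also have "card (?H ` (P - {a})) = card P - 1" using card_image[OF merge_inj[OF P a]] a by simp
      also have "(card P - 1) * fact (card P - 2) = fact (card P - 1)"
        using fact_reduce[of "card P - 1", where 'a = nat] c3 by (simp add: numeral_2_eq_2)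
      finally show ?thesis .
    qed
    moreover have "\<forall>c\<in>?S. R.sat fams P c {\<Union>P} \<and> card c + 2 = card P"
      using chain dif by blast
    ultimately show ?thesis by auto
  qed
qed

end

section \<open>Intervals of families\<close>

context edge_order
begin

text \<open>The families under \<open>P\<close> that miss a point of its union; for
  \<open>P = {B}\<close> this is the poset into which the families covering \<open>B\<close> are
  later inserted.\<close>

definition W :: "'n set set \<Rightarrow> 'n set set set" where
  "W P = {Q\<in>fams. Q \<noteq> {} \<and> finer Q P \<and> \<Union>Q \<noteq> \<Union>P}"

lemma psi_V_subset_W:
  assumes P: "P \<in> fams"
  shows "psi P ` V P \<subseteq> W P"
proof
  fix Q assume "Q \<in> psi P ` V P"
  then obtain X where X: "X \<in> V P" "Q = psi P X" by auto
  note i = psi_V_interval[OF P X(1)]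
  have XP: "X \<subset> \<Union>P" using X(1) unfolding V_def by simp
  have "\<Union>Q = X" using psi_Union[of X P] XP X(2) by simp
  then have "\<Union>Q \<noteq> \<Union>P" using XP by simp
  moreover have "Q \<noteq> {}" using i(1,2) rlt_bot[of Q] X(2) by simp
  ultimately show "Q \<in> W P" unfolding W_def using i(1) psi_finer_P[of P X] X(2) by simp
qed

lemma W_subset_interval:
  assumes P: "P \<in> fams"
  shows "W P \<subseteq> {z\<in>fams. rlt {} z \<and> rlt z P}"
proof
  fix Q assume Q: "Q \<in> W P"
  then have Qf: "Q \<in> fams" "Q \<noteq> {}" "finer Q P" "Q \<noteq> P" unfolding W_def by auto
  then show "Q \<in> {z\<in>fams. rlt {} z \<and> rlt z P}" using rlt_bot[OF Qf(1)] rlt_iff[OF Qf(1) P] by simp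
qed

text \<open>Among the images of \<open>V P\<close>, the least one above a family \<open>Q\<close> is
  \<open>psi P (\<Union>Q)\<close>. A family outside the image therefore has a cone above it and can
  be discarded, and the chains of \<open>V P\<close> carry over.\<close>

lemma W_good:
  assumes P: "P \<in> fams" and cV: "V_chains P cV"
  shows "good rlt (W P) ((\<lambda>D. psi P ` cV D) ` decs P)"
proof -
  have gV: "good (\<subset>) (V P) (cV ` decs P)" using cV unfolding V_chains_def by simp
  have "good rlt (psi P ` V P) ((`) (psi P) ` cV ` decs P)"
    by (rule good_image[OF V_psi_inj V_psi_emb gV])
  then have g: "good rlt (psi P ` V P) ((\<lambda>D. psi P ` cV D) ` decs P)" by (simp add: image_image)
  show ?thesis
  proof (rule good_superposet_up[OF R.strict_poset_axioms _ psi_V_subset_W[OF P] g])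
    show "finite (W P)" by simp
    fix c assume c: "c \<in> (\<lambda>D. psi P ` cV D) ` decs P"
    then obtain D where D: "D \<in> decs P" "c = psi P ` cV D" by auto
    have "max_chain rlt {z\<in>fams. rlt {} z \<and> rlt z P} c"
      using cV D unfolding V_chains_def R.sat_def by simp
    moreover have "c \<subseteq> W P" using goodD(3)[OF g c] psi_V_subset_W[OF P] by (rule subset_trans)
    ultimately show "max_chain rlt (W P) c" using W_subset_interval[OF P] by (rule max_chain_subset)
  next
    fix Q assume Q: "Q \<in> W P - psi P ` V P"
    then have Qf: "Q \<in> fams" "Q \<noteq> {}" "finer Q P" "\<Union>Q \<noteq> \<Union>P" unfolding W_def by auto
    have QP: "\<Union>Q \<subseteq> \<Union>P" by (rule finer_Union[OF Qf(3)])
    have block: "\<exists>A\<in>P. C \<subseteq> \<Union>Q \<inter> A" if C: "C \<in> Q" for C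
    proof -
      obtain A where "A \<in> P" "C \<subseteq> A" using finerE[OF Qf(3) C] by metis
      then show ?thesis using C by auto
    qed
    have UV: "\<Union>Q \<in> V P" unfolding V_def
    proof (intro CollectI conjI ballI)
      obtain C where C: "C \<in> Q" using Qf(2) by auto
      then show "\<Union>Q \<noteq> {}" using famsD(2)[OF Qf(1) C] by auto
      show "\<Union>Q \<subset> \<Union>P" using QP Qf(4) by simp
      fix A assume A: "A \<in> P"
      show "\<Union>Q \<inter> A = {} \<or> \<Union>Q \<inter> A \<in> N"
      proof (cases "\<Union>Q \<inter> A = {}")
        case False
        then obtain x C where x: "x \<in> C" "C \<in> Q" "x \<in> A" by auto
        obtain A' where A': "A' \<in> P" "C \<subseteq> \<Union>Q \<inter> A'" using block[OF x(2)] by auto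
        have "A' = A" using famsD(3)[OF P A'(1) A, of x] A'(2) x by auto
        then show ?thesis using up[OF famsD(1)[OF Qf(1) x(2)]] A'(2) by simp
      qed simp
    qed
    have "finer Q (psi P (\<Union>Q))" unfolding finer_def
    proof
      fix C assume C: "C \<in> Q"
      obtain A where A: "A \<in> P" "C \<subseteq> \<Union>Q \<inter> A" using block[OF C] by auto
      have "\<Union>Q \<inter> A \<noteq> {}" using A(2) famsD(2)[OF Qf(1) C] by auto
      then have "\<Union>Q \<inter> A \<in> psi P (\<Union>Q)" using A(1) unfolding psi_def by simp
      then show "\<exists>Y\<in>psi P (\<Union>Q). C \<subseteq> Y" using A(2) by (rule bexI[rotated])
    qed
    moreover have "Q \<noteq> psi P (\<Union>Q)" using Q UV by auto
    ultimately have lt: "rlt Q (psi P (\<Union>Q))" using rlt_iff[OF Qf(1) psi_V_interval(1)[OF P UV]] by simp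
    show "collapses (order_complex rlt {y\<in>psi P ` V P. rlt Q y}) {}"
    proof (rule chains_cone[of _ "psi P (\<Union>Q)"])
      show "finite {y\<in>psi P ` V P. rlt Q y}" by simp
      show "psi P (\<Union>Q) \<in> {y\<in>psi P ` V P. rlt Q y}" using UV lt by simp
      show "\<forall>y\<in>{y\<in>psi P ` V P. rlt Q y}. comparable rlt (psi P (\<Union>Q)) y"
      proof
        fix y assume "y \<in> {y\<in>psi P ` V P. rlt Q y}"
        then obtain X where X: "X \<in> V P" "y = psi P X" "rlt Q y" by auto
        have XP: "X \<subseteq> \<Union>P" using X(1) unfolding V_def by auto
        have "\<Union>Q \<subseteq> \<Union>y" using X(3) finer_Union unfolding rlt_def by blast
        then have "\<Union>Q \<subseteq> X" unfolding X(2) psi_Union[OF XP] .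
        then have "\<Union>Q = X \<or> \<Union>Q \<subset> X" by auto
        then show "comparable rlt (psi P (\<Union>Q)) y"
          using psi_rlt[OF QP XP] X(2) unfolding comparable_def by auto
      qed
    qed
  qed
qed

section \<open>The chains removed from a whole interval\<close>

definition cv :: "'n set set \<Rightarrow> ('n set \<times> nat) set \<Rightarrow> 'n set set" where
  "cv P = (SOME cV. V_chains P cV)"

lemma cv: "P \<in> fams \<Longrightarrow> P \<noteq> {} \<Longrightarrow> V_chains P (cv P)"
  unfolding cv_def using someI_ex[OF V_chains_exists] .

definition low_chain :: "('n set \<times> nat) set \<Rightarrow> 'n set set set" where
  "low_chain D = psi (fst ` D) ` cv (fst ` D) D"

text \<open>A single block is already the top, with no interval above it. The value
  \<open>{{}}\<close> then provides one empty upper chain, in accordance with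
  \<open>fact 0 = 1\<close>.\<close>

definition upper :: "'n set set \<Rightarrow> 'n set set set set" where
  "upper P = (if card P \<le> 1 then {{}} else (SOME S. good rlt (Pi P) S \<and> card S = fact (card P - 1) \<and>
    (\<forall>c\<in>S. R.sat fams P c {\<Union>P} \<and> card c + 2 = card P)))"

lemma upper_props:
  assumes "P \<in> fams" "2 \<le> card P"
  shows "good rlt (Pi P) (upper P) \<and> card (upper P) = fact (card P - 1) \<and>
    (\<forall>c\<in>upper P. R.sat fams P c {\<Union>P} \<and> card c + 2 = card P)"
proof -
  have "upper P = (SOME S. good rlt (Pi P) S \<and> card S = fact (card P - 1) \<and>
    (\<forall>c\<in>S. R.sat fams P c {\<Union>P} \<and> card c + 2 = card P))" using assms(2) unfolding upper_def by simp
  then show ?thesis by (simp only:) (rule someI_ex[OF partition_good[OF assms]])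
qed

lemma upper:
  assumes "P \<in> fams" "2 \<le> card P"
  shows "good rlt (Pi P) (upper P)" "\<And>c. c \<in> upper P \<Longrightarrow> R.sat fams P c {\<Union>P} \<and> card c + 2 = card P"
  using upper_props[OF assms] by blast+

lemma upper_card:
  assumes "P \<in> fams"
  shows "card (upper P) = fact (card P - 1)"
proof (cases "card P \<le> 1")
  case True
  then have "card P - 1 = 0" by simp
  then show ?thesis using True by (simp add: upper_def)
next
  case False
  then show ?thesis using upper_props[OF assms] by simp
qed

definition alldecs :: "'n set \<Rightarrow> ('n set \<times> nat) set set" where
  "alldecs B = {D. fst ` D \<in> fams \<and> \<Union>(fst ` D) = B \<and> inj_on fst D \<and> (\<forall>p\<in>D. snd p \<in> trapped q (fst p))}"

text \<open>Taking away \<open>{B}\<close> takes effect for one-block decompositions: there the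
  family of blocks is the top of the interval and not an interior element.\<close>

definition full_chain :: "'n set \<Rightarrow> ('n set \<times> nat) set \<Rightarrow> 'n set set set \<Rightarrow> 'n set set set" where
  "full_chain B D t = (low_chain D \<union> insert (fst ` D) t) - {{B}}"

definition index :: "'n set \<Rightarrow> (('n set \<times> nat) set \<times> 'n set set set) set" where
  "index B = {(D, t). D \<in> alldecs B \<and> t \<in> upper (fst ` D)}"

definition interval :: "'n set \<Rightarrow> 'n set set set" where
  "interval B = {Q\<in>fams. rlt {} Q \<and> rlt Q {B}}"

lemma alldecs_decs: "D \<in> alldecs B \<Longrightarrow> D \<in> decs (fst ` D)"
  unfolding alldecs_def decs_def by simp

lemma decs_alldecs: "P \<in> fams \<Longrightarrow> \<Union>P = B \<Longrightarrow> D \<in> decs P \<Longrightarrow> D \<in> alldecs B \<and> fst ` D = P"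
  unfolding alldecs_def decs_def by simp

lemma card_one_block:
  fixes P :: "'n set set"
  assumes "P \<noteq> {}" "P \<noteq> {\<Union>P}"
  shows "2 \<le> card P"
proof (rule ccontr)
  assume "\<not> 2 \<le> card P"
  moreover have "card P > 0" using assms(1) by (simp add: card_gt_0_iff)
  ultimately have "card P = 1" by linarith
  then obtain A where "P = {A}" by (auto simp: card_1_singleton_iff)
  then show False using assms(2) by simp
qed

lemma low_chain_props:
  assumes D: "D \<in> alldecs B" and ne: "fst ` D \<noteq> {}"
  shows "low_chain D \<subseteq> W (fst ` D)" "R.sat fams {} (low_chain D) (fst ` D)"
    "card (low_chain D) + 1 = dec_size D" "\<And>Q. Q \<in> low_chain D \<Longrightarrow> Q \<subseteq> uni"
proof -
  let ?P = "fst ` D"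
  have P: "?P \<in> fams" using D unfolding alldecs_def by simp
  note c = cv[OF P ne]
  have p: "cv ?P D \<subseteq> V ?P" "R.sat fams {} (psi ?P ` cv ?P D) ?P" "card (cv ?P D) + 1 = dec_size D"
    and p4: "\<forall>X\<in>cv ?P D. \<forall>A\<in>?P. X \<inter> A \<in> uni"
    using c alldecs_decs[OF D] unfolding V_chains_def by blast+
  show "low_chain D \<subseteq> W ?P" unfolding low_chain_def using psi_V_subset_W[OF P] p(1) by blast
  show "R.sat fams {} (low_chain D) ?P" unfolding low_chain_def by (rule p(2))
  have "card (psi ?P ` cv ?P D) = card (cv ?P D)" by (rule card_image[OF inj_on_subset[OF V_psi_inj p(1)]])
  then show "card (low_chain D) + 1 = dec_size D" unfolding low_chain_def using p(3) by simp
  show "Q \<subseteq> uni" if Q: "Q \<in> low_chain D" for Q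
  proof
    fix C assume C: "C \<in> Q"
    obtain X where X: "X \<in> cv ?P D" "Q = psi ?P X" using Q unfolding low_chain_def by auto
    then obtain A where "A \<in> ?P" "C = X \<inter> A" using C unfolding psi_def by auto
    then show "C \<in> uni" using bspec[OF bspec[OF p4 X(1)]] by simp
  qed
qed

lemma low_chain_inj:
  assumes "D \<in> alldecs B" "D' \<in> alldecs B" "fst ` D = fst ` D'" "low_chain D = low_chain D'" "fst ` D \<noteq> {}"
  shows "D = D'"
proof -
  let ?P = "fst ` D"
  have P: "?P \<in> fams" using assms(1) unfolding alldecs_def by simp
  note c = cv[OF P assms(5)]
  have D: "D \<in> decs ?P" "D' \<in> decs ?P" using alldecs_decs[OF assms(1)] alldecs_decs[OF assms(2)] assms(3) by simp_all
  have s: "cv ?P D \<subseteq> V ?P" "cv ?P D' \<subseteq> V ?P" "inj_on (cv ?P) (decs ?P)"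
    using c D unfolding V_chains_def by simp_all
  have "psi ?P ` cv ?P D = psi ?P ` cv ?P D'" using assms(3,4) unfolding low_chain_def by simp
  then have "cv ?P D = cv ?P D'" using inj_on_image_eq_iff[OF V_psi_inj s(1,2)] by simp
  then show ?thesis using inj_onD[OF s(3)] D by simp
qed

lemma index_cases:
  assumes B: "B \<in> N" and Dt: "(D, t) \<in> index B"
  obtains "fst ` D = {B}" "t = {}" "full_chain B D t = low_chain D" "low_chain D \<subseteq> W {B}"
  | "fst ` D \<noteq> {B}" "2 \<le> card (fst ` D)" "full_chain B D t = low_chain D \<union> insert (fst ` D) t"
    "t \<subseteq> Pi (fst ` D)" "fst ` D \<in> interval B - W {B}" "low_chain D \<subseteq> W (fst ` D)"
proof -
  have D: "D \<in> alldecs B" and t: "t \<in> upper (fst ` D)" using Dt unfolding index_def by simp_all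
  have P: "fst ` D \<in> fams" "\<Union>(fst ` D) = B" using D unfolding alldecs_def by simp_all
  have ne: "fst ` D \<noteq> {}" using P(2) N_nonempty[OF B] by (metis Union_empty)
  note l = low_chain_props[OF D ne]
  have BnW: "{B} \<notin> W (fst ` D)" unfolding W_def using P(2) by simp
  show thesis
  proof (cases "fst ` D = {B}")
    case True
    then have "t = {}" using t unfolding upper_def by simp
    moreover have "full_chain B D t = low_chain D" unfolding full_chain_def using True \<open>t = {}\<close> l(1) BnW by auto
    ultimately show thesis using that(1) True l(1) by simp
  next
    case False
    have c2: "2 \<le> card (fst ` D)" using card_one_block[OF ne] False P(2) by simp
    have tPi: "t \<subseteq> Pi (fst ` D)" using goodD(3)[OF upper(1)[OF P(1) c2] t] .
    have "{B} \<notin> t" using tPi P(2) R.irrefl unfolding Pi_def by auto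
    then have f: "full_chain B D t = low_chain D \<union> insert (fst ` D) t"
      unfolding full_chain_def using False l(1) BnW by auto
    have "fst ` D \<in> interval B - W {B}"
      unfolding interval_def interval_bot_top[OF B] W_def using P ne False by simp
    then show thesis using that(2)[OF False c2 f tPi _ l(1)] by simp
  qed
qed

text \<open>For p at least 2 the interior consists of \<open>dec_size D - 1\<close> families below
  the family of blocks, that family itself, and p - 2 coarser ones. For p = 1 it is the lower chain
  alone, and the same formula holds.\<close>

lemma full_chain_sat:
  assumes B: "B \<in> N" and Dt: "(D, t) \<in> index B"
  shows "R.sat fams {} (full_chain B D t) {B}" "card (full_chain B D t) + 2 = dec_size D + card (fst ` D)"
    "\<And>Q. Q \<in> full_chain B D t \<Longrightarrow> Q \<subseteq> uni"
proof -
  have D: "D \<in> alldecs B" and t: "t \<in> upper (fst ` D)" using Dt unfolding index_def by simp_all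
  have P: "fst ` D \<in> fams" "\<Union>(fst ` D) = B" using D unfolding alldecs_def by simp_all
  have ne: "fst ` D \<noteq> {}" using P(2) N_nonempty[OF B] by (metis Union_empty)
  note l = low_chain_props[OF D ne]
  from B Dt have "R.sat fams {} (full_chain B D t) {B} \<and> card (full_chain B D t) + 2 = dec_size D + card (fst ` D)
    \<and> (\<forall>Q\<in>full_chain B D t. Q \<subseteq> uni)"
  proof (cases rule: index_cases)
    case 1
    then show ?thesis using l(2,3,4) by simp
  next
    case 2
    have st: "R.sat fams (fst ` D) t {B}" "card t + 2 = card (fst ` D)"
      using upper(2)[OF P(1) 2(2) t] P(2) by simp_all
    have PnW: "fst ` D \<notin> W (fst ` D)" unfolding W_def by simp
    have Pnt: "fst ` D \<notin> t" using 2(4) R.irrefl unfolding Pi_def by auto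
    have dis: "low_chain D \<inter> insert (fst ` D) t = {}"
    proof (rule equals0I)
      fix Q assume Q: "Q \<in> low_chain D \<inter> insert (fst ` D) t"
      then have "Q \<in> W (fst ` D)" using l(1) by auto
      then have "\<Union>Q \<noteq> \<Union>(fst ` D)" unfolding W_def by simp
      then have "Q \<notin> Pi (fst ` D)" using PiD(4)[OF P(1) ne] by blast
      then have "Q \<notin> t" using 2(4) by blast
      moreover have "Q \<noteq> fst ` D" using \<open>Q \<in> W (fst ` D)\<close> PnW by metis
      ultimately show False using Q by blast
    qed
    have "card (full_chain B D t) = card (low_chain D) + (card t + 1)"
      unfolding 2(3) using dis Pnt by (simp add: card_Un_disjoint)
    then have c: "card (full_chain B D t) + 2 = dec_size D + card (fst ` D)" using l(3) st(2) by simp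
    have Pu: "A \<in> uni" if "A \<in> fst ` D" for A using decs_block[OF alldecs_decs[OF D] that] .
    have tu: "Q \<subseteq> uni" if Q: "Q \<in> t" for Q
    proof
      fix C assume C: "C \<in> Q"
      have QP: "Q \<in> Pi (fst ` D)" using 2(4) Q by auto
      note d = PiD[OF P(1) ne QP]
      show "C \<in> uni" unfolding uni_def
      proof (intro CollectI ballI)
        fix x assume x: "x \<in> C"
        obtain A where A: "A \<in> fst ` D" "x \<in> A" "A \<subseteq> C" using block_contains[OF d(1,2,4) C x] by auto
        then obtain i where "i < q" "E i \<subseteq> A" "x \<in> E i" using Pu[OF A(1)] unfolding uni_def by auto
        then show "\<exists>i<q. E i \<subseteq> C \<and> x \<in> E i" using A(3) by auto
      qed
    qed
    have Pu': "fst ` D \<subseteq> uni" using Pu by auto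
    have "\<forall>Q\<in>full_chain B D t. Q \<subseteq> uni"
    proof
      fix Q assume "Q \<in> full_chain B D t"
      then consider "Q \<in> low_chain D" | "Q = fst ` D" | "Q \<in> t" unfolding 2(3) by auto
      then show "Q \<subseteq> uni" using l(4) Pu' tu by cases simp_all
    qed
    moreover have "R.sat fams {} (full_chain B D t) {B}"
      unfolding 2(3) by (rule R.sat_compose[OF l(2) st(1) P(1)])
    ultimately show ?thesis using c by simp
  qed
  then show "R.sat fams {} (full_chain B D t) {B}" "card (full_chain B D t) + 2 = dec_size D + card (fst ` D)"
    "\<And>Q. Q \<in> full_chain B D t \<Longrightarrow> Q \<subseteq> uni" by auto
qed

text \<open>The family of blocks is the least member of the chain whose union is all of
  \<open>B\<close>. If no member has that union, the decomposition has one block.\<close>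

lemma full_chain_inj:
  assumes B: "B \<in> N"
  shows "inj_on (\<lambda>(D, t). full_chain B D t) (index B)"
proof (rule inj_onI, clarify)
  fix D t D' t' assume Dt: "(D, t) \<in> index B" "(D', t') \<in> index B" and eq: "full_chain B D t = full_chain B D' t'"
  have D: "D \<in> alldecs B" "D' \<in> alldecs B" using Dt unfolding index_def by simp_all
  have ne: "fst ` D \<noteq> {}" using D(1) N_nonempty[OF B] unfolding alldecs_def by auto
  from B Dt(1) show "D = D' \<and> t = t'"
  proof (cases rule: index_cases)
    case a: 1
    from B Dt(2) show ?thesis
    proof (cases rule: index_cases)
      case b: 1
      have "D = D'" using low_chain_inj[OF D _ _ ne] a b eq by simp
      then show ?thesis using a(2) b(2) by simp
    next
      case b: 2
      have "fst ` D' \<in> full_chain B D' t'" unfolding b(3) by simp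
      then have "fst ` D' \<in> low_chain D" unfolding eq[symmetric] a(3) .
      then have "fst ` D' \<in> W {B}" using a(4) by (rule subsetD[rotated])
      then show ?thesis using b(5) by simp
    qed
  next
    case a: 2
    from B Dt(2) show ?thesis
    proof (cases rule: index_cases)
      case b: 1
      have "fst ` D \<in> full_chain B D t" unfolding a(3) by simp
      then have "fst ` D \<in> low_chain D'" unfolding eq b(3) .
      then have "fst ` D \<in> W {B}" using b(4) by (rule subsetD[rotated])
      then show ?thesis using a(5) by simp
    next
      case b: 2
      have sub: "W (fst ` D) \<subseteq> {Q\<in>W {B}. rlt Q (fst ` D)}" if D: "D \<in> alldecs B" for D
      proof
        fix Q assume Q: "Q \<in> W (fst ` D)"
        have PB: "fst ` D \<in> fams" "\<Union>(fst ` D) = B" using D unfolding alldecs_def by simp_all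
        have Qf: "Q \<in> fams" "Q \<noteq> {}" "finer Q (fst ` D)" "\<Union>Q \<noteq> B" using Q PB(2) unfolding W_def by simp_all
        have "\<Union>Q \<subseteq> B" using finer_Union[OF Qf(3)] PB(2) by simp
        then have "Q \<in> W {B}" using Qf unfolding W_def finer_top by simp
        moreover have "rlt Q (fst ` D)" using rlt_iff[OF Qf(1) PB(1)] Qf(3,4) PB(2) by auto
        ultimately show "Q \<in> {Q\<in>W {B}. rlt Q (fst ` D)}" by simp
      qed
      have up: "Pi P \<subseteq> {z. rlt P z}" for P unfolding Pi_def by auto
      have "fst ` D = fst ` D' \<and> low_chain D = low_chain D' \<and> t = t'"
      proof (rule R.glue_inj[where Y = "W {B}"])
        show "low_chain D \<union> insert (fst ` D) t = low_chain D' \<union> insert (fst ` D') t'" using eq a(3) b(3) by simp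
        show "fst ` D \<notin> W {B}" "fst ` D' \<notin> W {B}" using a(5) b(5) by simp_all
        show "low_chain D \<subseteq> {y\<in>W {B}. rlt y (fst ` D)}" by (rule subset_trans[OF a(6) sub[OF D(1)]])
        show "low_chain D' \<subseteq> {y\<in>W {B}. rlt y (fst ` D')}" by (rule subset_trans[OF b(6) sub[OF D(2)]])
        show "t \<subseteq> {z. rlt (fst ` D) z}" by (rule subset_trans[OF a(4) up])
        show "t' \<subseteq> {z. rlt (fst ` D') z}" by (rule subset_trans[OF b(4) up])
      qed
      then show ?thesis using low_chain_inj[OF D _ _ ne] by simp
    qed
  qed
qed

text \<open>The starting poset \<open>W {B}\<close> carries the chains of the one-block
  decompositions, since \<open>{B}\<close> is the excluded top. An inserted \<open>P\<close> sees
  exactly \<open>W P\<close> below it and \<open>Pi P\<close> above it, so its glued chains are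
  indexed by the decompositions with block family \<open>P\<close> and the chains in
  \<open>upper P\<close>.\<close>

lemma interval_good:
  assumes B: "B \<in> N"
  shows "good rlt (interval B) ((\<lambda>(D, t). full_chain B D t) ` index B)"
proof -
  have Bf: "{B} \<in> fams" using B singleton_fams by simp
  let ?Y = "W {B}" and ?X = "interval B"
  let ?A = "\<lambda>P. (\<lambda>D. psi P ` cv P D) ` decs P"
  have Aeq: "?A P = low_chain ` decs P" for P
    by (rule image_cong) (auto simp: low_chain_def decs_def)
  have XY: "P \<in> fams" "\<Union>P = B" "P \<noteq> {B}" "P \<noteq> {}" "2 \<le> card P" if x: "P \<in> ?X - ?Y" for P
  proof -
    have *: "P \<in> fams" "P \<noteq> {}" "\<Union>P \<subseteq> B" "P \<noteq> {B}" using x unfolding interval_def interval_bot_top[OF B] by simp_all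
    then show "P \<in> fams" "P \<noteq> {B}" "P \<noteq> {}" by simp_all
    show "\<Union>P = B" using x * unfolding W_def finer_top by auto
    then show "2 \<le> card P" using card_one_block[of P] * by simp
  qed
  have maxfull: "max_chain rlt ?X (full_chain B D t)" if "(D, t) \<in> index B" for D t
    using full_chain_sat(1)[OF B that] unfolding R.sat_def interval_def by simp
  have glue_full: "\<exists>D t. (D, t) \<in> index B \<and> c = full_chain B D t \<and> fst ` D = P"
    if P: "P \<in> ?X - ?Y" and c: "c \<in> glue (?A P) P (upper P)" for P c
  proof -
    obtain D t where Dt: "D \<in> decs P" "t \<in> upper P" "c = low_chain D \<union> insert P t"
      using c unfolding Aeq glue_def by auto
    note xy = XY[OF P]
    have DP: "D \<in> alldecs B" "fst ` D = P" using decs_alldecs[OF xy(1,2) Dt(1)] by simp_all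
    have ix: "(D, t) \<in> index B" unfolding index_def using DP Dt(2) by simp
    have "full_chain B D t = c" using B ix
    proof (cases rule: index_cases)
      case 1
      then show ?thesis using DP(2) xy(3) by simp
    next
      case 2
      then show ?thesis using Dt(3) DP(2) by simp
    qed
    then show ?thesis using ix DP(2) by blast
  qed
  have g: "good rlt ?X (?A {B} \<union> (\<Union>P\<in>?X - ?Y. glue (?A P) P (upper P)))"
  proof (rule R.good_insert_elements[OF _ _ W_good[OF Bf cv[OF Bf]]])
    show "finite ?X" by simp
    show "?Y \<subseteq> ?X" unfolding interval_def by (rule W_subset_interval[OF Bf])
    fix c assume "c \<in> ?A {B}"
    then obtain D where D: "D \<in> decs {B}" "c = low_chain D" unfolding Aeq by auto
    have DP: "D \<in> alldecs B" "fst ` D = {B}" using decs_alldecs[OF Bf _ D(1), of B] by simp_all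
    have ix: "(D, {}) \<in> index B" unfolding index_def using DP by (simp add: upper_def)
    have "full_chain B D {} = c" using B ix
      by (cases rule: index_cases) (use DP(2) D(2) in simp_all)
    then show "max_chain rlt ?X c" using maxfull[OF ix] by simp
  next
    fix P assume P: "P \<in> ?X - ?Y"
    note xy = XY[OF P]
    have "{y\<in>?Y. rlt y P} = W P"
    proof (rule set_eqI)
      fix Q
      show "Q \<in> {y\<in>?Y. rlt y P} \<longleftrightarrow> Q \<in> W P"
      proof (cases "Q \<in> fams")
        case True
        have "finer Q P \<Longrightarrow> \<Union>Q \<subseteq> B" using finer_Union[of Q P] xy(2) by simp
        then show ?thesis using rlt_iff[OF True xy(1)] xy(2) unfolding W_def finer_top by auto
      next
        case False
        then show ?thesis unfolding W_def by simp
      qed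
    qed
    then show "good rlt {y\<in>?Y. rlt y P} (?A P)" using W_good[OF xy(1) cv[OF xy(1,4)]] by simp
    have bP: "rlt {} P" using rlt_bot[OF xy(1)] xy(4) by simp
    have "{z\<in>?X. rlt P z} = Pi P"
      unfolding interval_def Pi_def xy(2) using R.trans[OF bP] by auto
    then show "good rlt {z\<in>?X. rlt P z} (upper P)" using upper(1)[OF xy(1,5)] by simp
    fix c assume c: "c \<in> glue (?A P) P (upper P)"
    show "max_chain rlt ?X c" using glue_full[OF P c] maxfull by auto
  qed auto
  have "?A {B} \<union> (\<Union>P\<in>?X - ?Y. glue (?A P) P (upper P)) = (\<lambda>(D, t). full_chain B D t) ` index B" (is "?l = ?r")
  proof
    show "?l \<subseteq> ?r"
    proof
      fix c assume "c \<in> ?l"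
      then consider "c \<in> ?A {B}" | P where "P \<in> ?X - ?Y" "c \<in> glue (?A P) P (upper P)" by blast
      then show "c \<in> ?r"
      proof cases
        case 1
        then obtain D where D: "D \<in> decs {B}" "c = low_chain D" unfolding Aeq by auto
        have DP: "D \<in> alldecs B" "fst ` D = {B}" using decs_alldecs[OF Bf _ D(1), of B] by simp_all
        have ix: "(D, {}) \<in> index B" unfolding index_def using DP by (simp add: upper_def)
        have "full_chain B D {} = c" using B ix
          by (cases rule: index_cases) (use DP(2) D(2) in simp_all)
        then show ?thesis using ix by force
      next
        case 2
        then show ?thesis using glue_full[of P c] by force
      qed
    qed
    show "?r \<subseteq> ?l"
    proof
      fix c assume "c \<in> ?r"
      then obtain D t where Dt: "(D, t) \<in> index B" "c = full_chain B D t" by auto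
      have D: "D \<in> decs (fst ` D)" "t \<in> upper (fst ` D)"
        using Dt(1) alldecs_decs[of D B] unfolding index_def by simp_all
      from B Dt(1) show "c \<in> ?l"
      proof (cases rule: index_cases)
        case 1
        then have "c \<in> ?A {B}" unfolding Aeq using D(1) Dt(2) by auto
        then show ?thesis by simp
      next
        case 2
        have "c \<in> glue (?A (fst ` D)) (fst ` D) (upper (fst ` D))"
          unfolding Aeq glue_def using D Dt(2) 2(3) by auto
        then show ?thesis using 2(5) by blast
      qed
    qed
  qed
  then show ?thesis using g by simp
qed

section \<open>Retraction of the enlarged interval\<close>

definition uni_interval :: "'n set \<Rightarrow> 'n set set set" where
  "uni_interval B = {Q\<in>interval B. Q \<subseteq> uni}"

text \<open>Replacing each block by its core retracts all families onto those in the intersection lattice.\<close>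
definition core :: "'n set \<Rightarrow> 'n set" where
  "core C = \<Union>{E i | i. i < q \<and> E i \<subseteq> C}"

lemma core:
  shows "core C \<subseteq> C" "core C \<in> uni" "C \<in> N \<Longrightarrow> core C \<in> N" "X \<in> uni \<Longrightarrow> X \<subseteq> C \<Longrightarrow> X \<subseteq> core C"
proof -
  show "core C \<subseteq> C" unfolding core_def by auto
  show "core C \<in> uni" unfolding core_def uni_def by auto
  show "core C \<in> N" if "C \<in> N"
  proof -
    obtain i where "i < q" "E i \<subseteq> C" using \<open>C \<in> N\<close> unfolding N_def by auto
    then have "E i \<subseteq> core C" unfolding core_def by auto
    then show ?thesis using \<open>i < q\<close> unfolding N_def by auto
  qed
  show "X \<subseteq> core C" if X: "X \<in> uni" "X \<subseteq> C"
  proof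
    fix x assume "x \<in> X"
    then obtain i where "i < q" "E i \<subseteq> X" "x \<in> E i" using X(1) unfolding uni_def by auto
    then show "x \<in> core C" unfolding core_def using X(2) by auto
  qed
qed

text \<open>The cores of the blocks of \<open>x\<close> form the greatest family in
  \<open>uni_interval B\<close> below \<open>x\<close>, so the lower part of a discarded family is a
  cone.\<close>

lemma interval_collapses_uni:
  assumes B: "B \<in> N" and S: "\<forall>c\<in>S. max_chain rlt (interval B) c \<and> c \<subseteq> uni_interval B"
  shows "collapses (order_complex rlt (interval B) - S) (order_complex rlt (uni_interval B) - S)"
proof (rule R.collapses_chains_subposet[OF _ _ S])
  show "finite (interval B)" by simp
  show "uni_interval B \<subseteq> interval B" unfolding uni_interval_def by simp
  fix x assume x: "x \<in> interval B - uni_interval B"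
  then have xi: "x \<in> fams" "rlt {} x" "rlt x {B}" "\<not> x \<subseteq> uni" unfolding uni_interval_def interval_def by simp_all
  let ?y = "core ` x"
  have yf: "?y \<in> fams"
  proof (rule famsI)
    show "X \<in> N" if "X \<in> ?y" for X using that core(3) famsD(1)[OF xi(1)] by auto
    show "X = Y" if XY: "X \<in> ?y" "Y \<in> ?y" "u \<in> X" "u \<in> Y" for X Y u
    proof -
      obtain C C' where C: "C \<in> x" "C' \<in> x" "X = core C" "Y = core C'" using XY by auto
      then have "C = C'" using famsD(3)[OF xi(1), of C C' u] XY(3,4) core(1)[of C] core(1)[of C'] by auto
      then show ?thesis using C by simp
    qed
  qed
  have "finer ?y x" unfolding finer_def using core(1) by blast
  moreover have "?y \<subseteq> uni" using core(2) by auto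
  then have "?y \<noteq> x" using xi(4) by auto
  ultimately have lt: "rlt ?y x" using rlt_iff[OF yf xi(1)] by simp
  have "x \<noteq> {}" using rlt_bot[OF xi(1)] xi(2) by simp
  then have "rlt {} ?y" using rlt_bot[OF yf] by simp
  then have yi: "?y \<in> uni_interval B"
    unfolding uni_interval_def interval_def using yf R.trans[OF lt xi(3)] \<open>?y \<subseteq> uni\<close> by simp
  show "collapses (order_complex rlt {y\<in>uni_interval B. rlt y x}) {}"
  proof (rule chains_cone[of _ ?y])
    show "finite {y\<in>uni_interval B. rlt y x}" by simp
    show "?y \<in> {y\<in>uni_interval B. rlt y x}" using yi lt by simp
    show "\<forall>z\<in>{y\<in>uni_interval B. rlt y x}. comparable rlt ?y z"
    proof
      fix z assume "z \<in> {y\<in>uni_interval B. rlt y x}"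
      then have z: "z \<in> fams" "z \<subseteq> uni" "rlt z x" unfolding uni_interval_def interval_def by simp_all
      have "finer z ?y" unfolding finer_def
      proof
        fix X assume X: "X \<in> z"
        have "finer z x" using z(3) unfolding rlt_def by simp
        then obtain C where C: "C \<in> x" "X \<subseteq> C" using finerE[OF _ X] by metis
        have "X \<subseteq> core C" using core(4)[OF subsetD[OF z(2) X] C(2)] .
        then show "\<exists>Y\<in>?y. X \<subseteq> Y" using C(1) by auto
      qed
      then show "comparable rlt ?y z" using rle_iff[OF z(1) yf] unfolding comparable_def by auto
    qed
  qed
qed

end

section \<open>The intersection lattice as a poset of families\<close>

text \<open>A block stands for coordinates required to be equal, and \<open>{}\<close> for no
  equation at all. Coarser families give smaller subspaces, so refinement matches the reverse
  inclusion order of the lattice.\<close>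

definition phi :: "'n::finite set set \<Rightarrow> (real^'n) set" where
  "phi Q = (\<Inter>X\<in>Q. diag_subspace X)"

lemma phi_empty: "phi {} = UNIV"
  unfolding phi_def by simp

lemma phi_singleton: "phi {B} = diag_subspace B"
  unfolding phi_def by simp

lemma phi_mem: "u \<in> phi Q \<longleftrightarrow> (\<forall>X\<in>Q. \<forall>i\<in>X. \<forall>j\<in>X. u $ i = u $ j)"
  unfolding phi_def diag_subspace_def by auto

lemma diag_indicator:
  "(\<chi> i. if i \<in> C then 1 else (0::real)) \<in> diag_subspace X \<longleftrightarrow> X \<inter> C = {} \<or> X \<subseteq> C"
proof -
  have "(\<chi> i. if i \<in> C then 1 else (0::real)) \<in> diag_subspace X \<longleftrightarrow> (\<forall>i\<in>X. \<forall>j\<in>X. i \<in> C \<longleftrightarrow> j \<in> C)"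
    unfolding diag_subspace_def by simp blast
  also have "\<dots> \<longleftrightarrow> X \<inter> C = {} \<or> X \<subseteq> C" by blast
  finally show ?thesis .
qed

lemma diag_subspaceD: "u \<in> diag_subspace X \<Longrightarrow> i \<in> X \<Longrightarrow> j \<in> X \<Longrightarrow> u $ i = u $ j"
  unfolding diag_subspace_def by blast

lemma finer_phi: "finer P Q \<Longrightarrow> phi Q \<subseteq> phi P"
proof
  fix u assume f: "finer P Q" and u: "u \<in> phi Q"
  show "u \<in> phi P" unfolding phi_mem
  proof (intro ballI)
    fix X i j assume X: "X \<in> P" "i \<in> X" "j \<in> X"
    obtain Y where "Y \<in> Q" "X \<subseteq> Y" using finerE[OF f X(1)] by metis
    then show "u $ i = u $ j" using u X unfolding phi_mem by blast
  qed
qed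

context upset_family
begin

text \<open>The indicator of a block of \<open>Q\<close> lies in \<open>phi Q\<close>, so a block of
  \<open>P\<close> meeting that block must lie inside it. A point in no block of \<open>Q\<close> is
  tested by its own indicator, which would force its block in \<open>P\<close> to be a
  singleton.\<close>

lemma phi_finer:
  assumes P: "P \<in> fams" and Q: "Q \<in> fams" and sub: "phi Q \<subseteq> phi P"
  shows "finer P Q"
  unfolding finer_def
proof
  fix X assume X: "X \<in> P"
  have inphi: "X \<inter> C = {} \<or> X \<subseteq> C" if C: "\<And>Y. Y \<in> Q \<Longrightarrow> Y \<inter> C = {} \<or> Y \<subseteq> C" for C
  proof -
    have "(\<chi> i. if i \<in> C then 1 else (0::real)) \<in> phi Q" unfolding phi_def using C by (simp add: diag_indicator)
    then have "(\<chi> i. if i \<in> C then 1 else (0::real)) \<in> phi P" using sub by (rule subsetD[rotated])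
    then show ?thesis unfolding phi_def using X by (simp add: diag_indicator)
  qed
  obtain x where x: "x \<in> X" using famsD(2)[OF P X] by auto
  show "\<exists>Y\<in>Q. X \<subseteq> Y"
  proof (cases "\<exists>C\<in>Q. x \<in> C")
    case True
    then obtain C where C: "C \<in> Q" "x \<in> C" by auto
    have "Y \<inter> C = {} \<or> Y \<subseteq> C" if "Y \<in> Q" for Y using famsD(3)[OF Q that C(1)] by auto
    then have "X \<subseteq> C" using inphi[of C] x C by auto
    then show ?thesis using C by auto
  next
    case False
    then have "Y \<inter> {x} = {} \<or> Y \<subseteq> {x}" if "Y \<in> Q" for Y using that by auto
    then have "X \<subseteq> {x}" using inphi[of "{x}"] x by auto
    then have "card X \<le> 1" using card_mono[of "{x}" X] by simp
    then show ?thesis using two[OF famsD(1)[OF P X]] by simp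
  qed
qed

lemma phi_subset_iff: "P \<in> fams \<Longrightarrow> Q \<in> fams \<Longrightarrow> phi Q \<subseteq> phi P \<longleftrightarrow> finer P Q"
  using phi_finer[of P Q] finer_phi[of P Q] by auto

lemma phi_psubset_iff: "P \<in> fams \<Longrightarrow> Q \<in> fams \<Longrightarrow> phi Q \<subset> phi P \<longleftrightarrow> rlt P Q"
  unfolding rlt_def less_le_not_le using phi_subset_iff[of P Q] phi_subset_iff[of Q P] by simp

lemma phi_inj: "inj_on phi fams"
proof (rule inj_onI)
  fix P Q assume "P \<in> fams" "Q \<in> fams" "phi P = phi Q"
  then show "P = Q" using phi_subset_iff[of P Q] phi_subset_iff[of Q P] finer_antisym by simp
qed

lemma phi_comparable:
  assumes "P \<in> fams" "Q \<in> fams"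
  shows "comparable (\<subset>) (phi P) (phi Q) \<longleftrightarrow> comparable rlt P Q"
  unfolding comparable_def phi_psubset_iff[OF assms] phi_psubset_iff[OF assms(2,1)] inj_on_eq_iff[OF phi_inj assms]
  by (rule disj_cong[OF HOL.refl disj_commute])

end

lemma comparable_psubset: "comparable (\<subset>) X Y \<longleftrightarrow> X \<subseteq> Y \<or> Y \<subseteq> X"
  unfolding comparable_def by auto

lemma count_map_distinct:
  assumes "distinct xs"
  shows "count (mset (map f xs)) d = card {x\<in>set xs. f x = d}"
proof -
  have "count (mset (map f xs)) d = length (filter (\<lambda>x. f x = d) xs)"
    by (induction xs) auto
  also have "\<dots> = card {x\<in>set xs. f x = d}"
    using distinct_card[OF distinct_filter[OF assms, of "\<lambda>x. f x = d"]] by simp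
  finally show ?thesis .
qed

text \<open>This serves the sphere of dimension -1, where both the interval and the wedge are empty
  spaces over different types.\<close>

lemma homotopy_equivalent_empty:
  "top_of_set ({} :: 'a::topological_space set) homotopy_equivalent_space top_of_set ({} :: 'b::topological_space set)"
proof -
  have e: "homotopic_with (\<lambda>x. True) (top_of_set {}) (top_of_set {}) f g" for f g :: "'c::topological_space \<Rightarrow> 'c"
    by (rule homotopic_with_top_of_setI[where h = "\<lambda>p. f (snd p)"]) auto
  show ?thesis unfolding homotopy_equivalent_space_def
  proof (intro exI conjI)
    show "continuous_map (top_of_set {}) (top_of_set {}) (\<lambda>_ :: 'a. undefined :: 'b)" by simp
    show "continuous_map (top_of_set {}) (top_of_set {}) (\<lambda>_ :: 'b. undefined :: 'a)" by simp
  qed (rule e)+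
qed

section \<open>Complements of facets in a shelled complex, and the intersection lattice\<close>

locale shelled_complex =
  fixes \<Delta> :: "('n::finite) set set" and Fs :: "'n set list"
  assumes cx: "simplicial_complex \<Delta>"
    and dim: "\<forall>F\<in>\<Delta>. int (card F) - 1 \<le> int CARD('n) - 3"
    and sh: "shelling \<Delta> Fs"
begin

definition E :: "nat \<Rightarrow> 'n set" where
  "E i = UNIV - Fs ! i"

abbreviation q :: nat where
  "q \<equiv> length Fs"

lemma set_Fs: "set Fs = facets \<Delta>" and distinct_Fs: "distinct Fs"
  using sh unfolding shelling_def by auto

lemma Fs_facet: "i < q \<Longrightarrow> Fs ! i \<in> facets \<Delta>"
  unfolding set_Fs[symmetric] by (rule nth_mem)

lemma card_E:
  assumes "i < q"
  shows "card (E i) + card (Fs ! i) = CARD('n)" "2 \<le> card (E i)"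
proof -
  have "card (E i) = CARD('n) - card (Fs ! i)" unfolding E_def by (simp add: card_Diff_subset)
  moreover have "card (Fs ! i) \<le> CARD('n)" by (simp add: card_mono)
  ultimately show 1: "card (E i) + card (Fs ! i) = CARD('n)" by simp
  have "Fs ! i \<in> \<Delta>" using Fs_facet[OF assms] unfolding facets_def by auto
  then have "int (card (Fs ! i)) - 1 \<le> int CARD('n) - 3" using dim by auto
  then show "2 \<le> card (E i)" using 1 by linarith
qed

text \<open>The intersection of \<open>Fs ! i\<close> and \<open>Fs ! j\<close> extends to a facet
  of the intersection complex. By purity this facet is \<open>Fs ! j\<close> without one vertex
  \<open>v\<close>, it lies in an earlier \<open>Fs ! k\<close>, and \<open>v\<close> is outside
  \<open>Fs ! i\<close>.\<close>

lemma shelling_step: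
  assumes "i < j" "j < q"
  shows "\<exists>v\<in>E i. v \<notin> E j \<and> (\<exists>k<j. E k \<subseteq> insert v (E j))"
proof -
  let ?K = "{t. t \<subseteq> Fs ! j \<and> (\<exists>i<j. t \<subseteq> Fs ! i)}"
  have pure: "pure_of_dim ?K (int (card (Fs ! j)) - 2)" using sh assms unfolding shelling_def by auto
  have "Fs ! i \<inter> Fs ! j \<in> ?K" using assms(1) by auto
  then obtain G where G: "G \<in> ?K" "Fs ! i \<inter> Fs ! j \<subseteq> G" "\<forall>b\<in>?K. G \<subseteq> b \<longrightarrow> G = b"
    using finite_has_maximal2[of ?K "Fs ! i \<inter> Fs ! j"] by auto
  then have "G \<in> facets ?K" unfolding facets_def by auto
  then have "int (card G) = int (card (Fs ! j)) - 2 + 1" using pure unfolding pure_of_dim_def by auto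
  then have cG: "card (Fs ! j) = card G + 1" by linarith
  have GF: "G \<subseteq> Fs ! j" using G(1) by auto
  then have "card (Fs ! j - G) = 1" using cG by (simp add: card_Diff_subset)
  then obtain v where v: "Fs ! j - G = {v}" by (auto simp: card_1_singleton_iff)
  then have vF: "v \<in> Fs ! j" "v \<notin> G" by auto
  obtain k where k: "k < j" "G \<subseteq> Fs ! k" using G(1) by auto
  have "v \<notin> Fs ! i" using vF G(2) by auto
  moreover have "E k \<subseteq> insert v (E j)" using k(2) v unfolding E_def by auto
  ultimately show ?thesis using vF k(1) unfolding E_def by auto
qed

sublocale edge_order E q
proof
  show "i = j" if "i < q" "j < q" "E i \<subseteq> E j" for i j
  proof -
    have "Fs ! j \<subseteq> Fs ! i" using that(3) unfolding E_def by auto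
    then have "Fs ! i = Fs ! j" using Fs_facet[OF that(2)] Fs_facet[OF that(1)] unfolding facets_def by auto
    then show ?thesis using distinct_Fs that by (simp add: nth_eq_iff_index_eq)
  qed
  show "2 \<le> card (E i)" if "i < q" for i by (rule card_E(2)[OF that])
  show "\<exists>v\<in>E i. v \<notin> E j \<and> (\<exists>k<j. E k \<subseteq> insert v (E j))" if "i < j" "j < q" for i j
    by (rule shelling_step[OF that])
qed

text \<open>\<open>E k\<close> contains \<open>v\<close>, being no subset of \<open>E j\<close>, and
  it has a second point, which lies in \<open>E j\<close>. The bound on the dimension enters here:
  it gives complements at least two elements, and so connects the unions of the sets
  \<open>E i\<close>.\<close>

lemma edges_bridge:
  assumes "i < j" "j < q"
  shows "\<exists>k<q. E k \<subseteq> E i \<union> E j \<and> E k \<inter> E i \<noteq> {} \<and> E k \<inter> E j \<noteq> {}"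
proof -
  obtain v k where v: "v \<in> E i" "v \<notin> E j" "k < j" "E k \<subseteq> insert v (E j)" using shelling_step[OF assms] by auto
  have kq: "k < q" using v(3) assms(2) by simp
  have vk: "v \<in> E k"
  proof (rule ccontr)
    assume "v \<notin> E k"
    then have "E k \<subseteq> E j" using v(4) by auto
    then show False using anti[OF kq assms(2)] v(3) by simp
  qed
  have "E k \<inter> E j \<noteq> {}"
  proof
    assume "E k \<inter> E j = {}"
    then have "E k \<subseteq> {v}" using v(4) by auto
    then have "card (E k) \<le> 1" using card_mono[of "{v}" "E k"] by simp
    then show False using card_E(2)[OF kq] by simp
  qed
  moreover have "E k \<subseteq> E i \<union> E j" using v(1,4) by auto
  ultimately show ?thesis using kq vk v(1) by auto
qed

lemma edges_constant:
  assumes u: "\<And>k. k < q \<Longrightarrow> E k \<subseteq> X \<Longrightarrow> u \<in> diag_subspace (E k)"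
    and ij: "i < q" "j < q" "E i \<subseteq> X" "E j \<subseteq> X" and xy: "x \<in> E i" "y \<in> E j"
  shows "u $ x = u $ y"
proof -
  have const: "u $ x = u $ y" if "k < q" "E k \<subseteq> X" "x \<in> E k" "y \<in> E k" for k x y
    by (rule diag_subspaceD[OF u[OF that(1,2)] that(3,4)])
  have lt: "u $ x = u $ y" if ij: "i < j" "j < q" "E i \<subseteq> X" "E j \<subseteq> X" and xy: "x \<in> E i" "y \<in> E j" for i j x y
  proof -
    obtain k where k: "k < q" "E k \<subseteq> E i \<union> E j" "E k \<inter> E i \<noteq> {}" "E k \<inter> E j \<noteq> {}" using edges_bridge[OF ij(1,2)] by auto
    obtain a b where ab: "a \<in> E k" "a \<in> E i" "b \<in> E k" "b \<in> E j" using k(3,4) by auto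
    have kX: "E k \<subseteq> X" using k(2) ij(3,4) by auto
    have iq: "i < q" using ij(1,2) by simp
    show ?thesis using const[OF iq ij(3) xy(1) ab(2)] const[OF k(1) kX ab(1,3)] const[OF ij(2,4) ab(4) xy(2)] by simp
  qed
  show ?thesis
  proof (cases "i = j")
    case True
    then show ?thesis using const[OF ij(1,3) xy(1), of y] xy(2) by simp
  next
    case False
    then consider "i < j" | "j < i" by linarith
    then show ?thesis
    proof cases
      case 1
      show ?thesis by (rule lt[OF 1 ij(2,3,4) xy])
    next
      case 2
      show ?thesis by (rule lt[OF 2 ij(1,4,3) xy(2,1), symmetric])
    qed
  qed
qed

lemma arrangement_eq: "arrangement \<Delta> = (\<lambda>i. diag_subspace (E i)) ` {..<q}"
proof -
  have "facets \<Delta> = (\<lambda>i. Fs ! i) ` {..<q}" unfolding set_Fs[symmetric] by (auto simp: set_conv_nth)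
  then show ?thesis unfolding arrangement_def E_def by auto
qed

text \<open>Any two edges inside \<open>X\<close> are equal or linked by a bridging edge inside
  \<open>X\<close>. Hence the equations of the edges in \<open>X\<close> already make a vector
  constant on all of \<open>X\<close>.\<close>

lemma uni_diag:
  assumes "X \<in> uni"
  shows "diag_subspace X = \<Inter>((\<lambda>i. diag_subspace (E i)) ` {i. i < q \<and> E i \<subseteq> X})"
proof
  show "diag_subspace X \<subseteq> \<Inter>((\<lambda>i. diag_subspace (E i)) ` {i. i < q \<and> E i \<subseteq> X})"
    unfolding diag_subspace_def by blast
  show "\<Inter>((\<lambda>i. diag_subspace (E i)) ` {i. i < q \<and> E i \<subseteq> X}) \<subseteq> diag_subspace X"
  proof
    fix u assume u: "u \<in> \<Inter>((\<lambda>i. diag_subspace (E i)) ` {i. i < q \<and> E i \<subseteq> X})"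
    have u': "u \<in> diag_subspace (E k)" if "k < q" "E k \<subseteq> X" for k using u that by auto
    have "u $ x = u $ y" if xy: "x \<in> X" "y \<in> X" for x y
    proof -
      obtain i where i: "i < q" "E i \<subseteq> X" "x \<in> E i" using assms xy(1) unfolding uni_def by auto
      obtain j where j: "j < q" "E j \<subseteq> X" "y \<in> E j" using assms xy(2) unfolding uni_def by auto
      show ?thesis using edges_constant[of X u i j x y] u' i j by auto
    qed
    then show "u \<in> diag_subspace X" unfolding diag_subspace_def by (intro CollectI ballI)
  qed
qed

lemma phi_in_lattice:
  assumes "Q \<subseteq> uni"
  shows "phi Q \<in> intersection_lattice \<Delta>"
proof -
  let ?S = "(\<lambda>i. diag_subspace (E i)) ` {i. i < q \<and> (\<exists>X\<in>Q. E i \<subseteq> X)}"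
  have "phi Q = \<Inter>?S"
  proof -
    have "phi Q = (\<Inter>X\<in>Q. \<Inter>((\<lambda>i. diag_subspace (E i)) ` {i. i < q \<and> E i \<subseteq> X}))"
      unfolding phi_def by (rule INF_cong[OF HOL.refl], rule uni_diag) (use assms in auto)
    also have "\<dots> = \<Inter>?S" by auto
    finally show ?thesis .
  qed
  moreover have "?S \<subseteq> arrangement \<Delta>" unfolding arrangement_eq by auto
  ultimately show ?thesis unfolding intersection_lattice_def by blast
qed

lemma lattice_phi:
  assumes "L \<in> intersection_lattice \<Delta>"
  shows "\<exists>Q\<in>fams. Q \<subseteq> uni \<and> L = phi Q"
proof -
  obtain J where J: "J \<subseteq> {..<q}" "L = (\<Inter>i\<in>J. diag_subspace (E i))"
  proof -
    obtain S where S: "S \<subseteq> (\<lambda>i. diag_subspace (E i)) ` {..<q}" "L = \<Inter>S"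
      using assms unfolding intersection_lattice_def arrangement_eq by auto
    obtain J where "J \<subseteq> {..<q}" "S = (\<lambda>i. diag_subspace (E i)) ` J" using subset_imageE[OF S(1)] .
    then show thesis using that[of J] S(2) by simp
  qed
  \<comment> \<open>Coordinates that agree on all of \<open>L\<close> form a class; the classes with
    more than one element become the blocks.\<close>
  define cls where "cls = (\<lambda>x. {y. \<forall>u\<in>L. u $ x = u $ y})"
  define Q where "Q = {cls x | x. cls x \<noteq> {x}}"
  have self: "x \<in> cls x" for x unfolding cls_def by auto
  have cls_eq: "cls x = cls y" if "z \<in> cls x" "z \<in> cls y" for x y z
  proof -
    have "u $ x = u $ y" if "u \<in> L" for u using that \<open>z \<in> cls x\<close> \<open>z \<in> cls y\<close> unfolding cls_def by simp
    then show ?thesis unfolding cls_def by (simp cong: ball_cong)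
  qed
  have edge_cls: "E i \<subseteq> cls x" if i: "i \<in> J" "x \<in> E i" for i x
  proof
    fix y assume y: "y \<in> E i"
    have "u $ x = u $ y" if "u \<in> L" for u
    proof -
      have "u \<in> diag_subspace (E i)" using that i(1) unfolding J(2) by simp
      then show ?thesis using i(2) y by (rule diag_subspaceD)
    qed
    then show "y \<in> cls x" unfolding cls_def by simp
  qed
  \<comment> \<open>If no edge indexed by \<open>J\<close> contained \<open>y\<close>, the indicator
    of \<open>y\<close> would satisfy all equations of \<open>L\<close> and separate
    \<open>y\<close> from every other coordinate, so the class would be a singleton.\<close>
  have cover: "\<exists>i\<in>J. y \<in> E i" if y: "y \<in> cls x" and ne: "cls x \<noteq> {x}" for x y
  proof (rule ccontr)
    assume no: "\<not> (\<exists>i\<in>J. y \<in> E i)"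
    have yx: "cls y = cls x" using cls_eq[of y y x] self y by auto
    have "cls y \<noteq> {y}"
    proof
      assume "cls y = {y}"
      then have "x = y" using self[of x] yx by simp
      then show False using ne \<open>cls y = {y}\<close> by simp
    qed
    then obtain z where z: "z \<in> cls y" "z \<noteq> y" using self[of y] by auto
    let ?u = "\<chi> i. if i \<in> {y} then 1 else (0::real)"
    have "?u \<in> diag_subspace (E i)" if "i \<in> J" for i
      using no that unfolding diag_indicator by auto
    then have "?u \<in> L" unfolding J(2) by auto
    moreover have "\<forall>u\<in>L. u $ y = u $ z" using z(1) unfolding cls_def by simp
    ultimately have "?u $ y = ?u $ z" by (rule bspec[rotated])
    then show False using z(2) by simp
  qed
  have uni: "C \<in> uni" if C: "C \<in> Q" for C
  proof -
    obtain x where x: "C = cls x" "cls x \<noteq> {x}" using C unfolding Q_def by auto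
    show ?thesis unfolding uni_def
    proof (intro CollectI ballI)
      fix y assume y: "y \<in> C"
      obtain i where i: "i \<in> J" "y \<in> E i" using cover[of y x] y x by auto
      have "E i \<subseteq> C" using edge_cls[OF i] cls_eq[of y y x] self y x by auto
      then show "\<exists>i<q. E i \<subseteq> C \<and> y \<in> E i" using i J(1) by auto
    qed
  qed
  have "Q \<in> fams"
  proof (rule famsI)
    show "C \<in> N" if C: "C \<in> Q" for C
    proof -
      obtain x where x: "x \<in> C" using C self unfolding Q_def by auto
      then show ?thesis using uni[OF C] unfolding uni_def N_def by auto
    qed
    show "C = C'" if CC: "C \<in> Q" "C' \<in> Q" "z \<in> C" "z \<in> C'" for C C' z
      using CC cls_eq unfolding Q_def by auto
  qed
  moreover have "L = phi Q"
  proof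
    show "L \<subseteq> phi Q"
    proof
      fix u assume u: "u \<in> L"
      show "u \<in> phi Q" unfolding phi_mem
      proof (intro ballI)
        fix C i j assume "C \<in> Q" "i \<in> C" "j \<in> C"
        then obtain x where "i \<in> cls x" "j \<in> cls x" unfolding Q_def by auto
        then show "u $ i = u $ j" using u unfolding cls_def by auto
      qed
    qed
    show "phi Q \<subseteq> L"
    proof
      fix u assume u: "u \<in> phi Q"
      show "u \<in> L" unfolding J(2)
      proof
        fix i assume i: "i \<in> J"
        then have iq: "i < q" using J(1) by auto
        obtain x where x: "x \<in> E i" using card_E(2)[OF iq] by fastforce
        have sub: "E i \<subseteq> cls x" using edge_cls[OF i x] .
        have "cls x \<noteq> {x}"
        proof
          assume "cls x = {x}"
          then have "card (E i) \<le> 1" using sub card_mono[of "{x}" "E i"] by simp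
          then show False using card_E(2)[OF iq] by simp
        qed
        then have "cls x \<in> Q" unfolding Q_def by auto
        then have "u \<in> diag_subspace (cls x)" using u unfolding phi_def by simp
        then show "u \<in> diag_subspace (E i)" using sub unfolding diag_subspace_def by (simp add: subset_iff)
      qed
    qed
  qed
  ultimately show ?thesis using uni by blast
qed

lemma intersection_lattice_eq: "intersection_lattice \<Delta> = phi ` {Q\<in>fams. Q \<subseteq> uni}"
proof
  show "intersection_lattice \<Delta> \<subseteq> phi ` {Q\<in>fams. Q \<subseteq> uni}" using lattice_phi by blast
  show "phi ` {Q\<in>fams. Q \<subseteq> uni} \<subseteq> intersection_lattice \<Delta>" using phi_in_lattice by blast
qed

lemma open_interval_eq:
  assumes B: "B \<in> N"
  shows "open_interval \<Delta> (diag_subspace B) = phi ` uni_interval B"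
proof -
  have Bf: "{B} \<in> fams" using B singleton_fams by simp
  have iff: "(diag_subspace B \<subset> phi Q \<and> phi Q \<subset> UNIV) \<longleftrightarrow> (rlt {} Q \<and> rlt Q {B})" if "Q \<in> fams" for Q
    unfolding phi_singleton[symmetric] phi_empty[symmetric]
    using phi_psubset_iff[OF that Bf] phi_psubset_iff[OF empty_fams that] by auto
  have "{Q \<in> {Q\<in>fams. Q \<subseteq> uni}. diag_subspace B \<subset> phi Q \<and> phi Q \<subset> UNIV} = uni_interval B"
    unfolding uni_interval_def interval_def by (rule set_eqI) (simp only: mem_Collect_eq, metis iff)
  then show ?thesis unfolding open_interval_def intersection_lattice_eq Compr_image_eq by simp
qed

lemma order_complex_interval_eq:
  assumes B: "B \<in> N"
  shows "order_complex_interval \<Delta> (diag_subspace B) = (`) phi ` order_complex rlt (uni_interval B)"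
proof -
  have sub: "uni_interval B \<subseteq> fams" unfolding uni_interval_def interval_def by auto
  have "order_complex_interval \<Delta> (diag_subspace B) = order_complex (\<subset>) (phi ` uni_interval B)"
    unfolding order_complex_interval_def order_complex_def open_interval_eq[OF B] comparable_psubset ..
  also have "\<dots> = (`) phi ` order_complex rlt (uni_interval B)"
    by (rule chains_image[OF inj_on_subset[OF phi_inj sub] phi_comparable[OF subsetD[OF sub] subsetD[OF sub]]])
  finally show ?thesis .
qed

end

section \<open>Shelling-trapped decompositions\<close>

context shelled_complex
begin

lemma R_iff: "x \<in> R i \<longleftrightarrow> x \<in> Fs ! i \<and> (\<exists>k<i. Fs ! i - {x} \<subseteq> Fs ! k)"
proof -
  have 1: "E k \<subseteq> insert x (E i) \<longleftrightarrow> Fs ! i - {x} \<subseteq> Fs ! k" for k unfolding E_def by blast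
  have 2: "x \<notin> E i \<longleftrightarrow> x \<in> Fs ! i" unfolding E_def by blast
  show ?thesis unfolding R_def mem_Collect_eq 1 2 ..
qed

text \<open>Each wall of \<open>Fs ! i\<close> in the earlier subcomplex omits one vertex, and the
  omitted vertices are exactly those of \<open>R i\<close>. For the first facet \<open>R 0\<close>
  is empty.\<close>

lemma shelling_G_iff: "x \<in> shelling_G Fs i \<longleftrightarrow> x \<in> Fs ! i \<and> x \<notin> R i"
proof (cases "i = 0")
  case True
  then show ?thesis unfolding shelling_G_def R_iff by simp
next
  case False
  then show ?thesis unfolding shelling_G_def R_iff old_walls_def by auto
qed

lemma trapped_iff:
  assumes "i < q"
  shows "i \<in> trapped q \<tau> \<longleftrightarrow> shelling_G Fs i \<subseteq> UNIV - \<tau> \<and> UNIV - \<tau> \<subseteq> Fs ! i"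
proof -
  have "\<tau> \<subseteq> E i \<union> R i \<longleftrightarrow> shelling_G Fs i \<subseteq> UNIV - \<tau>"
    using shelling_G_iff[of _ i] unfolding E_def by auto
  moreover have "E i \<subseteq> \<tau> \<longleftrightarrow> UNIV - \<tau> \<subseteq> Fs ! i" unfolding E_def by auto
  ultimately show ?thesis using assms unfolding trapped_def by auto
qed

text \<open>The decompositions of the theorem carry facets, the construction carries positions in
  the shelling. Distinctness of the list makes \<open>unconv\<close> and \<open>conv\<close> inverse
  to each other.\<close>

definition unconv :: "('n set \<times> 'n set) set \<Rightarrow> ('n set \<times> nat) set" where
  "unconv D = {p. snd p < q \<and> (fst p, Fs ! snd p) \<in> D}"

definition conv :: "('n set \<times> nat) set \<Rightarrow> ('n set \<times> 'n set) set" where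
  "conv D = (\<lambda>p. (fst p, Fs ! snd p)) ` D"

lemma alldecs_snd: "D \<in> alldecs B \<Longrightarrow> p \<in> D \<Longrightarrow> snd p < q"
  unfolding alldecs_def trapped_def by blast

lemma Fs_inj: "i < q \<Longrightarrow> j < q \<Longrightarrow> Fs ! i = Fs ! j \<Longrightarrow> i = j"
  using distinct_Fs by (simp add: nth_eq_iff_index_eq)

lemma unconv_conv:
  assumes "D \<in> alldecs B"
  shows "unconv (conv D) = D"
proof
  show "unconv (conv D) \<subseteq> D"
  proof
    fix p assume "p \<in> unconv (conv D)"
    then obtain p' where p: "snd p < q" "p' \<in> D" "fst p = fst p'" "Fs ! snd p = Fs ! snd p'"
      unfolding unconv_def conv_def by auto
    then have "snd p = snd p'" using Fs_inj alldecs_snd[OF assms] by simp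
    then have "p = p'" using p(3) by (rule prod_eqI[rotated])
    then show "p \<in> D" using p(2) by simp
  qed
  show "D \<subseteq> unconv (conv D)" using alldecs_snd[OF assms] unfolding unconv_def conv_def by auto
qed

lemma conv_decomp:
  assumes D: "D \<in> alldecs B"
  shows "shelling_trapped_decomp Fs B (conv D)"
  unfolding shelling_trapped_decomp_def
proof (intro conjI ballI impI)
  have a: "fst ` D \<in> fams" "\<Union>(fst ` D) = B" "inj_on fst D" "\<And>p. p \<in> D \<Longrightarrow> snd p \<in> trapped q (fst p)"
    using D unfolding alldecs_def by simp_all
  show "finite (conv D)" by simp
  have "fst ` conv D = fst ` D" unfolding conv_def by (simp add: image_image)
  then show "\<Union>(fst ` conv D) = B" using a(2) by simp
  fix d e assume de: "d \<in> conv D" "e \<in> conv D" "d \<noteq> e"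
  then obtain p r where pr: "p \<in> D" "r \<in> D" "d = (fst p, Fs ! snd p)" "e = (fst r, Fs ! snd r)"
    unfolding conv_def by auto
  have "fst p \<noteq> fst r" using inj_onD[OF a(3), of p r] pr de(3) by auto
  then show "fst d \<inter> fst e = {}"
    using famsD(3)[OF a(1), of "fst p" "fst r"] pr by auto
next
  fix d assume "d \<in> conv D"
  then obtain p where p: "p \<in> D" "d = (fst p, Fs ! snd p)" unfolding conv_def by auto
  have "snd p \<in> trapped q (fst p)" using D p(1) unfolding alldecs_def by simp
  then have "shelling_G Fs (snd p) \<subseteq> UNIV - fst p \<and> UNIV - fst p \<subseteq> Fs ! snd p"
    using trapped_iff[OF alldecs_snd[OF D p(1)]] by simp
  then show "case d of (\<tau>bar, F) \<Rightarrow> \<exists>i<q. Fs ! i = F \<and> shelling_G Fs i \<subseteq> UNIV - \<tau>bar \<and> UNIV - \<tau>bar \<subseteq> F"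
    using alldecs_snd[OF D p(1)] unfolding p(2) by auto
qed

lemma unconv_decomp:
  assumes D: "shelling_trapped_decomp Fs B D"
  shows "unconv D \<in> alldecs B" "conv (unconv D) = D"
proof -
  have D1: "\<Union>(fst ` D) = B" using D unfolding shelling_trapped_decomp_def by simp
  have D2: "fst d \<inter> fst e = {}" if "d \<in> D" "e \<in> D" "d \<noteq> e" for d e
  proof -
    have "\<forall>a\<in>D. \<forall>b\<in>D. a \<noteq> b \<longrightarrow> fst a \<inter> fst b = {}" using D unfolding shelling_trapped_decomp_def by simp
    then show ?thesis using that by blast
  qed
  have D3: "\<exists>i<q. Fs ! i = snd d \<and> i \<in> trapped q (fst d)" if d: "d \<in> D" for d
  proof -
    have "case d of (\<tau>bar, F) \<Rightarrow> \<exists>i<q. Fs ! i = F \<and> shelling_G Fs i \<subseteq> UNIV - \<tau>bar \<and> UNIV - \<tau>bar \<subseteq> F"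
      using D d unfolding shelling_trapped_decomp_def by simp
    then obtain i where i: "i < q" "Fs ! i = snd d" "shelling_G Fs i \<subseteq> UNIV - fst d" "UNIV - fst d \<subseteq> snd d"
      by (cases d) auto
    then show ?thesis using trapped_iff[OF i(1), of "fst d"] by auto
  qed
  have tr: "snd p \<in> trapped q (fst p)" if p: "p \<in> unconv D" for p
  proof -
    have pD: "snd p < q" "(fst p, Fs ! snd p) \<in> D" using p unfolding unconv_def by simp_all
    obtain i where i: "i < q" "Fs ! i = Fs ! snd p" "i \<in> trapped q (fst p)" using D3[OF pD(2)] by auto
    then show ?thesis using Fs_inj[OF i(1) pD(1) i(2)] by simp
  qed
  show cb: "conv (unconv D) = D"
  proof
    show "conv (unconv D) \<subseteq> D" unfolding conv_def unconv_def by auto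
    show "D \<subseteq> conv (unconv D)"
    proof
      fix d assume d: "d \<in> D"
      obtain i where i: "i < q" "Fs ! i = snd d" using D3[OF d] by auto
      then have "(fst d, i) \<in> unconv D" using d unfolding unconv_def by simp
      then have "(fst d, Fs ! i) \<in> conv (unconv D)" unfolding conv_def by force
      then show "d \<in> conv (unconv D)" using i(2) by simp
    qed
  qed
  have fs: "fst ` unconv D = fst ` D"
  proof -
    have "fst ` conv (unconv D) = fst ` unconv D" unfolding conv_def by (simp add: image_image)
    then show ?thesis unfolding cb by simp
  qed
  have inN: "fst d \<in> N" if "d \<in> D" for d
    using D3[OF that] unfolding trapped_def N_def by auto
  have same: "d = e" if de: "d \<in> D" "e \<in> D" "x \<in> fst d" "x \<in> fst e" for d e x
    using D2[OF de(1,2)] de(3,4) by auto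
  have "fst ` D \<in> fams"
  proof (rule famsI)
    show "X \<in> N" if "X \<in> fst ` D" for X using that inN by auto
    show "X = Y" if "X \<in> fst ` D" "Y \<in> fst ` D" "x \<in> X" "x \<in> Y" for X Y x using that same by blast
  qed
  moreover have "inj_on fst (unconv D)"
  proof (rule inj_onI)
    fix p r assume pr: "p \<in> unconv D" "r \<in> unconv D" "fst p = fst r"
    have pD: "snd p < q" "(fst p, Fs ! snd p) \<in> D" "snd r < q" "(fst r, Fs ! snd r) \<in> D"
      using pr unfolding unconv_def by simp_all
    obtain x where "x \<in> fst p" using N_nonempty[OF inN[OF pD(2)]] by auto
    then have "(fst p, Fs ! snd p) = (fst r, Fs ! snd r)" using same[OF pD(2,4), of x] pr(3) by simp
    then have "snd p = snd r" using Fs_inj[OF pD(1,3)] by simp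
    then show "p = r" using pr(3) by (rule prod_eqI[rotated])
  qed
  ultimately show "unconv D \<in> alldecs B" unfolding alldecs_def using fs D1 tr by simp
qed

text \<open>With n the number of coordinates, \<open>card (E i) = n - card (Fs ! i)\<close>. So the
  covering steps of the p blocks add up to \<open>card B\<close> plus the facet sizes plus p times 1
  - n, and adding p gives the coefficient 2 - n. Of the 3, two account for the size of the chain
  interior and one for passing from its size to its dimension.\<close>

lemma decomp_card:
  assumes D: "D \<in> alldecs B"
  shows "card (conv D) = card (fst ` D)"
    "decomp_dim (conv D) B + 3 = int (dec_size D + card (fst ` D))"
proof -
  have a: "fst ` D \<in> fams" "\<Union>(fst ` D) = B" "inj_on fst D" "\<And>p. p \<in> D \<Longrightarrow> snd p \<in> trapped q (fst p)"
    using D unfolding alldecs_def by simp_all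
  have fin: "finite D" using decs_finite[OF alldecs_decs[OF D]] .
  have inj: "inj_on (\<lambda>p. (fst p, Fs ! snd p)) D"
    using a(3) unfolding inj_on_def by auto
  have cD: "card (conv D) = card D" unfolding conv_def by (rule card_image[OF inj])
  have cf: "card (fst ` D) = card D" by (rule card_image[OF a(3)])
  show "card (conv D) = card (fst ` D)" using cD cf by simp
  have s1: "(\<Sum>d\<in>conv D. int (card (snd d))) = (\<Sum>p\<in>D. int CARD('n) - int (card (E (snd p))))"
  proof -
    have "(\<Sum>d\<in>conv D. int (card (snd d))) = (\<Sum>p\<in>D. int (card (Fs ! snd p)))"
      unfolding conv_def by (simp add: sum.reindex[OF inj])
    also have "\<dots> = (\<Sum>p\<in>D. int CARD('n) - int (card (E (snd p))))"
    proof (rule sum.cong[OF HOL.refl])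
      fix p assume "p \<in> D"
      then show "int (card (Fs ! snd p)) = int CARD('n) - int (card (E (snd p)))"
        using card_E(1)[OF alldecs_snd[OF D]] by (metis add_diff_cancel_left' of_nat_add)
    qed
    finally show ?thesis .
  qed
  have "card B = (\<Sum>X\<in>fst ` D. card X)"
    unfolding a(2)[symmetric] using a(1) unfolding fams_def by (intro card_Union_disjoint) (auto simp: disjoint_def pairwise_def disjnt_def)
  then have s2: "int (card B) = (\<Sum>p\<in>D. int (card (fst p)))" by (simp add: sum.reindex[OF a(3)])
  have "int (dec_size D) = (\<Sum>p\<in>D. int (card (fst p)) - int (card (E (snd p))) + 1)"
    unfolding dec_size_def of_nat_sum
  proof (rule sum.cong[OF HOL.refl])
    fix p assume "p \<in> D"
    then have "E (snd p) \<subseteq> fst p" using a(4) unfolding trapped_def by simp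
    then have "card (E (snd p)) \<le> card (fst p)" by (simp add: card_mono)
    then show "int (card (fst p) - card (E (snd p)) + 1) = int (card (fst p)) - int (card (E (snd p))) + 1"
      by (simp add: of_nat_diff)
  qed
  then show "decomp_dim (conv D) B + 3 = int (dec_size D + card (fst ` D))"
    unfolding decomp_dim_def s1 s2 cD cf by (simp add: sum.distrib sum_subtractf algebra_simps)
qed

text \<open>The subspace equals \<open>phi Q\<close> for some nonempty \<open>Q\<close>. Indicator
  vectors show that a block of \<open>Q\<close> lies inside or outside \<open>B\<close> as a whole,
  and outside it could be split into points. So \<open>B\<close> contains an admissible
  block.\<close>

lemma block_in_N:
  assumes inL: "diag_subspace B \<in> intersection_lattice \<Delta>" and nonbot: "diag_subspace B \<noteq> UNIV"
  shows "B \<in> N"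
proof -
  obtain Q where Q: "Q \<in> fams" "diag_subspace B = phi Q" using lattice_phi[OF inL] by auto
  have "Q \<noteq> {}" using Q(2) nonbot phi_empty by metis
  then obtain C where C: "C \<in> Q" by auto
  have sub: "diag_subspace B \<subseteq> diag_subspace C" unfolding Q(2) phi_def using C by auto
  have ind: "C \<inter> Z = {} \<or> C \<subseteq> Z" if "B \<inter> Z = {} \<or> B \<subseteq> Z" for Z
    using subsetD[OF sub, of "\<chi> i. if i \<in> Z then 1 else 0"] that unfolding diag_indicator by simp
  have "C \<subseteq> B"
  proof (rule ccontr)
    assume n: "\<not> C \<subseteq> B"
    then have CB: "C \<inter> B = {}" using ind[of B] by auto
    obtain x where x: "x \<in> C" using famsD(2)[OF Q(1) C] by auto
    then have "C \<subseteq> {x}" using ind[of "{x}"] CB by auto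
    then have "card C \<le> 1" using card_mono[of "{x}" C] by simp
    then show False using two[OF famsD(1)[OF Q(1) C]] by simp
  qed
  then show ?thesis using up[OF famsD(1)[OF Q(1) C]] by simp
qed

text \<open>Permutations enter only through their number, so an arbitrary bijection with the upper
  chains serves.\<close>

definition perm_chain :: "('n set \<times> 'n set) set \<Rightarrow> (nat \<Rightarrow> nat) \<Rightarrow> 'n set set set" where
  "perm_chain D = (SOME h. bij_betw h {w. w permutes {1..card D - 1}} (upper (fst ` unconv D)))"

lemma perm_chain:
  assumes "shelling_trapped_decomp Fs B D"
  shows "bij_betw (perm_chain D) {w. w permutes {1..card D - 1}} (upper (fst ` unconv D))"
proof -
  note b = unconv_decomp[OF assms]
  have "fst ` unconv D \<in> fams" using b(1) unfolding alldecs_def by simp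
  then have "card (upper (fst ` unconv D)) = fact (card D - 1)"
    using upper_card decomp_card(1)[OF b(1)] b(2) by simp
  moreover have "card {w. w permutes {1..card D - 1}} = fact (card D - 1)" by (rule card_permutations) auto
  ultimately have "\<exists>h. bij_betw h {w. w permutes {1..card D - 1}} (upper (fst ` unconv D))"
    by (intro finite_same_card_bij) (auto intro: finite_permutations)
  then show ?thesis unfolding perm_chain_def by (rule someI_ex)
qed

definition pairs :: "'n set \<Rightarrow> (('n set \<times> 'n set) set \<times> (nat \<Rightarrow> nat)) set" where
  "pairs B = {(D, w). shelling_trapped_decomp Fs B D \<and> w permutes {1..card D - 1}}"

lemma pairs_bij: "bij_betw (\<lambda>(D, w). (unconv D, perm_chain D w)) (pairs B) (index B)"
  unfolding bij_betw_def
proof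
  show "inj_on (\<lambda>(D, w). (unconv D, perm_chain D w)) (pairs B)"
  proof (rule inj_onI)
    fix x y assume xy: "x \<in> pairs B" "y \<in> pairs B"
      "(\<lambda>(D, w). (unconv D, perm_chain D w)) x = (\<lambda>(D, w). (unconv D, perm_chain D w)) y"
    obtain D w D' w' where xD: "x = (D, w)" "y = (D', w')" by (cases x, cases y) blast
    have p: "(D, w) \<in> pairs B" "(D', w') \<in> pairs B"
      and eq: "unconv D = unconv D'" "perm_chain D w = perm_chain D' w'" using xy unfolding xD by simp_all
    have d: "shelling_trapped_decomp Fs B D" "shelling_trapped_decomp Fs B D'" using p unfolding pairs_def by simp_all
    have DD: "D = D'" by (rule trans[OF sym[OF unconv_decomp(2)[OF d(1)]] trans[OF arg_cong[OF eq(1), of conv] unconv_decomp(2)[OF d(2)]]])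
    moreover have "w = w'"
    proof (rule inj_onD[OF bij_betw_imp_inj_on[OF perm_chain[OF d(1)]]])
      show "perm_chain D w = perm_chain D w'" using eq(2) DD by simp
      show "w \<in> {w. w permutes {1..card D - 1}}" "w' \<in> {w. w permutes {1..card D - 1}}"
        using p DD unfolding pairs_def by simp_all
    qed
    ultimately show "x = y" unfolding xD by simp
  qed
  show "(\<lambda>(D, w). (unconv D, perm_chain D w)) ` pairs B = index B"
  proof
    show "(\<lambda>(D, w). (unconv D, perm_chain D w)) ` pairs B \<subseteq> index B"
    proof (rule image_subsetI, clarify)
      fix D w assume "(D, w) \<in> pairs B"
      then have d: "shelling_trapped_decomp Fs B D" "w permutes {1..card D - 1}" unfolding pairs_def by simp_all
      have "perm_chain D w \<in> upper (fst ` unconv D)" using bij_betwE[OF perm_chain[OF d(1)]] d(2) by simp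
      then show "(unconv D, perm_chain D w) \<in> index B" unfolding index_def using unconv_decomp(1)[OF d(1)] by simp
    qed
    show "index B \<subseteq> (\<lambda>(D, w). (unconv D, perm_chain D w)) ` pairs B"
    proof clarify
      fix D t assume "(D, t) \<in> index B"
      then have D: "D \<in> alldecs B" "t \<in> upper (fst ` D)" unfolding index_def by auto
      note c = conv_decomp[OF D(1)]
      have "t \<in> perm_chain (conv D) ` {w. w permutes {1..card (conv D) - 1}}"
        using bij_betw_imp_surj_on[OF perm_chain[OF c]] D(2) unconv_conv[OF D(1)] by simp
      then obtain w where w: "w permutes {1..card (conv D) - 1}" "t = perm_chain (conv D) w" by auto
      have "(conv D, w) \<in> pairs B" unfolding pairs_def using c w(1) by simp
      then show "(D, t) \<in> (\<lambda>(D, w). (unconv D, perm_chain D w)) ` pairs B"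
        by (rule rev_image_eqI) (simp add: w(2) unconv_conv[OF D(1)])
    qed
  qed
qed

definition int_chain :: "'n set \<Rightarrow> ('n set \<times> 'n set) set \<Rightarrow> (nat \<Rightarrow> nat) \<Rightarrow> 'n set set set" where
  "int_chain B D w = full_chain B (unconv D) (perm_chain D w)"

definition sat_chain :: "'n set \<Rightarrow> ('n set \<times> 'n set) set \<Rightarrow> (nat \<Rightarrow> nat) \<Rightarrow> (real^'n) set set" where
  "sat_chain B D w = insert UNIV (insert (diag_subspace B) (phi ` int_chain B D w))"

lemma int_chain_image:
  "(\<lambda>(D, w). int_chain B D w) ` pairs B = (\<lambda>(D, t). full_chain B D t) ` index B"
proof -
  have "(\<lambda>(D, w). int_chain B D w) ` pairs B = (\<lambda>(D, t). full_chain B D t) ` (\<lambda>(D, w). (unconv D, perm_chain D w)) ` pairs B"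
    unfolding image_image int_chain_def by (rule image_cong) auto
  then show ?thesis using bij_betw_imp_surj_on[OF pairs_bij] by simp
qed

lemma int_chain_inj:
  assumes "B \<in> N"
  shows "inj_on (\<lambda>(D, w). int_chain B D w) (pairs B)"
proof -
  have "inj_on ((\<lambda>(D, t). full_chain B D t) \<circ> (\<lambda>(D, w). (unconv D, perm_chain D w))) (pairs B)"
    using full_chain_inj[OF assms] bij_betw_imp_surj_on[OF pairs_bij] bij_betw_imp_inj_on[OF pairs_bij]
    by (intro comp_inj_on) simp_all
  moreover have "(\<lambda>(D, t). full_chain B D t) \<circ> (\<lambda>(D, w). (unconv D, perm_chain D w)) = (\<lambda>(D, w). int_chain B D w)"
    by (auto simp: int_chain_def)
  ultimately show ?thesis by simp
qed

lemma int_chain_props: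
  assumes B: "B \<in> N" and p: "(D, w) \<in> pairs B"
  shows "max_chain rlt (interval B) (int_chain B D w)" "int_chain B D w \<subseteq> uni_interval B"
    "int (card (int_chain B D w)) = decomp_dim D B + 1"
proof -
  have ix: "(unconv D, perm_chain D w) \<in> index B" using bij_betwE[OF pairs_bij, of B] p by auto
  note f = full_chain_sat[OF B ix]
  have d: "shelling_trapped_decomp Fs B D" using p unfolding pairs_def by simp
  show m: "max_chain rlt (interval B) (int_chain B D w)"
    using f(1) unfolding R.sat_def interval_def int_chain_def by simp
  have "int_chain B D w \<in> order_complex rlt (interval B)" using m unfolding max_chain_def by simp
  then have "int_chain B D w \<subseteq> interval B" by (rule chainsD(1))
  then show "int_chain B D w \<subseteq> uni_interval B" using f(3) unfolding uni_interval_def int_chain_def by blast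
  have "decomp_dim D B + 3 = int (dec_size (unconv D) + card (fst ` unconv D))"
    using decomp_card(2)[OF unconv_decomp(1)[OF d]] unconv_decomp(2)[OF d] by simp
  then show "int (card (int_chain B D w)) = decomp_dim D B + 1"
    using f(2) unfolding int_chain_def by linarith
qed

lemma uni_interval_fams: "uni_interval B \<subseteq> fams"
  unfolding uni_interval_def interval_def by auto

lemma phi_uni_inj: "inj_on phi (uni_interval B)"
  by (rule inj_on_subset[OF phi_inj uni_interval_fams])

lemma phi_uni_proper:
  assumes B: "B \<in> N" and Q: "Q \<in> uni_interval B"
  shows "phi Q \<noteq> UNIV" "phi Q \<noteq> diag_subspace B" "diag_subspace B \<subseteq> phi Q" "phi Q \<in> intersection_lattice \<Delta>"
proof -
  have "phi Q \<in> open_interval \<Delta> (diag_subspace B)" unfolding open_interval_eq[OF B] using Q by simp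
  then show "phi Q \<noteq> UNIV" "phi Q \<noteq> diag_subspace B" "diag_subspace B \<subseteq> phi Q" "phi Q \<in> intersection_lattice \<Delta>"
    unfolding open_interval_def by auto
qed

lemma sat_chain_interior:
  assumes B: "B \<in> N" and p: "(D, w) \<in> pairs B"
  shows "sat_chain B D w - {UNIV, diag_subspace B} = phi ` int_chain B D w"
  using phi_uni_proper(1,2)[OF B subsetD[OF int_chain_props(2)[OF B p]]] unfolding sat_chain_def by auto

text \<open>A lattice element above the subspace and comparable with the whole chain is an end point
  or the image of a family in the interval. In the latter case the maximality of the interior chain
  puts it into the chain.\<close>

lemma sat_chain_saturated:
  assumes B: "B \<in> N" and inL: "diag_subspace B \<in> intersection_lattice \<Delta>" and p: "(D, w) \<in> pairs B"
  shows "saturated_chain \<Delta> (diag_subspace B) (sat_chain B D w)"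
proof -
  note c = int_chain_props[OF B p]
  have q: "phi Q \<in> intersection_lattice \<Delta>" "diag_subspace B \<subseteq> phi Q" if "Q \<in> int_chain B D w" for Q
    using phi_uni_proper(3,4)[OF B subsetD[OF c(2) that]] by simp_all
  have top: "UNIV \<in> intersection_lattice \<Delta>" proof -
    have "phi {} = (UNIV :: (real^'n) set)" by (rule phi_empty)
    then show ?thesis using phi_in_lattice[of "{}"] by simp
  qed
  have oc: "int_chain B D w \<in> order_complex rlt (interval B)" using c(1) unfolding max_chain_def by simp
  have fam: "Q \<in> fams" if "Q \<in> int_chain B D w" for Q using subsetD[OF uni_interval_fams subsetD[OF c(2) that]] .
  have comp: "phi P \<subseteq> phi Q \<or> phi Q \<subseteq> phi P" if PQ: "P \<in> int_chain B D w" "Q \<in> int_chain B D w" for P Q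
    using phi_comparable[OF fam[OF PQ(1)] fam[OF PQ(2)]] chainsD(3)[OF oc PQ] unfolding comparable_psubset by simp
  show ?thesis unfolding saturated_chain_def
  proof (intro conjI)
    show "sat_chain B D w \<subseteq> intersection_lattice \<Delta>" unfolding sat_chain_def using q(1) top inL by auto
    show "UNIV \<in> sat_chain B D w" "diag_subspace B \<in> sat_chain B D w" unfolding sat_chain_def by simp_all
    show "\<forall>X\<in>sat_chain B D w. diag_subspace B \<subseteq> X" unfolding sat_chain_def using q(2) by auto
    show "\<forall>X\<in>sat_chain B D w. \<forall>Y\<in>sat_chain B D w. X \<subseteq> Y \<or> Y \<subseteq> X"
    proof (intro ballI)
      fix X Y assume "X \<in> sat_chain B D w" "Y \<in> sat_chain B D w"
      then consider "X = UNIV \<or> Y = UNIV" | "X = diag_subspace B" "Y \<in> phi ` int_chain B D w"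
        | "Y = diag_subspace B" "X \<in> phi ` int_chain B D w" | "X = Y"
        | P Q where "P \<in> int_chain B D w" "Q \<in> int_chain B D w" "X = phi P" "Y = phi Q"
        unfolding sat_chain_def by blast
      then show "X \<subseteq> Y \<or> Y \<subseteq> X" by cases (use q(2) comp in auto)
    qed
    show "\<forall>X\<in>intersection_lattice \<Delta>. diag_subspace B \<subseteq> X \<and> (\<forall>Y\<in>sat_chain B D w. X \<subseteq> Y \<or> Y \<subseteq> X) \<longrightarrow> X \<in> sat_chain B D w"
    proof (intro ballI impI)
      fix X assume X: "X \<in> intersection_lattice \<Delta>" "diag_subspace B \<subseteq> X \<and> (\<forall>Y\<in>sat_chain B D w. X \<subseteq> Y \<or> Y \<subseteq> X)"
      show "X \<in> sat_chain B D w"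
      proof (cases "X = UNIV \<or> X = diag_subspace B")
        case True
        then show ?thesis unfolding sat_chain_def by auto
      next
        case False
        then have "X \<in> open_interval \<Delta> (diag_subspace B)" unfolding open_interval_def using X by auto
        then obtain Q where Q: "Q \<in> uni_interval B" "X = phi Q" unfolding open_interval_eq[OF B] by auto
        have Qf: "Q \<in> fams" using subsetD[OF uni_interval_fams Q(1)] .
        have "comparable rlt Q P" if P: "P \<in> int_chain B D w" for P
        proof -
          have "phi P \<in> sat_chain B D w" unfolding sat_chain_def using P by simp
          then have "X \<subseteq> phi P \<or> phi P \<subseteq> X" using X(2) by simp
          then show ?thesis using phi_comparable[OF Qf fam[OF P]] Q(2) unfolding comparable_psubset by simp
        qed
        moreover have "Q \<in> interval B" using Q(1) unfolding uni_interval_def by simp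
        ultimately have "Q \<in> int_chain B D w" using c(1) unfolding max_chain_def by simp
        then show ?thesis unfolding sat_chain_def using Q(2) by simp
      qed
    qed
  qed
qed

end

text \<open>These two complexes occur when the open interval is empty: \<open>{{}}\<close> before
  and \<open>{}\<close> after the empty simplex is removed.\<close>

lemma points_void: "points ({} :: 'v set set) = {}" "points ({{}} :: 'v set set) = {}"
proof -
  show "points ({} :: 'v set set) = {}" unfolding points_def by simp
  have s: "sum f {v. f v \<noteq> 0} \<noteq> 1" if "{v. f v \<noteq> 0} \<in> {{}}" for f :: "'v \<Rightarrow> real"
    using that by (simp only: singleton_iff sum.empty zero_neq_one not_False_eq_True)
  show "points ({{}} :: 'v set set) = {}"
  proof (rule equals0I)
    fix f :: "'v \<Rightarrow> real" assume "f \<in> points {{}}"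
    then have "{v. f v \<noteq> 0} \<in> {{}} \<and> sum f {v. f v \<noteq> 0} = 1" unfolding points_def mem_Collect_eq by (rule conjunct2)
    then show False by (elim conjE) (rule notE[OF s])
  qed
qed

section \<open>Contractibility of the residual complex and the final count\<close>

context shelled_complex
begin

definition removed :: "'n set \<Rightarrow> 'n set set set set" where
  "removed B = (\<lambda>(D, w). int_chain B D w) ` pairs B"

lemma removed_max:
  assumes "B \<in> N" "c \<in> removed B"
  shows "max_chain rlt (interval B) c" "c \<subseteq> uni_interval B" "max_chain rlt (uni_interval B) c"
proof -
  obtain D w where "(D, w) \<in> pairs B" "c = int_chain B D w" using assms(2) unfolding removed_def by auto
  then show m: "max_chain rlt (interval B) c" "c \<subseteq> uni_interval B"
    using int_chain_props[OF assms(1)] by simp_all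
  show "max_chain rlt (uni_interval B) c"
    by (rule max_chain_subset[OF m]) (simp add: uni_interval_def)
qed

lemma image_chains:
  assumes "X \<subseteq> fams"
  shows "order_complex (\<subset>) (phi ` X) = (`) phi ` order_complex rlt X"
  by (rule chains_image[OF inj_on_subset[OF phi_inj assms]]) (rule phi_comparable; use assms in blast)

lemma image_chains_diff:
  assumes X: "X \<subseteq> fams" and S: "S \<subseteq> order_complex rlt X"
  shows "(`) phi ` (order_complex rlt X - S) = order_complex (\<subset>) (phi ` X) - (`) phi ` S"
  unfolding image_chains[OF X]
proof (rule inj_on_image_set_diff[OF inj_on_image_Pow[OF inj_on_subset[OF phi_inj X]]])
  have "order_complex rlt X \<subseteq> Pow X" using chainsD(1) by blast
  then show "order_complex rlt X - S \<subseteq> Pow X" "S \<subseteq> Pow X" using S by blast+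
qed

lemma interval_complex:
  assumes "B \<in> N"
  shows "order_complex_interval \<Delta> (diag_subspace B) = order_complex (\<subset>) (phi ` uni_interval B)"
  unfolding image_chains[OF uni_interval_fams] by (rule order_complex_interval_eq[OF assms])

lemma removed_facets:
  assumes B: "B \<in> N"
  shows "(`) phi ` removed B \<subseteq> facets (order_complex_interval \<Delta> (diag_subspace B))"
  unfolding interval_complex[OF B]
proof (rule image_subsetI)
  fix c assume c: "c \<in> removed B"
  have "max_chain (\<subset>) (phi ` uni_interval B) (phi ` c) \<longleftrightarrow> max_chain rlt (uni_interval B) c"
    by (rule max_chain_image[OF phi_uni_inj _ removed_max(2)[OF B c]])
      (rule phi_comparable; use uni_interval_fams in blast)
  then show "phi ` c \<in> facets (order_complex (\<subset>) (phi ` uni_interval B))"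
    using removed_max(3)[OF B c] by (intro max_chain_facet) simp
qed

text \<open>In the enlarged interval the residue collapses to nothing and is contractible; it also
  collapses onto the residue in the lattice. As \<open>{}\<close> is not removed, the empty face
  survives the second collapse, which is therefore a homotopy equivalence.\<close>

lemma residue_contractible:
  assumes B: "B \<in> N" and ne: "{} \<notin> removed B"
  shows "contractible_space (geom_realization (order_complex_interval \<Delta> (diag_subspace B) - (`) phi ` removed B))"
    "points (order_complex_interval \<Delta> (diag_subspace B) - (`) phi ` removed B) \<noteq> {}"
proof -
  let ?S = "removed B" and ?I = "interval B" and ?U = "uni_interval B"
  let ?K = "order_complex (\<subset>) (phi ` ?I) - (`) phi ` ?S" and ?L = "order_complex (\<subset>) (phi ` ?U) - (`) phi ` ?S"
  have If: "?I \<subseteq> fams" unfolding interval_def by blast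
  have g: "good rlt ?I ?S" using interval_good[OF B] unfolding removed_def int_chain_image .
  have "good (\<subset>) (phi ` ?I) ((`) phi ` ?S)"
    by (rule good_image[OF inj_on_subset[OF phi_inj If] _ g]) (rule phi_comparable; use If in blast)
  note g' = goodD[OF this]
  have cK: "simplicial_complex ?K"
    by (rule simplicial_complex_diff_facets[OF simplicial_complex_chains g'(4)])
  have SI: "?S \<subseteq> order_complex rlt ?I" "?S \<subseteq> order_complex rlt ?U"
    using removed_max(1,3)[OF B] unfolding max_chain_def by blast+
  have "\<Union>(order_complex rlt ?I - ?S) \<subseteq> fams" using If chainsD(1)[of _ rlt ?I] by blast
  note inj = inj_on_subset[OF phi_inj this]
  have c0: "collapses (order_complex rlt ?I - ?S) (order_complex rlt ?U - ?S)"
    by (rule interval_collapses_uni[OF B]) (use removed_max(1,2)[OF B] in blast)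
  have col: "collapses ?K ?L"
    using collapses_image[OF c0 inj] unfolding image_chains_diff[OF If SI(1)] image_chains_diff[OF uni_interval_fams SI(2)] .
  have e: "{} \<in> order_complex (\<subset>) X" for X :: "(real^'n) set set" unfolding order_complex_def by simp
  have ni: "{} \<notin> (`) phi ` ?S" using ne by auto
  have eK: "?K \<noteq> {}" and eL: "{} \<in> ?L" using e ni by blast+
  note c = contractible_collapses_void[OF g'(5) HOL.refl cK eK]
  note h = homotopy_equivalent_collapses[OF col cK eL]
  show "contractible_space (geom_realization (order_complex_interval \<Delta> (diag_subspace B) - (`) phi ` ?S))"
    unfolding interval_complex[OF B] using homotopy_equivalent_space_contractibility[OF h] c by blast
  obtain f where "continuous_map (geom_realization ?K) (geom_realization ?L) f"
    using h unfolding homotopy_equivalent_space_def by blast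
  then have "f ` points ?K \<subseteq> points ?L" unfolding geom_realization_points by (simp add: continuous_map_in_subtopology image_subset_iff_funcset)
  then show "points (order_complex_interval \<Delta> (diag_subspace B) - (`) phi ` ?S) \<noteq> {}"
    unfolding interval_complex[OF B] using c by blast
qed

text \<open>The empty chain is maximal only in an empty poset.\<close>

lemma residue_void:
  assumes B: "B \<in> N" and e: "{} \<in> removed B"
  shows "order_complex_interval \<Delta> (diag_subspace B) = {{}}" "removed B = {{}}"
proof -
  have "interval B = {}" using removed_max(1)[OF B e] unfolding max_chain_def by blast
  then have u: "uni_interval B = {}" unfolding uni_interval_def by simp
  show "order_complex_interval \<Delta> (diag_subspace B) = {{}}" unfolding interval_complex[OF B] u by simp
  show "removed B = {{}}" using removed_max(2)[OF B] u e by blast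
qed

lemma residue_contractible':
  assumes B: "B \<in> N"
  shows "contractible_space (geom_realization (order_complex_interval \<Delta> (diag_subspace B) - (`) phi ` removed B))"
proof (cases "{} \<in> removed B")
  case True
  \<comment> \<open>Removing the empty simplex leaves the void complex; its realization is the empty
    space, which satisfies \<open>contractible_space\<close>.\<close>
  have e: "order_complex_interval \<Delta> (diag_subspace B) - (`) phi ` removed B = {}"
    unfolding residue_void[OF B True] by simp
  show ?thesis unfolding e geom_realization_points points_void by simp
next
  case False
  then show ?thesis by (rule residue_contractible(1)[OF B])
qed

lemma interval_wedge:
  assumes B: "B \<in> N" and ss: "distinct ss" "set ss = (`) phi ` removed B"
  shows "geom_realization (order_complex_interval \<Delta> (diag_subspace B))
    homotopy_equivalent_space wedge_of_spheres (map (\<lambda>s. int (card s) - 1) ss)"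
proof (cases "{} \<in> removed B")
  case True
  have "set ss = {{}}" using ss(2) unfolding residue_void[OF B True] by simp
  then have "ss = [{}]" using ss(1) by (cases ss) (auto simp: subset_singleton_iff)
  \<comment> \<open>The only removed simplex is the empty one, of dimension -1, and the
    corresponding wedge is empty like the realization of the interval.\<close>
  moreover have "wedge_of_spheres [-1] = top_of_set {}"
    unfolding wedge_of_spheres_def wedge_sphere_def by simp
  ultimately show ?thesis
    unfolding residue_void(1)[OF B True] geom_realization_points points_void
    using homotopy_equivalent_empty by simp
next
  case False
  interpret cells_attached_list "order_complex_interval \<Delta> (diag_subspace B)" "(`) phi ` removed B" ss
  proof
    show "finite (order_complex_interval \<Delta> (diag_subspace B))"
      unfolding interval_complex[OF B] by (rule finite_chains) simp
    show "simplicial_complex (order_complex_interval \<Delta> (diag_subspace B))"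
      unfolding interval_complex[OF B] by (rule simplicial_complex_chains)
    show "(`) phi ` removed B \<subseteq> facets (order_complex_interval \<Delta> (diag_subspace B))" by (rule removed_facets[OF B])
    show "{} \<notin> (`) phi ` removed B" using False by auto
  qed (rule ss)+
  show ?thesis by (rule homotopy_equivalent_wedge[OF residue_contractible[OF B False]])
qed

lemma sat_chain_interiors:
  assumes B: "B \<in> N"
  shows "{sat_chain B D w - {UNIV, diag_subspace B} | D w.
    shelling_trapped_decomp Fs B D \<and> w permutes {1..card D - 1}} = (`) phi ` removed B"
proof -
  have "{sat_chain B D w - {UNIV, diag_subspace B} | D w. shelling_trapped_decomp Fs B D \<and> w permutes {1..card D - 1}}
    = (\<lambda>(D, w). sat_chain B D w - {UNIV, diag_subspace B}) ` pairs B"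
    unfolding pairs_def by (auto simp: image_iff)
  also have "\<dots> = (\<lambda>(D, w). phi ` int_chain B D w) ` pairs B"
  proof (rule image_cong[OF HOL.refl])
    fix p assume "p \<in> pairs B"
    then show "(\<lambda>(D, w). sat_chain B D w - {UNIV, diag_subspace B}) p = (\<lambda>(D, w). phi ` int_chain B D w) p"
      using sat_chain_interior[OF B, of "fst p" "snd p"] by (simp add: case_prod_unfold)
  qed
  also have "\<dots> = (`) phi ` removed B" unfolding removed_def image_image by (simp add: case_prod_unfold)
  finally show ?thesis .
qed

lemma phi_int_chain_inj:
  assumes B: "B \<in> N"
  shows "inj_on (\<lambda>(D, w). phi ` int_chain B D w) (pairs B)"
proof -
  have "removed B \<subseteq> Pow (uni_interval B)" using removed_max(2)[OF B] by blast
  then have "inj_on ((`) phi \<circ> (\<lambda>(D, w). int_chain B D w)) (pairs B)"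
    using inj_on_subset[OF inj_on_image_Pow[OF phi_uni_inj]] unfolding removed_def
    by (intro comp_inj_on[OF int_chain_inj[OF B]])
  then show ?thesis by (simp add: comp_def case_prod_unfold)
qed

lemma sat_chain_inj:
  assumes B: "B \<in> N"
  shows "inj_on (\<lambda>(D, w). sat_chain B D w) (pairs B)"
proof (rule inj_onI)
  fix x y assume x: "x \<in> pairs B" and y: "y \<in> pairs B"
    and eq: "(\<lambda>(D, w). sat_chain B D w) x = (\<lambda>(D, w). sat_chain B D w) y"
  have "(\<lambda>(D, w). phi ` int_chain B D w) z = (\<lambda>(D, w). sat_chain B D w) z - {UNIV, diag_subspace B}"
    if "z \<in> pairs B" for z
    using sat_chain_interior[OF B, of "fst z" "snd z"] that by (simp add: case_prod_unfold)
  then have "(\<lambda>(D, w). phi ` int_chain B D w) x = (\<lambda>(D, w). phi ` int_chain B D w) y"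
    using x y eq by metis
  then show "x = y" by (rule inj_onD[OF phi_int_chain_inj[OF B] _ x y])
qed

lemma card_removed:
  assumes B: "B \<in> N"
  shows "card {s \<in> (`) phi ` removed B. int (card s) - 1 = d}
    = (\<Sum>D\<in>{D. shelling_trapped_decomp Fs B D \<and> decomp_dim D B = d}. fact (card D - 1))"
proof -
  let ?A = "{D. shelling_trapped_decomp Fs B D \<and> decomp_dim D B = d}"
  let ?f = "\<lambda>(D, w). phi ` int_chain B D w"
  let ?P = "Sigma ?A (\<lambda>D. {w. w permutes {1..card D - 1}})"
  have sub: "?P \<subseteq> pairs B" unfolding pairs_def by auto
  have dimf: "int (card (?f p)) - 1 = decomp_dim (fst p) B" if p: "p \<in> pairs B" for p
  proof -
    note c = int_chain_props[OF B, of "fst p" "snd p"]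
    have "card (phi ` int_chain B (fst p) (snd p)) = card (int_chain B (fst p) (snd p))"
      by (rule card_image[OF inj_on_subset[OF phi_uni_inj c(2)]]) (use p in simp)
    then show ?thesis using c(3) p by (simp add: case_prod_unfold)
  qed
  have img: "(`) phi ` removed B = ?f ` pairs B" unfolding removed_def image_image by (simp add: case_prod_unfold)
  have "{s \<in> (`) phi ` removed B. int (card s) - 1 = d} = ?f ` {p \<in> pairs B. decomp_dim (fst p) B = d}"
    unfolding img using dimf by (auto simp: image_iff)
  also have "{p \<in> pairs B. decomp_dim (fst p) B = d} = ?P" unfolding pairs_def by auto
  finally have "card {s \<in> (`) phi ` removed B. int (card s) - 1 = d} = card ?P"
    using card_image[OF inj_on_subset[OF phi_int_chain_inj[OF B] sub]] by simp
  also have "\<dots> = (\<Sum>D\<in>?A. card {w. w permutes {1..card D - 1}})"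
    by (rule card_SigmaI) (auto intro: finite_permutations)
  also have "\<dots> = (\<Sum>D\<in>?A. fact (card D - 1))"
    by (rule sum.cong[OF HOL.refl]) (rule card_permutations, simp_all)
  finally show ?thesis .
qed

end

theorem theorem4p1:
  fixes \<Delta> :: "('n::finite) set set" and Fs :: "'n set list" and \<sigma>bar :: "'n set"
  assumes cx: "simplicial_complex \<Delta>"
    and dim: "\<forall>F\<in>\<Delta>. int (card F) - 1 \<le> int CARD('n) - 3"
    and sh: "shelling \<Delta> Fs"
    and inL: "diag_subspace \<sigma>bar \<in> intersection_lattice \<Delta>"
    and nonbot: "diag_subspace \<sigma>bar \<noteq> UNIV"
  shows "(\<exists>ds. (\<forall>d. count (mset ds) d =
              (\<Sum>D\<in>{D. shelling_trapped_decomp Fs \<sigma>bar D \<and> decomp_dim D \<sigma>bar = d}.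
                  fact (card D - 1)))
            \<and> geom_realization (order_complex_interval \<Delta> (diag_subspace \<sigma>bar))
                homotopy_equivalent_space wedge_of_spheres ds)
       \<and> (\<exists>C. (\<forall>D w. shelling_trapped_decomp Fs \<sigma>bar D \<and> w permutes {1..card D - 1} \<longrightarrow>
                 saturated_chain \<Delta> (diag_subspace \<sigma>bar) (C D w) \<and>
                 C D w - {UNIV, diag_subspace \<sigma>bar}
                   \<in> order_complex_interval \<Delta> (diag_subspace \<sigma>bar) \<and>
                 int (card (C D w - {UNIV, diag_subspace \<sigma>bar})) = decomp_dim D \<sigma>bar + 1)
            \<and> inj_on (\<lambda>(D, w). C D w)
                {(D, w). shelling_trapped_decomp Fs \<sigma>bar D \<and> w permutes {1..card D - 1}}
            \<and> simplicial_complex (order_complex_interval \<Delta> (diag_subspace \<sigma>bar) -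
                 {C D w - {UNIV, diag_subspace \<sigma>bar} | D w.
                    shelling_trapped_decomp Fs \<sigma>bar D \<and> w permutes {1..card D - 1}})
            \<and> contractible_space (geom_realization (order_complex_interval \<Delta> (diag_subspace \<sigma>bar) -
                 {C D w - {UNIV, diag_subspace \<sigma>bar} | D w.
                    shelling_trapped_decomp Fs \<sigma>bar D \<and> w permutes {1..card D - 1}})))"
proof -
  interpret shelled_complex \<Delta> Fs by (rule shelled_complex.intro[OF cx dim sh])
  let ?U = "diag_subspace \<sigma>bar"
  have B: "\<sigma>bar \<in> N" by (rule block_in_N[OF inL nonbot])
  have facets: "(`) phi ` removed \<sigma>bar \<subseteq> facets (order_complex_interval \<Delta> ?U)" by (rule removed_facets[OF B])
  show ?thesis
  proof (intro conjI)
    have "finite ((`) phi ` removed \<sigma>bar)" by (rule finite_imageI[OF finite])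
    from finite_distinct_list[OF this] obtain ss where ss: "set ss = (`) phi ` removed \<sigma>bar" "distinct ss"
      by (elim exE conjE)
    show "\<exists>ds. (\<forall>d. count (mset ds) d =
              (\<Sum>D\<in>{D. shelling_trapped_decomp Fs \<sigma>bar D \<and> decomp_dim D \<sigma>bar = d}. fact (card D - 1)))
            \<and> geom_realization (order_complex_interval \<Delta> ?U) homotopy_equivalent_space wedge_of_spheres ds"
    proof (intro exI conjI allI)
      show "geom_realization (order_complex_interval \<Delta> ?U)
          homotopy_equivalent_space wedge_of_spheres (map (\<lambda>s. int (card s) - 1) ss)"
        by (rule interval_wedge[OF B ss(2,1)])
      show "count (mset (map (\<lambda>s. int (card s) - 1) ss)) d =
          (\<Sum>D\<in>{D. shelling_trapped_decomp Fs \<sigma>bar D \<and> decomp_dim D \<sigma>bar = d}. fact (card D - 1))" for d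
        unfolding count_map_distinct[OF ss(2)] ss(1) by (rule card_removed[OF B])
    qed
    show "\<exists>C. (\<forall>D w. shelling_trapped_decomp Fs \<sigma>bar D \<and> w permutes {1..card D - 1} \<longrightarrow>
                 saturated_chain \<Delta> ?U (C D w) \<and>
                 C D w - {UNIV, ?U} \<in> order_complex_interval \<Delta> ?U \<and>
                 int (card (C D w - {UNIV, ?U})) = decomp_dim D \<sigma>bar + 1)
            \<and> inj_on (\<lambda>(D, w). C D w)
                {(D, w). shelling_trapped_decomp Fs \<sigma>bar D \<and> w permutes {1..card D - 1}}
            \<and> simplicial_complex (order_complex_interval \<Delta> ?U -
                 {C D w - {UNIV, ?U} | D w. shelling_trapped_decomp Fs \<sigma>bar D \<and> w permutes {1..card D - 1}})
            \<and> contractible_space (geom_realization (order_complex_interval \<Delta> ?U -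
                 {C D w - {UNIV, ?U} | D w. shelling_trapped_decomp Fs \<sigma>bar D \<and> w permutes {1..card D - 1}}))"
    proof (rule exI[of _ "sat_chain \<sigma>bar"], unfold sat_chain_interiors[OF B], intro conjI)
      show "inj_on (\<lambda>(D, w). sat_chain \<sigma>bar D w)
          {(D, w). shelling_trapped_decomp Fs \<sigma>bar D \<and> w permutes {1..card D - 1}}"
        using sat_chain_inj[OF B] unfolding pairs_def .
      show "simplicial_complex (order_complex_interval \<Delta> ?U - (`) phi ` removed \<sigma>bar)"
        using simplicial_complex_diff_facets[OF simplicial_complex_chains] facets unfolding interval_complex[OF B] .
      show "contractible_space (geom_realization (order_complex_interval \<Delta> ?U - (`) phi ` removed \<sigma>bar))"
        by (rule residue_contractible'[OF B])
      show "\<forall>D w. shelling_trapped_decomp Fs \<sigma>bar D \<and> w permutes {1..card D - 1} \<longrightarrow>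
                 saturated_chain \<Delta> ?U (sat_chain \<sigma>bar D w) \<and>
                 sat_chain \<sigma>bar D w - {UNIV, ?U} \<in> order_complex_interval \<Delta> ?U \<and>
                 int (card (sat_chain \<sigma>bar D w - {UNIV, ?U})) = decomp_dim D \<sigma>bar + 1"
      proof (intro allI impI)
        fix D w assume "shelling_trapped_decomp Fs \<sigma>bar D \<and> w permutes {1..card D - 1}"
        then have p: "(D, w) \<in> pairs \<sigma>bar" unfolding pairs_def by simp
        then have "int_chain \<sigma>bar D w \<in> removed \<sigma>bar" unfolding removed_def by force
        then have "phi ` int_chain \<sigma>bar D w \<in> order_complex_interval \<Delta> ?U"
          using facets unfolding facets_def by blast
        moreover have "card (phi ` int_chain \<sigma>bar D w) = card (int_chain \<sigma>bar D w)"
          by (rule card_image[OF inj_on_subset[OF phi_uni_inj int_chain_props(2)[OF B p]]])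
        ultimately show "saturated_chain \<Delta> ?U (sat_chain \<sigma>bar D w) \<and>
                 sat_chain \<sigma>bar D w - {UNIV, ?U} \<in> order_complex_interval \<Delta> ?U \<and>
                 int (card (sat_chain \<sigma>bar D w - {UNIV, ?U})) = decomp_dim D \<sigma>bar + 1"
          unfolding sat_chain_interior[OF B p]
          using sat_chain_saturated[OF B inL p] int_chain_props(3)[OF B p] by simp
      qed
    qed
  qed
qed

end
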